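(* Let $\mathfrak{g}$ be a simply laced simple Lie algebra over $\mathbb{C}$ of rank $n$ with Serre generators $e_i,f_i,h_i$ ($1\le i\le n$), labelled as in Kac's book. Let $\omega_p$ be a minuscule fundamental weight of $\mathfrak{g}$, let $L_p$ be the irreducible $\mathfrak{g}$-module of highest weight $\omega_p$, and let $P$ be the minuscule poset such that the poset of weights of $L_p$ is isomorphic to $J(P)$. Let $\mathfrak{k}$ be the subalgebra of $\mathfrak{g}$ generated by $\{e_i,f_i,h_i:1\le i\le n,\ i\ne p\}$. Then the restriction of $L_p$ to $\mathfrak{k}$ decomposes as a direct sum $\bigoplus_{i=0}^{k}V_i$, where $k=\mathrm{width}(P)$ and, for each $0\le i\le k$, $V_i$ is a simple $\mathfrak{k}$-module whose poset of weights is isomorphic to $(\mathcal{A}_i(P),\le_i)$.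
   Context: The possible pairs (type of $\mathfrak{g}$, $p$) and the corresponding posets $P$ are: type $A_n$, $p=k\in[n]$, $P\cong[k]\times[n+1-k]$; type $D_n$, $p=1$, $P\cong J^{n-3}([2]\times[2])$; type $D_n$, $p\in\{n-1,n\}$, $P\cong J([n-2]\times[2])$; type $E_6$, $p\in\{1,5\}$, $P\cong J^2([2]\times[3])$; type $E_7$, $p=6$, $P\cong J^3([2]\times[3])$. Here $[m]=\{1,\dots,m\}$, products carry the product order, $J(Q)$ is the poset of order ideals of $Q$ under inclusion, and $J^{m}$ is the $m$-fold iterate of $J$ ($J^0(Q)=Q$). The poset of weights of a finite-dimensional module is its set of weights ordered by $\lambda\le\mu$ iff $\mu-\lambda$ is a nonnegative integer combination of the simple roots of the algebra in question ($\mathfrak{g}$ for $L_p$, $\mathfrak{k}$ for the $V_i$). $\mathrm{width}(P)$ is the maximum size of an antichain in $P$; $\mathcal{A}_i(P)$ is the set of antichains of $P$ of size $i$, and for $A,B\in\mathcal{A}_i(P)$, $A\prec_i B$ means $A\setminus B=\{a\}$, $B\setminus A=\{b\}$ are singletons with $a<_P b$, with $\le_i$ the reflexive transitive closure of $\prec_i$. *)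

theory Defs
  imports "HOL-Analysis.Analysis"
begin

text \<open>A generalized Cartan matrix indexed by 1..n, entries a i j = alpha_j(h_i).
  Simply laced simple Lie algebras of rank n correspond exactly to symmetric
  indecomposable positive definite Cartan matrices with off-diagonal entries in {0,-1}.\<close>

definition simply_laced_finite_cartan :: "nat \<Rightarrow> (nat \<Rightarrow> nat \<Rightarrow> int) \<Rightarrow> bool" where
  "simply_laced_finite_cartan n a \<longleftrightarrow>
     n \<ge> 1 \<and>
     (\<forall>i\<in>{1..n}. a i i = 2) \<and>
     (\<forall>i\<in>{1..n}. \<forall>j\<in>{1..n}. i \<noteq> j \<longrightarrow> a i j \<in> {0, -1} \<and> a j i = a i j) \<and>
     (\<forall>S. S \<subseteq> {1..n} \<and> S \<noteq> {} \<and> S \<noteq> {1..n} \<longrightarrow>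
          (\<exists>i\<in>S. \<exists>j\<in>{1..n} - S. a i j \<noteq> 0)) \<and>
     (\<forall>x :: nat \<Rightarrow> real. (\<exists>i\<in>{1..n}. x i \<noteq> 0) \<longrightarrow>
          (\<Sum>i=1..n. \<Sum>j=1..n. of_int (a i j) * x i * x j) > 0)"

definition comm :: "complex^'d^'d \<Rightarrow> complex^'d^'d \<Rightarrow> complex^'d^'d" where
  "comm A B = A ** B - B ** A"

text \<open>Operators E i, F i, H i (i in 1..n) on the finite-dimensional complex space
  complex^'d satisfying the Serre relations, i.e. a representation of the Lie algebra
  with Cartan matrix a (Serre's theorem).\<close>

definition serre_rep ::
  "nat \<Rightarrow> (nat \<Rightarrow> nat \<Rightarrow> int) \<Rightarrow> (nat \<Rightarrow> complex^'d^'d) \<Rightarrow> (nat \<Rightarrow> complex^'d^'d)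
     \<Rightarrow> (nat \<Rightarrow> complex^'d^'d) \<Rightarrow> bool" where
  "serre_rep n a E F H \<longleftrightarrow>
    (\<forall>i\<in>{1..n}. \<forall>j\<in>{1..n}.
       comm (H i) (H j) = 0 \<and>
       comm (H i) (E j) = (of_int (a i j) :: real) *\<^sub>R E j \<and>
       comm (H i) (F j) = (- of_int (a i j) :: real) *\<^sub>R F j \<and>
       comm (E i) (F j) = (if i = j then H i else 0) \<and>
       (i \<noteq> j \<longrightarrow> ((comm (E i)) ^^ nat (1 - a i j)) (E j) = 0) \<and>
       (i \<noteq> j \<longrightarrow> ((comm (F i)) ^^ nat (1 - a i j)) (F j) = 0))"

definition csubspace :: "(complex^'d) set \<Rightarrow> bool" where
  "csubspace W \<longleftrightarrow> 0 \<in> W \<and> (\<forall>x\<in>W. \<forall>y\<in>W. x + y \<in> W) \<and> (\<forall>c::complex. \<forall>x\<in>W. c *s x \<in> W)"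

definition invariant ::
  "nat set \<Rightarrow> (nat \<Rightarrow> complex^'d^'d) \<Rightarrow> (nat \<Rightarrow> complex^'d^'d) \<Rightarrow> (nat \<Rightarrow> complex^'d^'d)
     \<Rightarrow> (complex^'d) set \<Rightarrow> bool" where
  "invariant I E F H W \<longleftrightarrow>
     (\<forall>i\<in>I. \<forall>x\<in>W. E i *v x \<in> W \<and> F i *v x \<in> W \<and> H i *v x \<in> W)"

text \<open>W is a simple module for the subalgebra generated by e_i, f_i, h_i, i in I.\<close>
definition simple_submodule ::
  "nat set \<Rightarrow> (nat \<Rightarrow> complex^'d^'d) \<Rightarrow> (nat \<Rightarrow> complex^'d^'d) \<Rightarrow> (nat \<Rightarrow> complex^'d^'d)
     \<Rightarrow> (complex^'d) set \<Rightarrow> bool" where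
  "simple_submodule I E F H W \<longleftrightarrow>
     csubspace W \<and> invariant I E F H W \<and> W \<noteq> {0} \<and>
     (\<forall>U. csubspace U \<and> U \<subseteq> W \<and> invariant I E F H U \<longrightarrow> U = {0} \<or> U = W)"

text \<open>Weights of W with respect to the Cartan elements h_i, i in I; a weight is recorded
  as the function i \<mapsto> mu(h_i) (and 0 outside I).\<close>
definition weights_of ::
  "nat set \<Rightarrow> (nat \<Rightarrow> complex^'d^'d) \<Rightarrow> (complex^'d) set \<Rightarrow> (nat \<Rightarrow> complex) set" where
  "weights_of I H W = {\<mu>. (\<forall>i. i \<notin> I \<longrightarrow> \<mu> i = 0) \<and>
       (\<exists>v\<in>W. v \<noteq> 0 \<and> (\<forall>i\<in>I. H i *v v = \<mu> i *s v))}"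

text \<open>lambda \<le> mu iff mu - lambda is a nonnegative integer combination of the simple
  roots alpha_j (j in I), where alpha_j(h_i) = a i j.\<close>
definition weight_le :: "nat set \<Rightarrow> (nat \<Rightarrow> nat \<Rightarrow> int) \<Rightarrow> (nat \<Rightarrow> complex) \<Rightarrow> (nat \<Rightarrow> complex) \<Rightarrow> bool" where
  "weight_le I a \<nu> \<mu> \<longleftrightarrow>
     (\<exists>c :: nat \<Rightarrow> nat. \<forall>i\<in>I. \<mu> i - \<nu> i = (\<Sum>j\<in>I. of_nat (c j) * of_int (a i j)))"

definition fund_weight :: "nat \<Rightarrow> nat \<Rightarrow> complex" where
  "fund_weight p = (\<lambda>j. if j = p then 1 else 0)"

text \<open>Weyl group orbit, generated by simple reflections
  s_i(mu)(h_j) = mu(h_j) - mu(h_i) alpha_i(h_j).\<close>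
inductive_set weyl_orbit :: "nat \<Rightarrow> (nat \<Rightarrow> nat \<Rightarrow> int) \<Rightarrow> (nat \<Rightarrow> complex) \<Rightarrow> (nat \<Rightarrow> complex) set"
  for n a w0 where
  base: "w0 \<in> weyl_orbit n a w0"
| refl_step: "\<mu> \<in> weyl_orbit n a w0 \<Longrightarrow> i \<in> {1..n} \<Longrightarrow>
     (\<lambda>j. if j \<in> {1..n} then \<mu> j - \<mu> i * of_int (a j i) else \<mu> j) \<in> weyl_orbit n a w0"

definition partial_order_on' :: "'p set \<Rightarrow> ('p \<Rightarrow> 'p \<Rightarrow> bool) \<Rightarrow> bool" where
  "partial_order_on' P le \<longleftrightarrow>
     (\<forall>x\<in>P. le x x) \<and> (\<forall>x\<in>P. \<forall>y\<in>P. le x y \<and> le y x \<longrightarrow> x = y) \<and>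
     (\<forall>x\<in>P. \<forall>y\<in>P. \<forall>z\<in>P. le x y \<and> le y z \<longrightarrow> le x z)"

definition order_ideals :: "'p set \<Rightarrow> ('p \<Rightarrow> 'p \<Rightarrow> bool) \<Rightarrow> 'p set set" where
  "order_ideals P le = {S. S \<subseteq> P \<and> (\<forall>x\<in>S. \<forall>y\<in>P. le y x \<longrightarrow> y \<in> S)}"

definition antichain :: "'p set \<Rightarrow> ('p \<Rightarrow> 'p \<Rightarrow> bool) \<Rightarrow> 'p set \<Rightarrow> bool" where
  "antichain P le A \<longleftrightarrow> A \<subseteq> P \<and> (\<forall>x\<in>A. \<forall>y\<in>A. le x y \<longrightarrow> x = y)"

definition width :: "'p set \<Rightarrow> ('p \<Rightarrow> 'p \<Rightarrow> bool) \<Rightarrow> nat" where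
  "width P le = Max {card A | A. antichain P le A}"

definition antichains_size :: "'p set \<Rightarrow> ('p \<Rightarrow> 'p \<Rightarrow> bool) \<Rightarrow> nat \<Rightarrow> 'p set set" where
  "antichains_size P le i = {A. antichain P le A \<and> card A = i}"

definition antichain_prec :: "'p set \<Rightarrow> ('p \<Rightarrow> 'p \<Rightarrow> bool) \<Rightarrow> nat \<Rightarrow> 'p set \<Rightarrow> 'p set \<Rightarrow> bool" where
  "antichain_prec P le i A B \<longleftrightarrow>
     A \<in> antichains_size P le i \<and> B \<in> antichains_size P le i \<and>
     (\<exists>x y. A - B = {x} \<and> B - A = {y} \<and> le x y \<and> x \<noteq> y)"

definition antichain_le :: "'p set \<Rightarrow> ('p \<Rightarrow> 'p \<Rightarrow> bool) \<Rightarrow> nat \<Rightarrow> 'p set \<Rightarrow> 'p set \<Rightarrow> bool" where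
  "antichain_le P le i = (antichain_prec P le i)\<^sup>*\<^sup>*"

definition order_iso :: "'a set \<Rightarrow> ('a \<Rightarrow> 'a \<Rightarrow> bool) \<Rightarrow> 'b set \<Rightarrow> ('b \<Rightarrow> 'b \<Rightarrow> bool) \<Rightarrow> bool" where
  "order_iso X R Y S \<longleftrightarrow> (\<exists>f. bij_betw f X Y \<and> (\<forall>x\<in>X. \<forall>y\<in>X. R x y \<longleftrightarrow> S (f x) (f y)))"

end

(*
Write the weights of L_p as omega_p - c with c in the root lattice. Minuscularity means that
|omega_p - c| >= |omega_p| for all lattice vectors c, with equality exactly at the weights, and each
weight space has dimension one. The generators of k do not change c_p, and V_i is the span
of the weight vectors with c_p = i. The weights form a lattice under componentwise minimum,
hence any two weights with the same c_p are joined by simple steps in directions j ~= p, and V_i is simple.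

Let Phi1 be the set of roots whose coefficient at p is 1. Two things are needed:
  - every weight is omega_p minus the sum of a unique antichain of Phi1, whose size is c_p. Existence:
    c is a sum of orthogonal roots, and of all such sums one with the least sum of squared heights is an
    antichain, because two comparable orthogonal roots can be uncrossed. Covers in V_i
    replace one root a of the antichain by a + alpha_j.
  - Phi1, reversed, is isomorphic to P: sending a weight w(omega_p), w of minimal length, to the set of the roots
    in Phi1 made negative by w is an isomorphism onto the order ideals of Phi1, and J(P) determines P.
*)
theory Submission
  imports Defs "HOL-Library.Function_Algebras"
begin

text \<open>The hypothesis only places the weights of the module in a Weyl group orbit, while the
  combinatorics needs the norm inequality on the whole lattice. A weight pairs to -1, 0 or 1 with
  each simple root, and F_i acts nontrivially where the pairing is 1. So one can walk greedily from
  omega_p towards a lattice vector, and once no step is left the norm can only grow.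

  Weight vectors and Weyl group elements are both built along chains of simple steps from omega_p,
  and the chain is a choice. Two different last steps i and j of chains to the same c force
  \<open>a i j = 0\<close>, so the operators commute and the choice does not matter. One polymorphic
  construction, \<open>path_state\<close>, serves both cases.

  Since c measures how far a weight lies below omega_p, the order of weights is the reverse of the
  componentwise order; this is the reason for the complements and converses further on. Isomorphism
  types are never classified: \<open>P\<close> is reached only through its order ideals.\<close>

definition unit_vec :: "nat \<Rightarrow> nat \<Rightarrow> int" where
  "unit_vec i = (\<lambda>j. if j = i then 1 else 0)"

lemma unit_vec_apply: "unit_vec i j = (if j = i then 1 else 0)"
  by (simp add: unit_vec_def)

lemma minus_fun_apply [simp]: "(f - g) x = f x - (g x :: 'b::ab_group_add)"
  by (simp add: fun_diff_def)

lemma uminus_fun_apply [simp]: "(- f) x = - (f x :: 'b::ab_group_add)"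
  by (simp add: fun_Compl_def)

lemma sum_fun_apply: "(\<Sum>x\<in>A. f x) i = (\<Sum>x\<in>A. f x i :: int)"
  by (induction A rule: infinite_finite_induct) auto

subsection \<open>Root lattice\<close>

locale cartan_form =
  fixes n :: nat and a :: "nat \<Rightarrow> nat \<Rightarrow> int"
  assumes cartan: "simply_laced_finite_cartan n a"
begin

text \<open>The root lattice in coordinates of the simple roots: \<open>unit_vec i\<close> is
  alpha_i, and \<open>ip\<close> is the invariant form in which simple roots have square length
  2.\<close>

definition lattice :: "(nat \<Rightarrow> int) set" where
  "lattice = {x. \<forall>i. i \<notin> {1..n} \<longrightarrow> x i = 0}"

definition ip :: "(nat \<Rightarrow> int) \<Rightarrow> (nat \<Rightarrow> int) \<Rightarrow> int" where
  "ip x y = (\<Sum>i=1..n. \<Sum>j=1..n. a i j * x i * y j)"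

lemmas cartan_conj = cartan[unfolded simply_laced_finite_cartan_def]

lemma a_diag: "i \<in> {1..n} \<Longrightarrow> a i i = 2"
  using cartan_conj[THEN conjunct2, THEN conjunct1] by blast

lemma a_off_sym: "i \<in> {1..n} \<Longrightarrow> j \<in> {1..n} \<Longrightarrow> i \<noteq> j \<Longrightarrow> a i j \<in> {0, -1} \<and> a j i = a i j"
  using cartan_conj[THEN conjunct2, THEN conjunct2, THEN conjunct1] by blast

lemma a_off: "i \<in> {1..n} \<Longrightarrow> j \<in> {1..n} \<Longrightarrow> i \<noteq> j \<Longrightarrow> a i j = 0 \<or> a i j = -1"
  using a_off_sym by blast

lemma a_sym: "i \<in> {1..n} \<Longrightarrow> j \<in> {1..n} \<Longrightarrow> a i j = a j i"
  using a_off_sym by (cases "i = j") auto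

lemma ip_add_left: "ip (x + y) z = ip x z + ip y z"
  by (simp add: ip_def algebra_simps sum.distrib)

lemma ip_add_right: "ip z (x + y) = ip z x + ip z y"
  by (simp add: ip_def algebra_simps sum.distrib)

lemma ip_diff_left: "ip (x - y) z = ip x z - ip y z"
  by (simp add: ip_def algebra_simps sum_subtractf)

lemma ip_diff_right: "ip z (x - y) = ip z x - ip z y"
  by (simp add: ip_def algebra_simps sum_subtractf)

lemma ip_minus_left: "ip (- x) z = - ip x z"
  by (simp add: ip_def sum_negf)

lemma ip_minus_right: "ip z (- x) = - ip z x"
  by (simp add: ip_def sum_negf)

lemma ip_zero_left: "ip 0 z = 0"
  by (simp add: ip_def)

lemma ip_zero_right: "ip z 0 = 0"
  by (simp add: ip_def)

lemmas ip_bilinear = ip_add_left ip_add_right ip_diff_left ip_diff_right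
  ip_minus_left ip_minus_right ip_zero_left ip_zero_right

lemma ip_scale_left: "ip (\<lambda>k. m * x k) y = m * ip x y"
  by (simp add: ip_def sum_distrib_left mult_ac)

lemma ip_sum_left: "ip (\<Sum>x\<in>A. f x) z = (\<Sum>x\<in>A. ip (f x) z)"
  by (induction A rule: infinite_finite_induct) (auto simp: ip_zero_left ip_add_left simp del: plus_fun_apply zero_fun_apply)

lemma ip_sum_right: "ip z (\<Sum>x\<in>A. f x) = (\<Sum>x\<in>A. ip z (f x))"
  by (induction A rule: infinite_finite_induct) (auto simp: ip_zero_right ip_add_right simp del: plus_fun_apply zero_fun_apply)

lemma ip_sym: "ip x y = ip y x"
  unfolding ip_def
  by (subst sum.swap, intro sum.cong refl) (simp add: a_sym mult.commute mult.left_commute)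

lemma ip_unit_right:
  assumes "i \<in> {1..n}"
  shows "ip x (unit_vec i) = (\<Sum>j=1..n. a i j * x j)"
proof -
  have "(\<Sum>j=1..n. a k j * x k * unit_vec i j) = a k i * x k" for k
    using assms by (simp add: unit_vec_apply if_distrib[of "\<lambda>t. _ * t"] sum.delta' cong: if_cong)
  then have "ip x (unit_vec i) = (\<Sum>k=1..n. a k i * x k)"
    by (simp add: ip_def)
  also have "\<dots> = (\<Sum>j=1..n. a i j * x j)"
    using assms by (intro sum.cong refl) (simp add: a_sym)
  finally show ?thesis .
qed

lemma ip_expand: "ip x y = (\<Sum>i=1..n. y i * ip x (unit_vec i))"
proof -
  have "ip x y = (\<Sum>i=1..n. \<Sum>j=1..n. a j i * x j * y i)"
    unfolding ip_def by (rule sum.swap)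
  also have "\<dots> = (\<Sum>i=1..n. y i * ip x (unit_vec i))"
    by (intro sum.cong refl) (simp add: ip_unit_right sum_distrib_left a_sym mult_ac)
  finally show ?thesis .
qed

lemma ip_unit_unit:
  assumes "i \<in> {1..n}" "j \<in> {1..n}"
  shows "ip (unit_vec i) (unit_vec j) = a i j"
proof -
  have "ip (unit_vec i) (unit_vec j) = (\<Sum>k=1..n. a j k * unit_vec i k)"
    by (rule ip_unit_right) fact
  also have "\<dots> = a j i"
    using assms by (simp add: unit_vec_apply if_distrib[of "\<lambda>t. _ * t"] sum.delta' cong: if_cong)
  finally show ?thesis using assms by (simp add: a_sym)
qed

lemma ip_unit_self: "i \<in> {1..n} \<Longrightarrow> ip (unit_vec i) (unit_vec i) = 2"
  by (simp add: ip_unit_unit a_diag)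

lemma ip_pos:
  assumes "x \<in> lattice" "x \<noteq> 0"
  shows "ip x x > 0"
proof -
  obtain i where "x i \<noteq> 0" using assms(2) by (auto simp: fun_eq_iff)
  with assms(1) have "\<exists>i\<in>{1..n}. real_of_int (x i) \<noteq> 0"
    unfolding lattice_def by (intro bexI[of _ i]) auto
  with cartan_conj[THEN conjunct2, THEN conjunct2, THEN conjunct2, THEN conjunct2]
  have "(\<Sum>i=1..n. \<Sum>j=1..n. of_int (a i j) * real_of_int (x i) * real_of_int (x j)) > 0"
    by (elim allE[where x="\<lambda>i. real_of_int (x i)"]) blast
  also have "(\<Sum>i=1..n. \<Sum>j=1..n. of_int (a i j) * real_of_int (x i) * real_of_int (x j)) = of_int (ip x x)"
    by (simp add: ip_def)
  finally show ?thesis by simp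
qed

lemma ip_nonneg: "x \<in> lattice \<Longrightarrow> ip x x \<ge> 0"
  using ip_pos[of x] by (cases "x = 0") (auto simp: ip_zero_left)

lemma ip_eq_0D: "x \<in> lattice \<Longrightarrow> ip x x = 0 \<Longrightarrow> x = 0"
  using ip_pos[of x] by (cases "x = 0") auto

lemma lattice_add: "x \<in> lattice \<Longrightarrow> y \<in> lattice \<Longrightarrow> x + y \<in> lattice"
  and lattice_diff: "x \<in> lattice \<Longrightarrow> y \<in> lattice \<Longrightarrow> x - y \<in> lattice"
  and lattice_uminus: "x \<in> lattice \<Longrightarrow> - x \<in> lattice"
  and lattice_zero: "0 \<in> lattice"
  and lattice_unit: "i \<in> {1..n} \<Longrightarrow> unit_vec i \<in> lattice"
  by (auto simp: lattice_def unit_vec_apply)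

lemma lattice_sum: "(\<And>x. x \<in> A \<Longrightarrow> f x \<in> lattice) \<Longrightarrow> (\<Sum>x\<in>A. f x) \<in> lattice"
  by (induction A rule: infinite_finite_induct) (auto simp: lattice_zero lattice_add simp del: plus_fun_apply zero_fun_apply)

lemmas lattice_intros = lattice_add lattice_diff lattice_uminus lattice_zero lattice_unit

text \<open>Off-diagonal terms come in equal pairs and the diagonal entries are 2. The induction
  borders a square block by one row and one column.\<close>

lemma ip_even: "even (ip x x)"
proof -
  have "even (\<Sum>i=1..m. \<Sum>j=1..m. a i j * x i * x j)" if "m \<le> n" for m
    using that
  proof (induction m)
    case (Suc m)
    have "(\<Sum>i=1..Suc m. \<Sum>j=1..Suc m. a i j * x i * x j) =
      (\<Sum>i=1..m. \<Sum>j=1..m. a i j * x i * x j) + (\<Sum>i=1..m. a i (Suc m) * x i * x (Suc m))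
      + (\<Sum>j=1..m. a (Suc m) j * x (Suc m) * x j) + a (Suc m) (Suc m) * x (Suc m) * x (Suc m)"
      by (simp add: sum.distrib)
    moreover have "(\<Sum>j=1..m. a (Suc m) j * x (Suc m) * x j) = (\<Sum>i=1..m. a i (Suc m) * x i * x (Suc m))"
      using Suc.prems by (intro sum.cong refl) (simp add: a_sym[of "Suc m"])
    ultimately show ?case using Suc by (simp add: a_diag)
  qed simp
  then show ?thesis unfolding ip_def by simp
qed

lemma ip_ge_2: "x \<in> lattice \<Longrightarrow> x \<noteq> 0 \<Longrightarrow> ip x x \<ge> 2"
  using ip_pos[of x] ip_even[of x] by (smt (verit) odd_one)

text \<open>Disjoint supports meet only off-diagonal entries of the Cartan matrix, which are 0 or
  -1.\<close>

lemma ip_disjoint_le_0: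
  assumes "0 \<le> x" "0 \<le> y" "\<And>i. x i = 0 \<or> y i = 0"
  shows "ip x y \<le> 0"
  unfolding ip_def
proof (intro sum_nonpos)
  fix i j assume ij: "i \<in> {1..n}" "j \<in> {1..n}"
  have "0 \<le> x i" "0 \<le> y j" using assms(1,2) by (auto simp: le_fun_def)
  then show "a i j * x i * y j \<le> 0"
    using a_off[OF ij] assms(3)[of i] by (cases "i = j") auto
qed

definition pos_part :: "(nat \<Rightarrow> int) \<Rightarrow> nat \<Rightarrow> int" where
  "pos_part x = (\<lambda>i. max (x i) 0)"

lemma pos_part_nonneg: "0 \<le> pos_part x"
  and pos_part_diff: "pos_part x - pos_part (- x) = x"
  and pos_part_disjoint: "pos_part x i = 0 \<or> pos_part (- x) i = 0"
  and pos_part_lattice: "x \<in> lattice \<Longrightarrow> pos_part x \<in> lattice"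
  by (auto simp: pos_part_def le_fun_def lattice_def)

lemma pos_part_eq_0: "pos_part x = 0 \<longleftrightarrow> x \<le> 0"
  by (auto simp: pos_part_def le_fun_def fun_eq_iff max_def)

lemma ip_pos_part: "ip x x \<ge> ip (pos_part x) (pos_part x) + ip (pos_part (- x)) (pos_part (- x))"
proof -
  have "ip x x = ip (pos_part x - pos_part (- x)) (pos_part x - pos_part (- x))"
    by (simp only: pos_part_diff)
  moreover have "ip (pos_part x) (pos_part (- x)) \<le> 0"
    by (rule ip_disjoint_le_0) (rule pos_part_nonneg pos_part_disjoint)+
  ultimately show ?thesis
    using ip_sym[of "pos_part x" "pos_part (- x)"] by (simp add: ip_diff_left ip_diff_right)
qed

text \<open>In a simply laced root lattice the vectors of square length 2 are exactly the
  roots.\<close>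

definition roots :: "(nat \<Rightarrow> int) set" where
  "roots = {x \<in> lattice. ip x x = 2}"

lemma rootsD: "x \<in> roots \<Longrightarrow> x \<in> lattice" "x \<in> roots \<Longrightarrow> ip x x = 2"
  by (auto simp: roots_def)

lemma root_uminus: "x \<in> roots \<Longrightarrow> - x \<in> roots"
  by (auto simp: roots_def lattice_intros ip_bilinear)

lemma root_unit: "i \<in> {1..n} \<Longrightarrow> unit_vec i \<in> roots"
  by (auto simp: roots_def lattice_intros ip_unit_self)

lemma root_nonzero: "x \<in> roots \<Longrightarrow> x \<noteq> 0"
  by (auto simp: roots_def ip_zero_left)

text \<open>If both the positive and the negative part were nonzero, each would contribute at least
  2 to a norm that is only 2.\<close>

lemma root_pos_or_neg:
  assumes "x \<in> roots"
  shows "0 \<le> x \<or> x \<le> 0"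
proof (rule ccontr)
  assume "\<not> ?thesis"
  then have "pos_part x \<noteq> 0" "pos_part (- x) \<noteq> 0"
    unfolding pos_part_eq_0 by (auto simp: le_fun_def)
  then have "ip (pos_part x) (pos_part x) \<ge> 2" "ip (pos_part (- x)) (pos_part (- x)) \<ge> 2"
    using assms by (auto intro!: ip_ge_2 pos_part_lattice lattice_intros dest: rootsD)
  then show False using ip_pos_part[of x] assms by (simp add: roots_def)
qed

lemma root_diff: "x \<in> roots \<Longrightarrow> y \<in> roots \<Longrightarrow> ip x y = 1 \<Longrightarrow> x - y \<in> roots"
  and root_add: "x \<in> roots \<Longrightarrow> y \<in> roots \<Longrightarrow> ip x y = -1 \<Longrightarrow> x + y \<in> roots"
  using ip_sym[of x y] by (auto simp: roots_def lattice_intros ip_bilinear)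

text \<open>\<open>x - y\<close> and \<open>x + y\<close> have norms \<open>4 - 2 * ip x y\<close>
  and \<open>4 + 2 * ip x y\<close>, both positive unless one of the vectors vanishes.\<close>

lemma root_ip_bounds:
  assumes "x \<in> roots" "y \<in> roots"
  shows "ip x y \<in> {-1, 0, 1} \<or> x = y \<or> x = - y"
proof -
  have s: "ip y x = ip x y" by (rule ip_sym)
  have 1: "ip (x - y) (x - y) = 4 - 2 * ip x y" "ip (x + y) (x + y) = 4 + 2 * ip x y"
    using assms s by (auto simp: roots_def ip_bilinear)
  have l: "x - y \<in> lattice" "x + y \<in> lattice"
    using assms by (auto simp: roots_def lattice_intros)
  consider "x - y = 0" | "x + y = 0" | "ip (x - y) (x - y) > 0" "ip (x + y) (x + y) > 0"
    using l ip_pos by blast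
  then show ?thesis
  proof cases
    case 3 then show ?thesis unfolding 1 by auto
  next
    case 2 then show ?thesis using eq_neg_iff_add_eq_0[of x y] by blast
  qed simp
qed

definition ht :: "(nat \<Rightarrow> int) \<Rightarrow> int" where
  "ht x = (\<Sum>i=1..n. x i)"

lemma ht_add: "ht (x + y) = ht x + ht y"
  and ht_diff: "ht (x - y) = ht x - ht y"
  and ht_zero: "ht 0 = 0"
  by (auto simp: ht_def sum.distrib sum_subtractf sum_negf)

lemma ht_unit: "i \<in> {1..n} \<Longrightarrow> ht (unit_vec i) = 1"
  by (simp add: ht_def unit_vec_apply)

lemma ht_mono: "x \<le> y \<Longrightarrow> ht x \<le> ht y"
  by (auto simp: ht_def le_fun_def intro: sum_mono)

lemma ht_eq_imp_eq:
  assumes "x \<le> y" "x \<in> lattice" "y \<in> lattice" "ht x = ht y"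
  shows "x = y"
proof
  fix i
  have "(\<Sum>i=1..n. y i - x i) = 0" using assms(4) by (simp add: ht_def sum_subtractf)
  then have "\<forall>i\<in>{1..n}. y i - x i = 0"
    using assms(1) by (subst (asm) sum_nonneg_eq_0_iff) (auto simp: le_fun_def)
  then show "x i = y i" using assms(2,3) by (cases "i \<in> {1..n}") (auto simp: lattice_def)
qed

lemma ht_strict_mono: "x \<le> y \<Longrightarrow> x \<noteq> y \<Longrightarrow> x \<in> lattice \<Longrightarrow> y \<in> lattice \<Longrightarrow> ht x < ht y"
  using ht_mono[of x y] ht_eq_imp_eq[of x y] by linarith

lemma ht_sum: "ht (\<Sum>x\<in>A. f x) = (\<Sum>x\<in>A. ht (f x))"
  by (induction A rule: infinite_finite_induct) (auto simp: ht_zero ht_add simp del: plus_fun_apply zero_fun_apply)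

text \<open>When \<open>ip x x = 2\<close> is expanded over the simple roots, some summand
  \<open>x i * ip x (unit_vec i)\<close> is positive; its second factor is 1 because
  \<open>x\<close> is not simple.\<close>

lemma positive_root_decompose:
  assumes x: "x \<in> roots" "0 \<le> x" and nonsimple: "\<And>i. i \<in> {1..n} \<Longrightarrow> x \<noteq> unit_vec i"
  obtains i where "i \<in> {1..n}" "x - unit_vec i \<in> roots" "0 \<le> x - unit_vec i"
proof -
  have "(\<Sum>i=1..n. x i * ip x (unit_vec i)) = 2"
    using ip_expand[of x x] rootsD(2)[OF x(1)] by argo
  moreover have "(\<Sum>i=1..n. x i * ip x (unit_vec i)) \<le> 0" if "\<forall>i\<in>{1..n}. x i * ip x (unit_vec i) \<le> 0"
    using that by (intro sum_nonpos) blast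
  ultimately obtain i where i: "i \<in> {1..n}" "x i * ip x (unit_vec i) > 0"
    by (smt (verit))
  have "x i \<ge> 0" using x(2) by (auto simp: le_fun_def)
  with i(2) have xi: "x i \<ge> 1" "ip x (unit_vec i) > 0"
    by (auto simp: zero_less_mult_iff)
  have "x \<noteq> - unit_vec i"
    using xi(1) by (auto simp: fun_eq_iff unit_vec_apply)
  with root_ip_bounds[OF x(1) root_unit[OF i(1)]] nonsimple[OF i(1)] xi(2)
  have "ip x (unit_vec i) = 1" by auto
  then have "x - unit_vec i \<in> roots" using x(1) i(1) by (intro root_diff root_unit)
  moreover have "0 \<le> x - unit_vec i"
    using x(2) xi(1) by (auto simp: le_fun_def unit_vec_apply)
  ultimately show ?thesis using that i(1) by blast
qed

end

subsection \<open>Weights of a minuscule module\<close>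

locale pointed_form = cartan_form +
  fixes p :: nat
  assumes p: "p \<in> {1..n}"
begin

text \<open>A vector \<open>c\<close> stands for the weight \<open>\<omega>\<^sub>p - \<Sum>\<^sub>i c\<^sub>i \<alpha>\<^sub>i\<close>: \<open>excess c\<close> is the
  squared norm of this weight minus that of \<open>\<omega>\<^sub>p\<close>, and \<open>pr c x\<close> is its inner product with the lattice
  vector \<open>x\<close>. So the weights in the Weyl group orbit of \<open>\<omega>\<^sub>p\<close> have excess 0.\<close>

definition excess :: "(nat \<Rightarrow> int) \<Rightarrow> int" where
  "excess c = ip c c - 2 * c p"

definition pr :: "(nat \<Rightarrow> int) \<Rightarrow> (nat \<Rightarrow> int) \<Rightarrow> int" where
  "pr c x = x p - ip c x"

definition depths :: "(nat \<Rightarrow> int) set" where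
  "depths = {c \<in> lattice. excess c = 0}"

lemma excess_add: "excess (c + x) = excess c + ip x x - 2 * pr c x"
  using ip_sym[of x c] by (simp add: excess_def pr_def ip_add_left ip_add_right)

lemma excess_diff: "excess (c - x) = excess c + ip x x + 2 * pr c x"
  using ip_sym[of x c] by (simp add: excess_def pr_def ip_diff_left ip_diff_right)

lemma pr_minus_right: "pr c (- x) = - pr c x"
  and pr_zero_left: "pr 0 x = x p"
  by (auto simp: pr_def ip_bilinear)

lemma pr_add_left: "pr (c + d) x = pr c x - ip d x"
  and pr_diff_left: "pr (c - d) x = pr c x + ip d x"
  by (auto simp: pr_def ip_bilinear)

lemma pr_expand: "pr c x = (\<Sum>i=1..n. x i * pr c (unit_vec i))"
proof -
  have "(\<Sum>i=1..n. x i * unit_vec i p) = (\<Sum>i=1..n. if i = p then x p else 0)"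
    by (intro sum.cong refl) (auto simp: unit_vec_apply)
  also have "\<dots> = x p" using p by simp
  finally show ?thesis
    using ip_expand[of c x] by (simp add: pr_def right_diff_distrib sum_subtractf)
qed

lemma depths_zero: "0 \<in> depths"
  by (simp add: depths_def lattice_zero excess_def ip_zero_left)

lemma depthsD: "c \<in> depths \<Longrightarrow> c \<in> lattice" "c \<in> depths \<Longrightarrow> excess c = 0"
  by (auto simp: depths_def)

text \<open>Think of \<open>W\<close> as the weights of a module. From \<open>c\<close> in
  \<open>W\<close> walk towards \<open>c + x\<close> by simple steps of pairing 1. When none is left
  in the support of \<open>x\<close>, no term of \<open>pr c x\<close> is positive, and the
  remaining move raises the excess by at least \<open>ip x x\<close>.\<close>

lemma excess_nonneg_if_reachable:
  assumes W: "0 \<in> W" "W \<subseteq> lattice" "\<And>c. c \<in> W \<Longrightarrow> excess c = 0"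
    and bound: "\<And>c i. c \<in> W \<Longrightarrow> i \<in> {1..n} \<Longrightarrow> pr c (unit_vec i) \<le> 1"
    and step: "\<And>c i. c \<in> W \<Longrightarrow> i \<in> {1..n} \<Longrightarrow> pr c (unit_vec i) = 1 \<Longrightarrow> c + unit_vec i \<in> W"
    and c: "c \<in> lattice"
  shows "excess c \<ge> 0" "excess c = 0 \<Longrightarrow> c \<in> W"
proof -
  have up: "excess (c + x) \<ge> 0 \<and> (excess (c + x) = 0 \<longrightarrow> c + x \<in> W)"
    if "c \<in> W" "x \<in> lattice" "0 \<le> x" for c x
    using that
  proof (induction "nat (ht x)" arbitrary: c x rule: less_induct)
    case less
    show ?case
    proof (cases "\<exists>i\<in>{1..n}. x i > 0 \<and> pr c (unit_vec i) = 1")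
      case True
      then obtain i where i: "i \<in> {1..n}" "x i > 0" "pr c (unit_vec i) = 1" by blast
      let ?y = "x - unit_vec i"
      have y: "0 \<le> ?y" "?y \<in> lattice"
        using less.prems(2,3) i by (auto simp: le_fun_def unit_vec_apply intro!: lattice_intros)
      have "ht ?y = ht x - 1" "0 \<le> ht ?y"
        using i(1) ht_mono[OF y(1)] by (auto simp: ht_diff ht_unit ht_zero)
      then have "nat (ht ?y) < nat (ht x)" by linarith
      from less.hyps[OF this step[OF less.prems(1) i(1,3)] y(2,1)]
      show ?thesis by (simp add: add.assoc)
    next
      case False
      have "pr c x \<le> 0"
        unfolding pr_expand[of c x]
      proof (intro sum_nonpos)
        fix i assume i: "i \<in> {1..n}"
        have "0 \<le> x i" using less.prems(3) by (auto simp: le_fun_def)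
        moreover have "x i = 0 \<or> pr c (unit_vec i) \<le> 0"
          using False i bound[OF less.prems(1) i] \<open>0 \<le> x i\<close> by (smt (verit, best))
        ultimately show "x i * pr c (unit_vec i) \<le> 0"
          by (auto simp: mult_le_0_iff)
      qed
      then have "excess (c + x) \<ge> ip x x"
        using W(3)[OF less.prems(1)] by (simp add: excess_add)
      then show ?thesis
        using ip_pos[OF less.prems(2)] less.prems(1) W(3)[OF less.prems(1)]
        by (cases "x = 0") (auto simp del: zero_fun_apply plus_fun_apply)
    qed
  qed
  let ?u = "pos_part c" and ?d = "pos_part (- c)"
  have l: "?u \<in> lattice" "?d \<in> lattice"
    using c by (auto intro!: pos_part_lattice lattice_intros)
  \<comment> \<open>A general vector reduces to its positive part: subtracting the negative part
    only adds nonnegative terms to the excess.\<close>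
  have "excess c = excess (?u - ?d)" by (simp only: pos_part_diff)
  also have "\<dots> = excess ?u + ip ?d ?d + 2 * (?d p - ip ?u ?d)"
    by (simp add: excess_diff pr_def)
  finally have e: "excess c = excess ?u + ip ?d ?d + 2 * (?d p - ip ?u ?d)" .
  have "ip ?u ?d \<le> 0"
    by (rule ip_disjoint_le_0) (rule pos_part_nonneg pos_part_disjoint)+
  moreover have "?d p \<ge> 0" by (simp add: pos_part_def)
  moreover have "ip ?d ?d \<ge> 0" by (rule ip_nonneg[OF l(2)])
  moreover have u: "excess ?u \<ge> 0" "excess ?u = 0 \<Longrightarrow> ?u \<in> W"
    using up[OF W(1) l(1) pos_part_nonneg] by auto
  ultimately show "excess c \<ge> 0" unfolding e by (smt (verit))
  assume "excess c = 0"
  then have "ip ?d ?d = 0" "excess ?u = 0"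
    using e u(1) \<open>ip ?u ?d \<le> 0\<close> \<open>?d p \<ge> 0\<close> \<open>ip ?d ?d \<ge> 0\<close> by (smt (verit))+
  then have "?d = 0" "?u \<in> W" using ip_eq_0D[OF l(2)] u(2) by auto
  moreover have "c = ?u - ?d" by (simp only: pos_part_diff)
  ultimately show "c \<in> W" by simp
qed

end

text \<open>Isolating the inequality lets the combinatorics of weights and roots run without a
  module; \<open>minuscule_axiom\<close> derives it from the representation.\<close>

locale minuscule = pointed_form +
  assumes excess_nonneg: "c \<in> lattice \<Longrightarrow> excess c \<ge> 0"
begin

text \<open>Dropping a nonzero negative part of \<open>c\<close> would bring the excess below
  0.\<close>

lemma depths_nonneg:
  assumes "c \<in> depths"
  shows "0 \<le> c"
proof -
  let ?u = "pos_part c" and ?d = "pos_part (- c)"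
  have l: "?u \<in> lattice" "?d \<in> lattice"
    using assms by (auto intro!: pos_part_lattice lattice_intros dest: depthsD)
  have "0 = excess (?u - ?d)" using assms by (simp only: pos_part_diff depthsD)
  also have "\<dots> = excess ?u + ip ?d ?d + 2 * (?d p - ip ?u ?d)"
    by (simp add: excess_diff pr_def)
  finally have "ip ?d ?d \<le> 2 * ip ?u ?d"
    using excess_nonneg[OF l(1)] by (simp add: pos_part_def)
  moreover have "ip ?u ?d \<le> 0"
    by (rule ip_disjoint_le_0) (rule pos_part_nonneg pos_part_disjoint)+
  ultimately have "?d = 0" using ip_eq_0D[OF l(2)] ip_nonneg[OF l(2)] by linarith
  then have "- c \<le> 0" by (simp only: pos_part_eq_0)
  then show ?thesis by (simp add: le_fun_def)
qed

text \<open>Adding or subtracting the root \<open>x\<close> makes the excess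
  \<open>2 - 2 * pr c x\<close> or \<open>2 + 2 * pr c x\<close>, and neither may be
  negative.\<close>

lemma pr_root_bounds: "c \<in> depths \<Longrightarrow> x \<in> roots \<Longrightarrow> pr c x = -1 \<or> pr c x = 0 \<or> pr c x = 1"
  using excess_nonneg[of "c + x"] excess_nonneg[of "c - x"]
  by (auto simp: excess_add excess_diff roots_def depths_def lattice_intros)

lemma depths_add_root: "c \<in> depths \<Longrightarrow> x \<in> roots \<Longrightarrow> pr c x = 1 \<Longrightarrow> c + x \<in> depths"
  and depths_diff_root: "c \<in> depths \<Longrightarrow> x \<in> roots \<Longrightarrow> pr c x = -1 \<Longrightarrow> c - x \<in> depths"
  by (auto simp: excess_add excess_diff roots_def depths_def lattice_intros)

lemma root_p_bounds: "x \<in> roots \<Longrightarrow> x p = -1 \<or> x p = 0 \<or> x p = 1"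
  using pr_root_bounds[OF depths_zero, of x] by (simp add: pr_zero_left)

text \<open>Equal excess gives \<open>2 * pr c x = ip x x > 0\<close> for \<open>x = d - c\<close>,
  so some simple root in the support of \<open>x\<close> pairs positively with \<open>c\<close>.
  Hence simple steps generate the componentwise order on \<open>depths\<close>.\<close>

lemma depths_step_up:
  assumes "c \<in> depths" "d \<in> depths" "c \<le> d" "c \<noteq> d"
  obtains i where "i \<in> {1..n}" "c i < d i" "pr c (unit_vec i) = 1"
    "c + unit_vec i \<in> depths" "c + unit_vec i \<le> d"
proof -
  define x where "x = d - c"
  have x: "d = c + x" "0 \<le> x" "x \<noteq> 0" "x \<in> lattice"
    using assms(3,4) depthsD(1)[OF assms(1)] depthsD(1)[OF assms(2)]
    by (auto simp: x_def le_fun_def intro!: lattice_intros)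
  have "2 * pr c x = ip x x"
    using depthsD[OF assms(1)] depthsD[OF assms(2)] unfolding x(1) excess_add by simp
  then have "pr c x > 0" using ip_pos[OF x(4,3)] by linarith
  then have "\<not> (\<forall>i\<in>{1..n}. x i * pr c (unit_vec i) \<le> 0)"
    unfolding pr_expand[of c x] using sum_nonpos[of "{1..n}" "\<lambda>i. x i * pr c (unit_vec i)"] by fastforce
  then obtain i where i: "i \<in> {1..n}" "x i * pr c (unit_vec i) > 0" by (auto simp: not_le)
  have "x i \<ge> 0" using x(2) by (auto simp: le_fun_def)
  with i(2) have i': "x i > 0" "pr c (unit_vec i) > 0" by (auto simp: zero_less_mult_iff)
  then have pr: "pr c (unit_vec i) = 1" using pr_root_bounds[OF assms(1) root_unit[OF i(1)]] by linarith
  moreover have "c i < d i" using i'(1) by (simp add: x_def)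
  moreover have "c + unit_vec i \<le> d"
    using assms(3) \<open>c i < d i\<close> by (auto simp: le_fun_def unit_vec_apply)
  ultimately show ?thesis using that i(1) depths_add_root[OF assms(1) root_unit[OF i(1)]] by blast
qed

lemma depths_step_down:
  assumes "c \<in> depths" "d \<in> depths" "c \<le> d" "c \<noteq> d"
  obtains i where "i \<in> {1..n}" "c i < d i" "pr d (unit_vec i) = -1"
    "d - unit_vec i \<in> depths" "c \<le> d - unit_vec i"
proof -
  define x where "x = d - c"
  have x: "c = d - x" "0 \<le> x" "x \<noteq> 0" "x \<in> lattice"
    using assms(3,4) depthsD(1)[OF assms(1)] depthsD(1)[OF assms(2)]
    by (auto simp: x_def le_fun_def intro!: lattice_intros)
  have "2 * pr d x = - ip x x"
    using depthsD[OF assms(1)] depthsD[OF assms(2)] unfolding x(1) excess_diff by simp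
  then have "pr d x < 0" using ip_pos[OF x(4,3)] by linarith
  then have "\<not> (\<forall>i\<in>{1..n}. x i * pr d (unit_vec i) \<ge> 0)"
    unfolding pr_expand[of d x] using sum_nonneg[of "{1..n}" "\<lambda>i. x i * pr d (unit_vec i)"] by fastforce
  then obtain i where i: "i \<in> {1..n}" "x i * pr d (unit_vec i) < 0" by (auto simp: not_le)
  have "x i \<ge> 0" using x(2) by (auto simp: le_fun_def)
  with i(2) have i': "x i > 0" "pr d (unit_vec i) < 0" by (auto simp: mult_less_0_iff)
  then have pr: "pr d (unit_vec i) = -1" using pr_root_bounds[OF assms(2) root_unit[OF i(1)]] by linarith
  moreover have "c i < d i" using i'(1) by (simp add: x_def)
  moreover have "c \<le> d - unit_vec i"
    using assms(3) \<open>c i < d i\<close> by (auto simp: le_fun_def unit_vec_apply)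
  ultimately show ?thesis using that i(1) depths_diff_root[OF assms(2) root_unit[OF i(1)]] by blast
qed

lemma depths_induct [consumes 1, case_names zero step]:
  assumes "c \<in> depths" "P 0"
    and "\<And>c i. c \<in> depths \<Longrightarrow> i \<in> {1..n} \<Longrightarrow> pr c (unit_vec i) = 1 \<Longrightarrow> P c \<Longrightarrow> P (c + unit_vec i)"
  shows "P c"
  using assms(1)
proof (induction "nat (ht c)" arbitrary: c rule: less_induct)
  case less
  show ?case
  proof (cases "c = 0")
    case False
    then obtain i where i: "i \<in> {1..n}" "pr c (unit_vec i) = -1" "c - unit_vec i \<in> depths"
      using depths_step_down[OF depths_zero less.prems depths_nonneg[OF less.prems]] by metis
    have "0 \<le> ht (c - unit_vec i)"
      using ht_mono[OF depths_nonneg[OF i(3)]] by (simp add: ht_zero)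
    then have "nat (ht (c - unit_vec i)) < nat (ht c)"
      using i(1) by (simp add: ht_diff ht_unit)
    then have "P (c - unit_vec i)" using less.hyps i(3) by blast
    then have "P (c - unit_vec i + unit_vec i)"
      using i by (intro assms(3)) (auto simp: pr_diff_left ip_unit_self)
    then show ?thesis by simp
  qed (use assms(2) in simp)
qed

text \<open>Submodularity: the excess of the meet \<open>?m\<close> and that of the join
  \<open>?m + ?x + ?y\<close> add up to \<open>2 * ip ?x ?y\<close>, which is at most 0, while both
  are nonnegative.\<close>

lemma depths_min:
  assumes "c \<in> depths" "d \<in> depths"
  shows "(\<lambda>i. min (c i) (d i)) \<in> depths"
proof -
  let ?m = "\<lambda>i. min (c i) (d i)"
  let ?x = "pos_part (c - d)" and ?y = "pos_part (- (c - d))"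
  have m: "?m \<in> lattice" using assms by (auto simp: lattice_def depths_def)
  have l: "?x \<in> lattice" "?y \<in> lattice"
    using assms by (auto intro!: pos_part_lattice lattice_intros dest: depthsD)
  have c: "c = ?m + ?x" and d: "d = ?m + ?y"
    by (auto simp: fun_eq_iff pos_part_def)
  have "excess (?m + ?x) = 0" "excess (?m + ?y) = 0"
    using assms unfolding c[symmetric] d[symmetric] by (auto dest: depthsD)
  moreover have "excess (?m + ?x + ?y) = excess ?m + ip ?x ?x - 2 * pr ?m ?x + ip ?y ?y - 2 * pr ?m ?y + 2 * ip ?x ?y"
    by (simp only: excess_add pr_add_left) simp
  moreover have "ip ?x ?y \<le> 0"
    by (rule ip_disjoint_le_0) (rule pos_part_nonneg pos_part_disjoint)+
  moreover have "excess (?m + ?x + ?y) \<ge> 0" "excess ?m \<ge> 0"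
    using m l by (auto intro!: excess_nonneg lattice_intros)
  ultimately have "excess ?m = 0" by (simp only: excess_add)
  then show ?thesis using m by (simp add: depths_def)
qed

section \<open>Roots with coefficient 1 at \<open>p\<close>, the roots of an abelian
  nilradical\<close>

definition roots1 :: "(nat \<Rightarrow> int) set" where
  "roots1 = {x \<in> roots. x p = 1}"

lemma roots1D: "x \<in> roots1 \<Longrightarrow> x \<in> roots" "x \<in> roots1 \<Longrightarrow> x p = 1" "x \<in> roots1 \<Longrightarrow> x \<in> lattice"
  "x \<in> roots1 \<Longrightarrow> ip x x = 2"
  by (auto simp: roots1_def roots_def)

lemma roots1_nonneg: "x \<in> roots1 \<Longrightarrow> 0 \<le> x"
  using root_pos_or_neg[of x] le_funD[of x 0 p] by (auto simp: roots1_def)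

text \<open>Inner product -1 would make \<open>x + y\<close> a root with coefficient 2 at
  \<open>p\<close>, against \<open>root_p_bounds\<close>.\<close>

lemma roots1_ip:
  assumes "x \<in> roots1" "y \<in> roots1"
  shows "x = y \<or> ip x y = 0 \<or> ip x y = 1"
proof -
  have "ip x y \<noteq> -1"
    using root_add[of x y] assms root_p_bounds[of "x + y"] by (auto simp: roots1_def)
  moreover have "x \<noteq> - y" using assms by (auto simp: roots1_def)
  ultimately show ?thesis using root_ip_bounds[of x y] assms by (auto simp: roots1_def)
qed

lemma roots1_ip_nonneg: "x \<in> roots1 \<Longrightarrow> y \<in> roots1 \<Longrightarrow> ip x y \<ge> 0"
  using roots1_ip[of x y] by (auto dest: roots1D)

lemma roots1_ip_1_comparable:
  assumes "x \<in> roots1" "y \<in> roots1" "ip x y = 1"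
  shows "x \<le> y \<or> y \<le> x"
proof -
  have "x - y \<in> roots" using root_diff assms by (auto dest: roots1D)
  then show ?thesis using root_pos_or_neg[of "x - y"] by (auto simp: le_fun_def)
qed

lemma roots1_ip_unit:
  assumes "x \<in> roots1" "i \<in> {1..n}" "i \<noteq> p"
  shows "ip x (unit_vec i) = -1 \<or> ip x (unit_vec i) = 0 \<or> ip x (unit_vec i) = 1"
proof -
  have "x \<noteq> unit_vec i" "x \<noteq> - unit_vec i"
    using roots1D(2)[OF assms(1)] assms(3) by (auto simp: unit_vec_apply)
  then show ?thesis using root_ip_bounds[of x "unit_vec i"] assms root_unit by (auto dest: roots1D)
qed

lemma roots1_add_unit:
  "x \<in> roots1 \<Longrightarrow> i \<in> {1..n} \<Longrightarrow> i \<noteq> p \<Longrightarrow> ip x (unit_vec i) = -1 \<Longrightarrow> x + unit_vec i \<in> roots1"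
  using root_add[of x "unit_vec i"] root_unit by (auto simp: roots1_def unit_vec_apply)

lemma roots1_diff_unit:
  "x \<in> roots1 \<Longrightarrow> i \<in> {1..n} \<Longrightarrow> i \<noteq> p \<Longrightarrow> ip x (unit_vec i) = 1 \<Longrightarrow> x - unit_vec i \<in> roots1"
  using root_diff[of x "unit_vec i"] root_unit by (auto simp: roots1_def unit_vec_apply)


subsection \<open>Weights as sums of antichains of roots\<close>

definition orthogonal_family :: "(nat \<Rightarrow> int) set \<Rightarrow> bool" where
  "orthogonal_family S \<longleftrightarrow> finite S \<and> S \<subseteq> roots1 \<and> (\<forall>x\<in>S. \<forall>y\<in>S. x \<noteq> y \<longrightarrow> ip x y = 0)"

lemma orthogonal_familyD:
  "orthogonal_family S \<Longrightarrow> finite S"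
  "orthogonal_family S \<Longrightarrow> x \<in> S \<Longrightarrow> x \<in> roots1"
  "orthogonal_family S \<Longrightarrow> x \<in> S \<Longrightarrow> y \<in> S \<Longrightarrow> x \<noteq> y \<Longrightarrow> ip x y = 0"
  by (auto simp: orthogonal_family_def)

lemma orthogonal_family_ip_member:
  assumes "orthogonal_family S" "x \<in> S"
  shows "ip (\<Sum>S) x = 2"
proof -
  have "ip (\<Sum>S) x = (\<Sum>y\<in>S. ip y x)" by (simp add: ip_sum_left)
  also have "\<dots> = (\<Sum>y\<in>S. if y = x then 2 else 0)"
    using assms by (intro sum.cong refl) (auto dest: orthogonal_familyD roots1D)
  finally show ?thesis using assms by (simp add: orthogonal_familyD)
qed

lemma orthogonal_family_ip_self:
  assumes "orthogonal_family S"
  shows "ip (\<Sum>S) (\<Sum>S) = 2 * int (card S)"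
proof -
  have "ip (\<Sum>S) (\<Sum>S) = (\<Sum>x\<in>S. ip (\<Sum>S) x)" by (rule ip_sum_right)
  also have "\<dots> = (\<Sum>x\<in>S. 2)" using assms by (intro sum.cong refl orthogonal_family_ip_member)
  finally show ?thesis by simp
qed

lemma sum_roots1_p: "S \<subseteq> roots1 \<Longrightarrow> (\<Sum>S) p = int (card S)"
  by (simp add: sum_fun_apply[of "\<lambda>x. x"] roots1D subset_eq)

text \<open>The norm of the sum is \<open>2 * card S\<close> and its coefficient at \<open>p\<close>
  is \<open>card S\<close>, so the excess cancels.\<close>

lemma orthogonal_sum_depths:
  assumes "orthogonal_family S"
  shows "\<Sum>S \<in> depths"
proof -
  have "\<Sum>S \<in> lattice"
    using assms by (intro lattice_sum) (auto dest: orthogonal_familyD roots1D)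
  then show ?thesis
    using assms by (simp add: depths_def excess_def orthogonal_family_ip_self sum_roots1_p orthogonal_family_def)
qed

text \<open>At most one member can be raised by a simple root \<open>e\<close>: two orthogonal ones \<open>x\<close>, \<open>y\<close> would
  give the root \<open>x + y + e\<close>, whose coefficient at \<open>p\<close> is 2.\<close>

lemma raised_member_unique:
  assumes "orthogonal_family S" "i \<in> {1..n}" "i \<noteq> p" "x \<in> S" "y \<in> S"
    "ip x (unit_vec i) = -1" "ip y (unit_vec i) = -1"
  shows "x = y"
proof (rule ccontr)
  assume "x \<noteq> y"
  then have "ip x y = 0" using orthogonal_familyD(3)[OF assms(1)] assms by blast
  moreover have "x + unit_vec i \<in> roots1" "y \<in> roots1"
    using assms orthogonal_familyD(2)[OF assms(1)] by (auto intro: roots1_add_unit)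
  ultimately show False
    using roots1_ip_nonneg[of "x + unit_vec i" y] assms(7) ip_sym[of y "unit_vec i"]
    by (simp add: ip_add_left)
qed

text \<open>The pairings of the members with alpha_i lie in -1, 0, 1 and add up to -1. At most one
  of them is -1, so all others vanish.\<close>

lemma raised_member_exists:
  assumes "orthogonal_family S" "i \<in> {1..n}" "i \<noteq> p" "pr (\<Sum>S) (unit_vec i) = 1"
  obtains x where "x \<in> S" "ip x (unit_vec i) = -1"
    "\<And>y. y \<in> S \<Longrightarrow> y \<noteq> x \<Longrightarrow> ip y (unit_vec i) = 0"
proof -
  have s: "(\<Sum>y\<in>S. ip y (unit_vec i)) = -1"
    using assms(3,4) by (simp add: pr_def unit_vec_apply ip_sum_left)
  have "\<exists>x\<in>S. ip x (unit_vec i) < 0"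
  proof (rule ccontr)
    assume "\<not> ?thesis"
    then have "(\<Sum>y\<in>S. ip y (unit_vec i)) \<ge> 0" by (intro sum_nonneg) auto
    with s show False by simp
  qed
  then obtain x where x: "x \<in> S" "ip x (unit_vec i) = -1"
    using roots1_ip_unit[OF orthogonal_familyD(2)[OF assms(1)] assms(2,3)] by fastforce
  have nonneg: "ip y (unit_vec i) \<ge> 0" if "y \<in> S - {x}" for y
    using that roots1_ip_unit[OF orthogonal_familyD(2)[OF assms(1)] assms(2,3), of y]
      raised_member_unique[OF assms(1-3) x(1) _ x(2), of y] by auto
  have "(\<Sum>y\<in>S - {x}. ip y (unit_vec i)) = 0"
    using s x orthogonal_familyD(1)[OF assms(1)] by (simp add: sum.remove[of S x])
  then have "\<forall>y\<in>S - {x}. ip y (unit_vec i) = 0"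
    using nonneg orthogonal_familyD(1)[OF assms(1)] by (subst (asm) sum_nonneg_eq_0_iff) auto
  with x that show ?thesis by blast
qed

lemma sum_replace:
  fixes x y :: "nat \<Rightarrow> int"
  assumes "finite S" "x \<in> S" "y \<notin> S - {x}"
  shows "\<Sum>(insert y (S - {x})) = \<Sum>S - x + y"
  using assms by (simp add: sum.remove[of S x] del: plus_fun_apply)

lemma orthogonal_family_raise:
  assumes S: "orthogonal_family S" "i \<in> {1..n}" "i \<noteq> p"
    and x: "x \<in> S" "ip x (unit_vec i) = -1" "\<And>y. y \<in> S \<Longrightarrow> y \<noteq> x \<Longrightarrow> ip y (unit_vec i) = 0"
  defines "S' \<equiv> insert (x + unit_vec i) (S - {x})"
  shows "orthogonal_family S'" "\<Sum>S' = \<Sum>S + unit_vec i" "x + unit_vec i \<notin> S"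
proof -
  have r: "x + unit_vec i \<in> roots1"
    using S x orthogonal_familyD(2) by (auto intro: roots1_add_unit)
  have o: "ip (x + unit_vec i) y = 0 \<and> ip y (x + unit_vec i) = 0" if "y \<in> S" "y \<noteq> x" for y
    using that x orthogonal_familyD(3)[OF S(1), of x y] ip_sym[of y "unit_vec i"] ip_sym[of y x]
    by (simp add: ip_add_left ip_add_right)
  show "orthogonal_family S'"
    using S(1) r o unfolding orthogonal_family_def S'_def by auto
  have "x + unit_vec i \<noteq> x" by (auto simp: fun_eq_iff unit_vec_apply)
  \<comment> \<open>As a member different from \<open>x\<close> it would be orthogonal to
    itself.\<close>
  then show n: "x + unit_vec i \<notin> S" using o r roots1D(4) by fastforce
  show "\<Sum>S' = \<Sum>S + unit_vec i"
    unfolding S'_def using n x(1) orthogonal_familyD(1)[OF S(1)] by (subst sum_replace) auto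
qed

text \<open>Along a chain of simple steps, a step in a direction other than \<open>p\<close> raises
  one member, and a step in direction \<open>p\<close> adds alpha_p as a new member.\<close>

lemma orthogonal_decomposition:
  assumes "c \<in> depths"
  shows "\<exists>S. orthogonal_family S \<and> \<Sum>S = c"
  using assms
proof (induction rule: depths_induct)
  case zero
  show ?case by (intro exI[of _ "{}"]) (simp add: orthogonal_family_def)
next
  case (step c i)
  then obtain S where S: "orthogonal_family S" "\<Sum>S = c" by blast
  show ?case
  proof (cases "i = p")
    case False
    obtain x where "x \<in> S" "ip x (unit_vec i) = -1" "\<And>y. y \<in> S \<Longrightarrow> y \<noteq> x \<Longrightarrow> ip y (unit_vec i) = 0"
      using raised_member_exists[OF S(1) step(2) False] S(2) step(3) by auto
    from orthogonal_family_raise[OF S(1) step(2) False this] S(2) show ?thesis by auto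
  next
    case True
    have e: "unit_vec p \<in> roots1" using root_unit[OF p] by (simp add: roots1_def unit_vec_apply)
    \<comment> \<open>The members pair nonnegatively with alpha_p and the pairings add up to 0, so
      alpha_p is orthogonal to all of them.\<close>
    have "ip c (unit_vec p) = 0"
      using step(3) True by (simp add: pr_def unit_vec_apply)
    then have s: "(\<Sum>x\<in>S. ip x (unit_vec p)) = 0" using S(2) by (auto simp: ip_sum_left)
    moreover have nn: "ip x (unit_vec p) \<ge> 0" if "x \<in> S" for x
      using that e orthogonal_familyD(2)[OF S(1)] roots1_ip_nonneg by blast
    ultimately have z: "\<forall>x\<in>S. ip x (unit_vec p) = 0"
      using orthogonal_familyD(1)[OF S(1)] by (subst (asm) sum_nonneg_eq_0_iff) auto
    then have z': "\<forall>x\<in>S. ip (unit_vec p) x = 0" by (simp add: ip_sym)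
    have "unit_vec p \<notin> S" using z ip_unit_self[OF p] by auto
    then have "\<Sum>(insert (unit_vec p) S) = c + unit_vec i"
      using S orthogonal_familyD(1)[OF S(1)] True by (simp add: add.commute del: plus_fun_apply)
    moreover have "orthogonal_family (insert (unit_vec p) S)"
      using S(1) e z z' by (auto simp: orthogonal_family_def)
    ultimately show ?thesis by blast
  qed
qed

text \<open>Since \<open>ip x (y - x) = -2\<close>, some alpha_i in the support of
  \<open>y - x\<close> pairs to -1 with \<open>x\<close>. Either it moves from \<open>y\<close> to
  \<open>x\<close> directly, or it is added to \<open>x\<close> alone, the closer pair is uncrossed
  by induction, and alpha_i is removed again.\<close>

lemma uncross:
  assumes "x \<in> roots1" "y \<in> roots1" "ip x y = 0" "x \<le> y"
  shows "\<exists>u v. u \<in> roots1 \<and> v \<in> roots1 \<and> ip u v = 0 \<and> x \<le> u \<and> x \<noteq> u \<and> x \<le> v \<and> x \<noteq> v \<and> u + v = x + y"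
  using assms
proof (induction "nat (ht y - ht x)" arbitrary: x rule: less_induct)
  case less
  note x = less.prems(1) and y = less.prems(2)
  define z where "z = y - x"
  have z: "0 \<le> z" "z p = 0"
    using less.prems(4) roots1D(2)[OF x] roots1D(2)[OF y] by (auto simp: z_def le_fun_def)
  have "ip x z = -2" using less.prems(3) roots1D(4)[OF x] by (simp add: z_def ip_diff_right)
  then have "(\<Sum>i=1..n. z i * ip x (unit_vec i)) < 0" using ip_expand[of x z] by simp
  then have "\<not> (\<forall>i\<in>{1..n}. z i * ip x (unit_vec i) \<ge> 0)"
    using sum_nonneg[of "{1..n}" "\<lambda>i. z i * ip x (unit_vec i)"] by fastforce
  then obtain i where i: "i \<in> {1..n}" "z i * ip x (unit_vec i) < 0" by (auto simp: not_le)
  have "z i \<ge> 0" using z(1) by (auto simp: le_fun_def)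
  with i(2) have zi: "z i > 0" "ip x (unit_vec i) < 0" by (auto simp: mult_less_0_iff)
  then have ip: "i \<noteq> p" using z(2) by auto
  have xi: "ip x (unit_vec i) = -1" using roots1_ip_unit[OF x i(1) ip] zi(2) by auto
  let ?e = "unit_vec i"
  have x1: "x + ?e \<in> roots1" by (rule roots1_add_unit) fact+
  have xy: "x i < y i" using zi(1) by (simp add: z_def)
  have le: "x + ?e \<le> y" using less.prems(4) xy by (auto simp: le_fun_def unit_vec_apply)
  have ne: "x \<noteq> x + ?e" by (auto simp: fun_eq_iff unit_vec_apply)
  have ey: "ip ?e y = ip y ?e" "ip ?e x = ip x ?e" by (rule ip_sym)+
  \<comment> \<open>This excludes pairing -1 of \<open>y\<close> with alpha_i and leaves the two
    cases.\<close>
  have "ip (x + ?e) y \<ge> 0" using roots1_ip_nonneg[OF x1 y] .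
  then have "ip y ?e \<noteq> -1" using less.prems(3) ey by (simp add: ip_add_left)
  then consider "ip y ?e = 1" | "ip y ?e = 0"
    using roots1_ip_unit[OF y i(1) ip] by blast
  then show ?case
  proof cases
    case 1
    have y1: "y - ?e \<in> roots1" using y i(1) ip 1 by (rule roots1_diff_unit)
    have "ip (x + ?e) (y - ?e) = 0"
      using less.prems(3) 1 xi ey i(1) by (simp add: ip_bilinear ip_unit_self)
    moreover have "x \<le> y - ?e" "x \<le> x + ?e"
      using less.prems(4) xy by (auto simp: le_fun_def unit_vec_apply)
    moreover have "x \<noteq> y - ?e"
      using roots1D(4)[OF x] less.prems(3) xi by (auto simp: ip_diff_right)
    moreover have "x + ?e + (y - ?e) = x + y" by simp
    ultimately show ?thesis using x1 y1 ne by blast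
  next
    case 2
    have o: "ip (x + ?e) y = 0" using less.prems(3) 2 ey by (simp add: ip_add_left)
    have "nat (ht y - ht (x + ?e)) < nat (ht y - ht x)"
      using ht_mono[OF le] i(1) by (simp add: ht_add ht_unit)
    from less.hyps[OF this x1 y o le] obtain u v where
      uv: "u \<in> roots1" "v \<in> roots1" "ip u v = 0" "x + ?e \<le> u" "x + ?e \<noteq> u"
        "x + ?e \<le> v" "x + ?e \<noteq> v" "u + v = x + ?e + y" by blast
    \<comment> \<open>The sum is now too large by alpha_i. It comes off the root that pairs to 1
      with alpha_i; the other one is orthogonal to alpha_i, so orthogonality survives.\<close>
    have key: ?thesis if uv: "u \<in> roots1" "v \<in> roots1" "ip u v = 0" "x + ?e \<le> u" "x + ?e \<noteq> u"
        "x + ?e \<le> v" "x + ?e \<noteq> v" "u + v = x + ?e + y" and s: "ip u ?e = 1" "ip v ?e = 0" for u v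
    proof -
      have "u - ?e \<in> roots1" using uv(1) i(1) ip s(1) by (rule roots1_diff_unit)
      moreover have "ip (u - ?e) v = 0" using uv(3) s ip_sym[of v ?e] by (simp add: ip_diff_left)
      moreover have "0 \<le> ?e" by (simp add: le_fun_def unit_vec_apply)
      then have "x \<le> u - ?e" "x \<le> v"
        using uv(4,6) by (simp_all add: le_diff_eq) (metis add.right_neutral add_left_mono order_trans)
      moreover have "x \<noteq> u - ?e" "x \<noteq> v"
        using uv(5) uv(6) by (auto simp: le_fun_def unit_vec_apply dest: spec[of _ i])
      moreover have "u - ?e + v = x + y" using uv(8) by (simp add: algebra_simps)
      ultimately show ?thesis using uv(2) by blast
    qed
    have "ip (u + v) ?e = 1" using 2 xi i(1) unfolding uv(8) by (simp add: ip_add_left ip_unit_self)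
    then have "ip u ?e + ip v ?e = 1" by (simp add: ip_add_left)
    then consider "ip u ?e = 1" "ip v ?e = 0" | "ip v ?e = 1" "ip u ?e = 0"
      using roots1_ip_unit[OF uv(1) i(1) ip] roots1_ip_unit[OF uv(2) i(1) ip] by force
    then show ?thesis
    proof cases
      case 1 then show ?thesis using key uv by blast
    next
      case 2 then show ?thesis using key[of v u] uv ip_sym[of u v] add.commute[of u v] by metis
    qed
  qed
qed

lemma uncross_decreases_heights:
  assumes "orthogonal_family S" "x \<in> S" "y \<in> S" "x \<noteq> y" "x \<le> y"
  shows "\<exists>S'. orthogonal_family S' \<and> \<Sum>S' = \<Sum>S \<and> (\<Sum>z\<in>S'. nat (ht z) ^ 2) < (\<Sum>z\<in>S. nat (ht z) ^ 2)"
proof -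
  note D = orthogonal_familyD[OF assms(1)]
  have xy: "x \<in> roots1" "y \<in> roots1" "ip x y = 0" using D assms by auto
  then obtain u v where uv: "u \<in> roots1" "v \<in> roots1" "ip u v = 0" "x \<le> u" "x \<noteq> u" "x \<le> v" "x \<noteq> v" "u + v = x + y"
    using uncross assms(5) by blast
  define R where "R = S - {x, y}"
  have S: "S = insert x (insert y R)" "x \<notin> insert y R" "y \<notin> R" "finite R"
    using assms D by (auto simp: R_def)
  have Rr: "z \<in> roots1" if "z \<in> R" for z using that D by (auto simp: R_def)
  \<comment> \<open>The sum \<open>u + v = x + y\<close> is orthogonal to \<open>z\<close>, and
    neither summand pairs negatively with it.\<close>
  have o: "ip u z = 0 \<and> ip v z = 0" if z: "z \<in> R" for z
  proof -
    have "ip (u + v) z = 0" using z D assms unfolding uv(8) by (auto simp: R_def ip_add_left)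
    then show ?thesis
      using roots1_ip_nonneg[OF uv(1) Rr[OF z]] roots1_ip_nonneg[OF uv(2) Rr[OF z]]
      by (simp add: ip_add_left)
  qed
  then have o': "ip z u = 0 \<and> ip z v = 0" if z: "z \<in> R" for z
    using z ip_sym[of z u] ip_sym[of z v] by auto
  have n: "u \<noteq> v" "u \<notin> R" "v \<notin> R" using uv(1-3) o roots1D(4) by fastforce+
  let ?T = "insert u (insert v R)"
  have "orthogonal_family ?T"
    using assms(1) uv(1-3) o o' S(1) ip_sym[of v u] unfolding orthogonal_family_def by auto
  moreover have "\<Sum>?T = \<Sum>S"
    using n S uv(8) by (simp add: add.assoc[symmetric] del: plus_fun_apply)
  moreover have "(\<Sum>z\<in>?T. nat (ht z) ^ 2) < (\<Sum>z\<in>S. nat (ht z) ^ 2)"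
  proof -
    have "ht u + ht v = ht x + ht y" using uv(8) by (metis ht_add)
    moreover have "0 \<le> ht x" "ht x < ht u" "ht x < ht v"
      using ht_mono[OF roots1_nonneg[OF xy(1)]] uv xy ht_strict_mono[of x u] ht_strict_mono[of x v]
        by (auto simp: ht_zero roots1D)
    \<comment> \<open>The heights of \<open>x\<close>, \<open>u\<close>, \<open>v\<close>,
      \<open>y\<close> become \<open>a\<close>, \<open>a + b\<close>, \<open>a + c\<close>,
      \<open>a + b + c\<close>, and the sum of squares drops by \<open>2 * b * c\<close>.\<close>
    moreover define a b c where "a = nat (ht x)" and "b = nat (ht u) - a" and "c = nat (ht v) - a"
    ultimately have abc: "nat (ht x) = a" "nat (ht u) = a + b" "nat (ht v) = a + c" "nat (ht y) = a + b + c" "b > 0" "c > 0"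
      by (auto simp: a_def b_def c_def)
    have "nat (ht u) ^ 2 + nat (ht v) ^ 2 < nat (ht x) ^ 2 + nat (ht y) ^ 2"
      unfolding abc using abc(5,6) by (auto simp: power2_eq_square algebra_simps)
    then show ?thesis using n S by simp
  qed
  ultimately show ?thesis by blast
qed

lemma antichain_decomposition:
  assumes "c \<in> depths"
  obtains S where "orthogonal_family S" "antichain roots1 (\<le>) S" "\<Sum>S = c"
proof -
  define f where "f = (\<lambda>S::(nat \<Rightarrow> int) set. \<Sum>z\<in>S. nat (ht z) ^ 2)"
  obtain S where S: "orthogonal_family S \<and> \<Sum>S = c"
    and min: "\<And>T. orthogonal_family T \<and> \<Sum>T = c \<Longrightarrow> f S \<le> f T"
    using orthogonal_decomposition[OF assms]
      ex_has_least_nat[of "\<lambda>S. orthogonal_family S \<and> \<Sum>S = c" _ f] by metis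
  have "antichain roots1 (\<le>) S"
    unfolding antichain_def
    using S orthogonal_familyD(2) uncross_decreases_heights[of S] min unfolding f_def
    by (metis not_le subsetI)
  then show ?thesis using S that by blast
qed

lemma antichain_orthogonal:
  assumes "antichain roots1 (\<le>) A" "finite A"
  shows "orthogonal_family A"
  unfolding orthogonal_family_def
proof (intro conjI ballI impI)
  fix x y assume "x \<in> A" "y \<in> A" "x \<noteq> y"
  then show "ip x y = 0"
    using assms(1) roots1_ip[of x y] roots1_ip_1_comparable[of x y] unfolding antichain_def by blast
qed (use assms in \<open>auto simp: antichain_def\<close>)


text \<open>A column sum of the Gram matrix between two families with equal sums: \<open>x\<close>
  pairs to 2 with the common sum, and the terms outside \<open>U\<close> vanish.\<close>

lemma orthogonal_sum_ip:
  assumes "orthogonal_family S" "finite T" "U \<subseteq> T" "\<Sum>T = \<Sum>S" "x \<in> S" "\<And>t. t \<in> T - U \<Longrightarrow> ip t x = 0"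
  shows "(\<Sum>t\<in>U. ip t x) = 2"
proof -
  have "(\<Sum>t\<in>U. ip t x) = (\<Sum>t\<in>T. ip t x)"
    using assms(2,3,6) by (intro sum.mono_neutral_left) auto
  also have "\<dots> = 2" using orthogonal_family_ip_member[OF assms(1,5)] assms(4) by (simp add: ip_sum_left[symmetric])
  finally show ?thesis .
qed

text \<open>Let \<open>U\<close> be the members of \<open>A\<close> lying above some non-orthogonal member of \<open>B\<close>, and \<open>D\<close> the members of \<open>B\<close>
  below some non-orthogonal member of \<open>A\<close>. The Gram matrix between \<open>U\<close> and \<open>D\<close> has all row and column sums 2,
  so \<open>\<Sum>U = \<Sum>D\<close>, which contradicts that each link goes strictly upwards in height.\<close>

lemma no_upward_link:
  assumes A: "orthogonal_family A" "antichain roots1 (\<le>) A"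
    and B: "orthogonal_family B" "antichain roots1 (\<le>) B"
    and eq: "\<Sum>A = \<Sum>B" and xy: "x \<in> A" "y \<in> B" "ip x y = 1" "y \<le> x"
  shows False
proof -
  define U where "U = {x \<in> A. \<exists>y\<in>B. ip x y = 1 \<and> y \<le> x}"
  define D where "D = {y \<in> B. \<exists>x\<in>A. ip x y = 1 \<and> y \<le> x}"
  have fin: "finite A" "finite B" "finite U" "finite D"
    using A B by (auto simp: U_def D_def orthogonal_family_def)
  have r: "x \<in> roots1" "y \<in> roots1" if "x \<in> A" "y \<in> B" for x y
    using that A B by (auto dest: orthogonal_familyD)
  \<comment> \<open>Some \<open>z\<close> in \<open>A\<close> lies above \<open>y\<close>, so
    \<open>x\<close> cannot lie below \<open>y\<close>. A nonzero pairing would then put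
    \<open>x\<close> above \<open>y\<close> and hence into \<open>U\<close>.\<close>
  have D2: "ip x y = 0" if xy: "x \<in> A - U" "y \<in> D" for x y
  proof (rule ccontr)
    assume ne: "ip x y \<noteq> 0"
    obtain z where z: "z \<in> A" "ip z y = 1" "y \<le> z" using xy(2) by (auto simp: D_def)
    have xy': "x \<in> A" "y \<in> B" using xy by (auto simp: D_def)
    have "x \<noteq> y"
      using z xy'(1) A(2) roots1D(4)[OF r(1)[OF z(1) xy'(2)]] unfolding antichain_def by force
    then have 1: "ip x y = 1" using roots1_ip[OF r[OF xy']] ne by blast
    have "\<not> x \<le> y"
      using z xy'(1) A(2) \<open>x \<noteq> y\<close> unfolding antichain_def by (metis order_antisym order_trans)
    then have "y \<le> x" using roots1_ip_1_comparable[OF r[OF xy'] 1] by blast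
    then show False using xy xy' 1 by (auto simp: U_def)
  qed
  have U2: "ip x y = 0" if xy: "x \<in> U" "y \<in> B - D" for x y
  proof (rule ccontr)
    assume ne: "ip x y \<noteq> 0"
    obtain z where z: "z \<in> B" "ip x z = 1" "z \<le> x" using xy(1) by (auto simp: U_def)
    have xy': "x \<in> A" "y \<in> B" using xy by (auto simp: U_def)
    have "x \<noteq> y"
      using z xy'(2) B(2) roots1D(4)[OF r(2)[OF xy'(1) z(1)]] unfolding antichain_def by force
    then have 1: "ip x y = 1" using roots1_ip[OF r[OF xy']] ne by blast
    have "\<not> x \<le> y"
      using z xy'(2) B(2) \<open>x \<noteq> y\<close> unfolding antichain_def by (metis order_antisym order_trans)
    then have "y \<le> x" using roots1_ip_1_comparable[OF r[OF xy'] 1] by blast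
    then show False using xy xy' 1 by (auto simp: D_def)
  qed
  have sub: "U \<subseteq> A" "D \<subseteq> B" by (auto simp: U_def D_def)
  have col: "(\<Sum>x\<in>U. ip x y) = 2" if y: "y \<in> D" for y
    by (rule orthogonal_sum_ip[OF B(1) fin(1) sub(1) eq]) (use y sub D2 in blast)+
  have row: "(\<Sum>y\<in>D. ip x y) = 2" if x: "x \<in> U" for x
  proof -
    have "ip t x = 0" if "t \<in> B - D" for t using U2[OF x that] ip_sym[of t x] by simp
    then have "(\<Sum>y\<in>D. ip y x) = 2"
      using x sub by (intro orthogonal_sum_ip[OF A(1) fin(2) sub(2) eq[symmetric]]) auto
    then show ?thesis by (simp add: ip_sym[of x])
  qed
  have oU: "orthogonal_family U" and oD: "orthogonal_family D"
    using A(1) B(1) by (auto simp: orthogonal_family_def U_def D_def)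
  have UD: "ip (\<Sum>U) (\<Sum>D) = 2 * int (card U)"
    by (simp only: ip_sum_left) (simp add: ip_sum_right row)
  have UD': "ip (\<Sum>U) (\<Sum>D) = 2 * int (card D)"
    by (simp only: ip_sum_right) (simp add: ip_sum_left col)
  let ?z = "\<Sum>U - \<Sum>D"
  \<comment> \<open>Both norms and the mixed product equal
    \<open>2 * card U = 2 * card D\<close>.\<close>
  have "ip ?z ?z = 0"
    using UD UD' orthogonal_family_ip_self[OF oU] orthogonal_family_ip_self[OF oD] ip_sym[of "\<Sum>U" "\<Sum>D"]
    unfolding ip_diff_left ip_diff_right by linarith
  moreover have "?z \<in> lattice"
    using oU oD by (auto intro!: lattice_intros lattice_sum dest: orthogonal_familyD roots1D)
  ultimately have "?z = 0" by (rule ip_eq_0D[rotated])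
  then have s: "\<Sum>U = \<Sum>D" by simp
  \<comment> \<open>Weighted by the pairings, the height gains cancel in total by the row and column
    sums. No gain is negative, so linked roots have equal height and coincide.\<close>
  have "(\<Sum>x\<in>U. \<Sum>y\<in>D. ip x y * (ht x - ht y))
      = (\<Sum>x\<in>U. \<Sum>y\<in>D. ip x y * ht x) - (\<Sum>y\<in>D. \<Sum>x\<in>U. ip x y * ht y)"
    by (subst (3) sum.swap) (simp add: right_diff_distrib sum_subtractf)
  also have "\<dots> = 2 * (\<Sum>x\<in>U. ht x) - 2 * (\<Sum>y\<in>D. ht y)"
    by (simp add: sum_distrib_right[symmetric] row col sum_distrib_left)
  also have "\<dots> = 0" using arg_cong[OF s, of ht] by (simp add: ht_sum)
  finally have 0: "(\<Sum>x\<in>U. \<Sum>y\<in>D. ip x y * (ht x - ht y)) = 0" .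
  have nn: "ip x y * (ht x - ht y) \<ge> 0" if xy: "x \<in> U" "y \<in> D" for x y
  proof (cases "ip x y = 0")
    case False
    obtain w where w: "w \<in> A" "ip w y = 1" "y \<le> w" using xy(2) by (auto simp: D_def)
    have xy': "x \<in> A" "y \<in> B" using xy by (auto simp: U_def D_def)
    have "\<not> x \<le> y \<or> x = y"
      using w xy'(1) A(2) unfolding antichain_def by (metis order_antisym order_trans)
    then have "y \<le> x"
      using False roots1_ip[OF r[OF xy']] roots1_ip_1_comparable[OF r[OF xy']] by blast
    then show ?thesis
      using ht_mono[of y x] roots1_ip_nonneg[OF r[OF xy']] by auto
  qed simp
  have "\<forall>x\<in>U. (\<Sum>y\<in>D. ip x y * (ht x - ht y)) = 0"
    using 0 nn fin by (subst (asm) sum_nonneg_eq_0_iff) (auto intro: sum_nonneg)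
  moreover have "x \<in> U" "y \<in> D" using xy by (auto simp: U_def D_def)
  ultimately have "(\<Sum>y\<in>D. ip x y * (ht x - ht y)) = 0" by blast
  then have "\<forall>y\<in>D. ip x y * (ht x - ht y) = 0"
    using nn \<open>x \<in> U\<close> fin by (subst (asm) sum_nonneg_eq_0_iff) auto
  then have "ht x = ht y" using \<open>y \<in> D\<close> xy(3) by auto
  then have "y = x" using ht_eq_imp_eq[OF xy(4)] roots1D(3)[OF r(1)] roots1D(3)[OF r(2)] xy by metis
  then show False using xy(3) roots1D(4)[OF r(1)[OF xy(1,2)]] by simp
qed

text \<open>Each \<open>y\<close> in \<open>B\<close> pairs to 2 in total with \<open>A\<close>.
  Pairing 1 is excluded in both directions by \<open>no_upward_link\<close>, so a member that pairs
  positively with \<open>y\<close> is \<open>y\<close> itself.\<close>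

lemma antichain_sum_subset:
  assumes A: "orthogonal_family A" "antichain roots1 (\<le>) A"
    and B: "orthogonal_family B" "antichain roots1 (\<le>) B" and eq: "\<Sum>A = \<Sum>B"
  shows "B \<subseteq> A"
proof
  fix y assume y: "y \<in> B"
  have "(\<Sum>x\<in>A. ip x y) = 2"
    using A eq y by (intro orthogonal_sum_ip[OF B(1), of A]) (auto dest: orthogonal_familyD)
  then have "\<not> (\<forall>x\<in>A. ip x y \<le> 0)" using sum_nonpos[of A "\<lambda>x. ip x y"] by fastforce
  then obtain x where x: "x \<in> A" "ip x y > 0" by (auto simp: not_le)
  have r: "x \<in> roots1" "y \<in> roots1" using x y A B by (auto dest: orthogonal_familyD)
  have "ip x y \<noteq> 1"
  proof
    assume 1: "ip x y = 1"
    then consider "y \<le> x" | "x \<le> y" using roots1_ip_1_comparable[OF r] by blast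
    then show False
      using no_upward_link[OF A B eq x(1) y 1] no_upward_link[OF B A eq[symmetric] y x(1)] 1 ip_sym[of x y]
      by cases auto
  qed
  then show "y \<in> A" using roots1_ip[OF r] x by auto
qed

lemma antichain_sum_inject:
  assumes "orthogonal_family A" "antichain roots1 (\<le>) A" "orthogonal_family B" "antichain roots1 (\<le>) B" "\<Sum>A = \<Sum>B"
  shows "A = B"
  using antichain_sum_subset[OF assms] antichain_sum_subset[OF assms(3,4,1,2) assms(5)[symmetric]] by blast

section \<open>Antichains of size \<open>k\<close> and weights with coefficient \<open>k\<close> at
  \<open>p\<close>\<close>

definition level :: "nat \<Rightarrow> (nat \<Rightarrow> int) set" where
  "level k = {c \<in> depths. c p = int k}"

lemma antichains_size_orthogonal:
  assumes "finite roots1" "A \<in> antichains_size roots1 (\<le>) k"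
  shows "orthogonal_family A" "antichain roots1 (\<le>) A" "card A = k"
  using assms antichain_orthogonal[of A] by (auto simp: antichains_size_def antichain_def intro: finite_subset)

lemma antichain_sum_level:
  assumes "finite roots1" "A \<in> antichains_size roots1 (\<le>) k"
  shows "\<Sum>A \<in> level k"
  using antichains_size_orthogonal[OF assms] orthogonal_sum_depths sum_roots1_p
  by (auto simp: level_def orthogonal_family_def)

lemma bij_betw_antichains_level:
  assumes "finite roots1"
  shows "bij_betw (\<lambda>A. \<Sum>A) (antichains_size roots1 (\<le>) k) (level k)"
proof (rule bij_betw_imageI)
  show "inj_on (\<lambda>A. \<Sum>A) (antichains_size roots1 (\<le>) k)"
    using antichains_size_orthogonal[OF assms] antichain_sum_inject by (metis (mono_tags, lifting) inj_onI)
  show "(\<lambda>A. \<Sum>A) ` antichains_size roots1 (\<le>) k = level k"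
  proof (intro equalityI subsetI)
    fix c assume c: "c \<in> level k"
    then obtain S where S: "orthogonal_family S" "antichain roots1 (\<le>) S" "\<Sum>S = c"
      using antichain_decomposition by (auto simp: level_def)
    have "int (card S) = c p" using S sum_roots1_p[of S] by (auto simp: orthogonal_family_def)
    then have "S \<in> antichains_size roots1 (\<le>) k" using S c by (simp add: antichains_size_def level_def)
    then show "c \<in> (\<lambda>A. \<Sum>A) ` antichains_size roots1 (\<le>) k" using S by blast
  qed (use antichain_sum_level[OF assms] in auto)
qed

text \<open>If some other member \<open>y\<close> were below the raised root but not below
  \<open>x\<close>, the difference would vanish at \<open>i\<close> and pair nonpositively with
  alpha_i, whereas the pairing is -1 + 2 - 0 = 1.\<close>

lemma antichain_raise:
  assumes S: "orthogonal_family S" "antichain roots1 (\<le>) S" and i: "i \<in> {1..n}" "i \<noteq> p"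
    and x: "x \<in> S" "ip x (unit_vec i) = -1" "\<And>y. y \<in> S \<Longrightarrow> y \<noteq> x \<Longrightarrow> ip y (unit_vec i) = 0"
  shows "antichain roots1 (\<le>) (insert (x + unit_vec i) (S - {x}))"
proof -
  let ?e = "unit_vec i"
  have r: "x + ?e \<in> roots1" using S x i orthogonal_familyD(2) by (auto intro: roots1_add_unit)
  have no: "\<not> y \<le> x + ?e \<and> \<not> x + ?e \<le> y" if y: "y \<in> S" "y \<noteq> x" for y
  proof (intro conjI notI)
    assume le: "y \<le> x + ?e"
    have "\<not> y \<le> x" using y x S(2) by (auto simp: antichain_def)
    define d where "d = x + ?e - y"
    have "d i = 0"
    proof (rule ccontr)
      assume "d i \<noteq> 0"
      then have "y i \<le> x i" using le_funD[OF le, of i] by (simp add: d_def unit_vec_apply)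
      then have "y \<le> x" using le by (auto simp: le_fun_def unit_vec_apply split: if_splits)
      with \<open>\<not> y \<le> x\<close> show False ..
    qed
    moreover have "0 \<le> d" using le by (auto simp: le_fun_def d_def)
    ultimately have "ip d ?e \<le> 0"
      by (intro ip_disjoint_le_0) (auto simp: le_fun_def unit_vec_apply)
    then show False using x(2) x(3)[OF y] ip_unit_self[OF i(1)] by (simp add: d_def ip_bilinear)
  next
    assume "x + ?e \<le> y"
    moreover have "x \<le> x + ?e" by (auto simp: le_fun_def unit_vec_apply)
    ultimately have "x \<le> y" by (rule order_trans[rotated])
    then show False using y x S(2) by (auto simp: antichain_def)
  qed
  show ?thesis using S(2) r no unfolding antichain_def by blast
qed

lemma antichain_le_imp_sum_le:
  assumes fin: "finite roots1" and "antichain_le roots1 (\<le>) k A B"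
  shows "\<Sum>A \<le> \<Sum>B"
  using assms(2) unfolding antichain_le_def
proof (induction rule: rtranclp_induct)
  case (step B C)
  obtain x y where xy: "B - C = {x}" "C - B = {y}" "x \<le> y" and "finite B" "finite C"
    using step(2) antichains_size_orthogonal(1)[OF fin] orthogonal_familyD(1)
    unfolding antichain_prec_def by blast
  have "\<Sum>B = \<Sum>(B \<inter> C) + x" "\<Sum>C = \<Sum>(B \<inter> C) + y"
    using sum.Int_Diff[of B "\<lambda>x. x" C] sum.Int_Diff[of C "\<lambda>x. x" B] \<open>finite B\<close> \<open>finite C\<close> xy
    by (simp_all add: Int_commute)
  then have "\<Sum>B \<le> \<Sum>C" using xy(3) by (simp add: le_fun_def)
  with step.IH show ?case by (rule order_trans)
qed simp

text \<open>\<open>depths_step_up\<close> gives a simple step between the sums. Both have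
  coefficient \<open>k\<close> at \<open>p\<close>, so the step avoids \<open>p\<close> and is
  realised by raising one member of the antichain.\<close>

lemma sum_le_imp_antichain_le:
  assumes fin: "finite roots1"
    and "A \<in> antichains_size roots1 (\<le>) k" "B \<in> antichains_size roots1 (\<le>) k" "\<Sum>A \<le> \<Sum>B"
  shows "antichain_le roots1 (\<le>) k A B"
  using assms(2-)
proof (induction "nat (ht (\<Sum>B) - ht (\<Sum>A))" arbitrary: A rule: less_induct)
  case less
  note A = antichains_size_orthogonal[OF fin less.prems(1)]
    and B = antichains_size_orthogonal[OF fin less.prems(2)]
  note lA = antichain_sum_level[OF fin less.prems(1)] and lB = antichain_sum_level[OF fin less.prems(2)]
  show ?case
  proof (cases "\<Sum>A = \<Sum>B")
    case True
    then have "A = B" using antichain_sum_inject A B by blast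
    then show ?thesis by (simp add: antichain_le_def)
  next
    case False
    obtain i where i: "i \<in> {1..n}" "(\<Sum>A) i < (\<Sum>B) i" "pr (\<Sum>A) (unit_vec i) = 1" "\<Sum>A + unit_vec i \<le> \<Sum>B"
      using depths_step_up[OF _ _ less.prems(3) False] lA lB unfolding level_def by blast
    have ip: "i \<noteq> p" using i(2) lA lB by (auto simp: level_def)
    obtain x where x: "x \<in> A" "ip x (unit_vec i) = -1" "\<And>y. y \<in> A \<Longrightarrow> y \<noteq> x \<Longrightarrow> ip y (unit_vec i) = 0"
      using raised_member_exists[OF A(1) i(1) ip i(3)] by blast
    let ?A = "insert (x + unit_vec i) (A - {x})"
    note o = orthogonal_family_raise[OF A(1) i(1) ip x] and c = antichain_raise[OF A(1,2) i(1) ip x]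
    have "card ?A = k"
      using o(3) A(3) x(1) orthogonal_familyD(1)[OF A(1)] card_Suc_Diff1[of A x] by (auto simp: card_insert_if)
    then have A': "?A \<in> antichains_size roots1 (\<le>) k" using c by (simp add: antichains_size_def)
    have s: "\<Sum>?A = \<Sum>A + unit_vec i" by (rule o(2))
    have "nat (ht (\<Sum>B) - ht (\<Sum>?A)) < nat (ht (\<Sum>B) - ht (\<Sum>A))"
      using ht_mono[OF i(4)] i(1) by (simp add: s ht_add ht_unit del: sum.insert)
    then have "antichain_le roots1 (\<le>) k ?A B"
      using less.hyps A' less.prems(2) i(4) o(2) by metis
    moreover have "antichain_prec roots1 (\<le>) k A ?A"
    proof -
      have "x \<noteq> x + unit_vec i" using o(3) x(1) by auto
      then have "A - ?A = {x}" "?A - A = {x + unit_vec i}" using x(1) o(3) by auto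
      moreover have "x \<le> x + unit_vec i" by (auto simp: le_fun_def unit_vec_apply)
      ultimately show ?thesis
        using A' less.prems(1) \<open>x \<noteq> x + unit_vec i\<close> unfolding antichain_prec_def by blast
    qed
    ultimately show ?thesis unfolding antichain_le_def by (rule converse_rtranclp_into_rtranclp[rotated])
  qed
qed


subsection \<open>Weights as order ideals of roots\<close>

text \<open>An arbitrary choice for the last step of a chain from 0 to \<open>c\<close>;
  \<open>path_state_step\<close> frees the result from it.\<close>

definition descent :: "(nat \<Rightarrow> int) \<Rightarrow> nat" where
  "descent c = (SOME i. i \<in> {1..n} \<and> pr c (unit_vec i) = -1)"

primrec path_aux :: "(nat \<Rightarrow> 's \<Rightarrow> 's) \<Rightarrow> 's \<Rightarrow> nat \<Rightarrow> (nat \<Rightarrow> int) \<Rightarrow> 's" where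
  "path_aux G s 0 c = s"
| "path_aux G s (Suc m) c = G (descent c) (path_aux G s m (c - unit_vec (descent c)))"

text \<open>The result of applying to \<open>s\<close> the operators \<open>G i\<close> along some chain of simple steps from 0 to \<open>c\<close>.\<close>

definition path_state :: "(nat \<Rightarrow> 's \<Rightarrow> 's) \<Rightarrow> 's \<Rightarrow> (nat \<Rightarrow> int) \<Rightarrow> 's" where
  "path_state G s c = path_aux G s (nat (ht c)) c"

lemma path_state_zero: "path_state G s 0 = s"
  by (simp add: path_state_def ht_zero)

lemma descent:
  assumes "c \<in> depths" "c \<noteq> 0"
  shows "descent c \<in> {1..n}" "pr c (unit_vec (descent c)) = -1" "c - unit_vec (descent c) \<in> depths"
    "path_state G s c = G (descent c) (path_state G s (c - unit_vec (descent c)))"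
proof -
  obtain i where "i \<in> {1..n}" "pr c (unit_vec i) = -1"
    using depths_step_down[OF depths_zero assms(1) depths_nonneg[OF assms(1)]] assms(2) by metis
  then have *: "descent c \<in> {1..n} \<and> pr c (unit_vec (descent c)) = -1"
    unfolding descent_def by (intro someI[of "\<lambda>i. i \<in> {1..n} \<and> pr c (unit_vec i) = -1"]) auto
  then show d: "descent c \<in> {1..n}" "pr c (unit_vec (descent c)) = -1" by auto
  show m: "c - unit_vec (descent c) \<in> depths"
    using depths_diff_root[OF assms(1) root_unit[OF d(1)] d(2)] .
  have "nat (ht c) = Suc (nat (ht (c - unit_vec (descent c))))"
    using d(1) ht_mono[OF depths_nonneg[OF m]] by (simp add: ht_diff ht_unit ht_zero)
  then show "path_state G s c = G (descent c) (path_state G s (c - unit_vec (descent c)))"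
    by (simp add: path_state_def)
qed

text \<open>If the chosen last step \<open>j\<close> differs from \<open>i\<close>, then
  \<open>c\<close> pairs to \<open>-1 + a i j\<close> with alpha_j. This is at least -1, so
  \<open>a i j = 0\<close>, the operators commute, and both routes continue from
  \<open>c - unit_vec j\<close>.\<close>

lemma path_state_step:
  assumes comm: "\<And>i j x. i \<in> {1..n} \<Longrightarrow> j \<in> {1..n} \<Longrightarrow> i \<noteq> j \<Longrightarrow> a i j = 0 \<Longrightarrow> G i (G j x) = G j (G i x)"
    and "c \<in> depths" "i \<in> {1..n}" "pr c (unit_vec i) = 1"
  shows "path_state G s (c + unit_vec i) = G i (path_state G s c)"
  using assms(2-)
proof (induction "nat (ht c)" arbitrary: c i rule: less_induct)
  case less
  let ?c = "c + unit_vec i"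
  define j where "j = descent ?c"
  have c': "?c \<in> depths" using depths_add_root root_unit less.prems by blast
  have i1: "c i + 1 \<noteq> 0" using le_funD[OF depths_nonneg[OF less.prems(1)], of i] by simp
  have "?c \<noteq> 0"
  proof
    assume "?c = 0"
    then have "?c i = 0" by simp
    then show False using i1 by (simp add: unit_vec_apply)
  qed
  note d = descent[OF c' this, folded j_def]
  show ?case
  proof (cases "j = i")
    case True
    then show ?thesis using d(4)[of G s] by simp
  next
    case False
    let ?b = "c - unit_vec j"
    have aij: "a i j = 0 \<or> a i j = -1" using a_off[OF less.prems(2) d(1)] False by blast
    have "pr c (unit_vec j) = -1 + a i j"
      using d(2) ip_unit_unit[OF less.prems(2) d(1)] by (simp add: pr_add_left)
    then have z: "a i j = 0" "pr c (unit_vec j) = -1"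
      using aij pr_root_bounds[OF less.prems(1) root_unit[OF d(1)]] by auto
    have b: "?b \<in> depths" using depths_diff_root[OF less.prems(1) root_unit[OF d(1)] z(2)] .
    have "a j i = 0" using z(1) a_sym[OF less.prems(2) d(1)] by simp
    then have bi: "pr ?b (unit_vec i) = 1" "pr ?b (unit_vec j) = 1"
      using less.prems(3) z(2) ip_unit_unit[OF d(1) less.prems(2)] ip_unit_self[OF d(1)] by (auto simp: pr_diff_left)
    have lt: "nat (ht ?b) < nat (ht c)"
      using ht_mono[OF depths_nonneg[OF b]] d(1) by (simp add: ht_diff ht_unit ht_zero)
    have "?c - unit_vec j = ?b + unit_vec i" by simp
    then have "path_state G s ?c = G j (path_state G s (?b + unit_vec i))" using d(4)[of G s] by (simp only:)
    also have "\<dots> = G j (G i (path_state G s ?b))" using less.hyps[OF lt b less.prems(2) bi(1)] by simp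
    also have "\<dots> = G i (G j (path_state G s ?b))"
      using comm[OF less.prems(2) d(1) False[symmetric] z(1)] by simp
    also have "G j (path_state G s ?b) = path_state G s (?b + unit_vec j)"
      using less.hyps[OF lt b d(1) bi(2)] by simp
    finally show ?thesis by (simp only: diff_add_cancel)
  qed
qed

section \<open>Simple reflections and minimal coset representatives\<close>

definition reflect :: "nat \<Rightarrow> (nat \<Rightarrow> int) \<Rightarrow> nat \<Rightarrow> int" where
  "reflect i x = (\<lambda>k. x k - ip x (unit_vec i) * unit_vec i k)"

lemma ip_reflect_left: "ip (reflect i x) y = ip x y - ip x (unit_vec i) * ip (unit_vec i) y"
proof -
  have "reflect i x = x - (\<lambda>k. ip x (unit_vec i) * unit_vec i k)"
    by (simp add: reflect_def fun_eq_iff)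
  then show ?thesis by (simp add: ip_diff_left ip_scale_left)
qed

lemma ip_reflect_right: "ip y (reflect i x) = ip y x - ip x (unit_vec i) * ip y (unit_vec i)"
  using ip_reflect_left[of i x y] ip_sym by metis

lemma ip_reflect: "i \<in> {1..n} \<Longrightarrow> ip (reflect i x) (reflect i y) = ip x y"
  using ip_sym[of "unit_vec i" y] by (simp add: ip_reflect_left ip_reflect_right ip_unit_self algebra_simps)

lemma reflect_add: "reflect i (x + y) = reflect i x + reflect i y"
  by (simp add: reflect_def fun_eq_iff ip_add_left algebra_simps)

lemma reflect_reflect:
  assumes "i \<in> {1..n}"
  shows "reflect i (reflect i x) = x"
proof -
  have "ip (reflect i x) (unit_vec i) = - ip x (unit_vec i)"
    using assms by (simp add: ip_reflect_left ip_unit_self)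
  then show ?thesis by (simp add: reflect_def[of i "reflect i x"]) (simp add: reflect_def)
qed

lemma reflect_commute:
  assumes "i \<in> {1..n}" "j \<in> {1..n}" "a i j = 0"
  shows "reflect i (reflect j x) = reflect j (reflect i x)"
proof -
  have "ip (unit_vec i) (unit_vec j) = 0" "ip (unit_vec j) (unit_vec i) = 0"
    using assms a_sym by (auto simp: ip_unit_unit)
  then have "ip (reflect j x) (unit_vec i) = ip x (unit_vec i)" "ip (reflect i x) (unit_vec j) = ip x (unit_vec j)"
    by (auto simp: ip_reflect_left)
  then show ?thesis
    by (simp add: reflect_def[of i "reflect j x"] reflect_def[of j "reflect i x"]) (simp add: reflect_def algebra_simps)
qed

lemma reflect_lattice: "i \<in> {1..n} \<Longrightarrow> x \<in> lattice \<Longrightarrow> reflect i x \<in> lattice"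
  by (auto simp: lattice_def reflect_def unit_vec_apply)

lemma reflect_root: "i \<in> {1..n} \<Longrightarrow> x \<in> roots \<Longrightarrow> reflect i x \<in> roots"
  by (auto simp: roots_def reflect_lattice ip_reflect)

lemma reflect_unit: "i \<in> {1..n} \<Longrightarrow> reflect i (unit_vec i) = - unit_vec i"
  by (simp add: reflect_def fun_eq_iff ip_unit_self)

lemma reflect_minus: "reflect i (- x) = - reflect i x"
  by (simp add: reflect_def fun_eq_iff ip_minus_left)

text \<open>Only coordinate \<open>i\<close> changes. If the result is negative, \<open>x\<close> is
  supported at \<open>i\<close>, and norm 2 leaves only alpha_i.\<close>

lemma reflect_nonneg:
  assumes "i \<in> {1..n}" "x \<in> roots" "0 \<le> x" "x \<noteq> unit_vec i"
  shows "0 \<le> reflect i x"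
proof (rule ccontr)
  assume "\<not> ?thesis"
  then have "reflect i x \<le> 0" using root_pos_or_neg reflect_root assms by blast
  then have z: "x k = 0" if "k \<noteq> i" for k
    using that assms(3) by (auto simp: le_fun_def reflect_def unit_vec_apply antisym dest!: spec[of _ k])
  then have x: "x = (\<lambda>k. x i * unit_vec i k)" by (auto simp: fun_eq_iff unit_vec_apply)
  have "ip x x = x i * x i * 2"
    using assms(1) by (subst (1 2) x) (simp add: ip_scale_left ip_sym[of _ "\<lambda>k. _ * _ k"] ip_unit_self)
  then have "x i * x i = 1" using rootsD[OF assms(2)] by simp
  moreover have "x i \<ge> 0" using assms(3) by (auto simp: le_fun_def)
  ultimately have "x i = 1" by (auto simp: zmult_eq_1_iff)
  then show False using x assms(4) by simp
qed

text \<open>The Weyl group element of minimal length that takes \<open>\<omega>\<^sub>p\<close> to \<open>\<omega>\<^sub>p - c\<close>.\<close>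

definition transport :: "(nat \<Rightarrow> int) \<Rightarrow> (nat \<Rightarrow> int) \<Rightarrow> nat \<Rightarrow> int" where
  "transport = path_state (\<lambda>i w x. reflect i (w x)) id"

lemma transport_zero: "transport 0 x = x"
  by (simp add: transport_def path_state_zero)

lemma transport_step:
  "c \<in> depths \<Longrightarrow> i \<in> {1..n} \<Longrightarrow> pr c (unit_vec i) = 1 \<Longrightarrow>
    transport (c + unit_vec i) x = reflect i (transport c x)"
  unfolding transport_def by (subst path_state_step) (auto intro!: reflect_commute)

lemma transport_add: "c \<in> depths \<Longrightarrow> transport c (x + y) = transport c x + transport c y"
  by (induction c rule: depths_induct) (simp_all only: transport_zero transport_step reflect_add)

lemma transport_diff: "c \<in> depths \<Longrightarrow> transport c (x - y) = transport c x - transport c y"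
  using transport_add[of c "x - y" y] by (simp add: algebra_simps)

lemma transport_minus: "c \<in> depths \<Longrightarrow> transport c (- x) = - transport c x"
  using transport_add[of c "- x" x] transport_diff[of c x x] by (simp add: eq_neg_iff_add_eq_0)

lemma ip_transport: "c \<in> depths \<Longrightarrow> ip (transport c x) (transport c y) = ip x y"
  by (induction c rule: depths_induct) (simp_all only: transport_zero transport_step ip_reflect)

lemma transport_root: "c \<in> depths \<Longrightarrow> x \<in> roots \<Longrightarrow> transport c x \<in> roots"
  by (induction c rule: depths_induct) (simp_all only: transport_zero transport_step reflect_root)

lemma transport_surj:
  assumes "c \<in> depths" "x \<in> roots"
  obtains y where "y \<in> roots" "transport c y = x"
proof -
  have "\<exists>y. y \<in> roots \<and> transport c y = x"
    using assms
  proof (induction c arbitrary: x rule: depths_induct)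
    case (step c i)
    obtain y where "y \<in> roots" "transport c y = reflect i x"
      using step.IH[of "reflect i x"] step reflect_root by blast
    then show ?case using step by (auto simp: transport_step reflect_reflect simp del: plus_fun_apply)
  qed (auto simp: transport_zero)
  then show ?thesis using that by blast
qed

lemma transport_inject:
  assumes "c \<in> depths" "x \<in> lattice" "y \<in> lattice" "transport c x = transport c y"
  shows "x = y"
proof -
  have "transport c (x - y) = 0" using assms by (simp add: transport_diff)
  then have "ip (x - y) (x - y) = 0" using ip_transport[OF assms(1), of "x - y" "x - y"] by (simp add: ip_zero_left)
  then have "x - y = 0" using assms by (intro ip_eq_0D lattice_intros)
  then show ?thesis by simp
qed

text \<open>With w for \<open>transport c\<close>: w takes omega_p to omega_p - c and preserves the
  form, so w x pairs with this weight as x does with omega_p.\<close>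

lemma pr_transport:
  assumes "c \<in> depths"
  shows "pr c (transport c x) = x p"
  using assms
proof (induction c rule: depths_induct)
  case (step c i)
  let ?y = "transport c x"
  have "reflect i ?y p = ?y p - ip ?y (unit_vec i) * unit_vec i p" by (simp add: reflect_def)
  moreover have "unit_vec i p = 1 + ip c (unit_vec i)" using step(3) by (simp add: pr_def)
  moreover have "ip (unit_vec i) ?y = ip ?y (unit_vec i)" by (rule ip_sym)
  ultimately have "pr (c + unit_vec i) (reflect i ?y) = pr c ?y"
    using step(2) by (simp add: pr_def ip_reflect_right ip_add_left ip_unit_self algebra_simps)
  then show ?case using step by (simp add: transport_step del: plus_fun_apply)
qed (simp only: transport_zero pr_zero_left)

text \<open>A reflection s_i makes only the positive root alpha_i negative. At such a step alpha_i
  pairs to 1 with the current weight and the image of alpha_j pairs to 0, so they differ.\<close>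

lemma transport_nonneg_unit:
  assumes "c \<in> depths" "j \<in> {1..n}" "j \<noteq> p"
  shows "0 \<le> transport c (unit_vec j)"
  using assms(1)
proof (induction c rule: depths_induct)
  case (step c i)
  have "pr c (transport c (unit_vec j)) = 0"
    using pr_transport[OF step(1)] assms(3) by (simp add: unit_vec_apply)
  then have "transport c (unit_vec j) \<noteq> unit_vec i" using step(3) by auto
  then have "0 \<le> reflect i (transport c (unit_vec j))"
    using step assms(2) by (intro reflect_nonneg transport_root root_unit)
  then show ?case using step by (simp only: transport_step)
qed (simp only: transport_zero, simp add: le_fun_def unit_vec_apply)

lemma transport_nonneg:
  assumes "c \<in> depths" "x \<in> lattice" "0 \<le> x" "x p = 0"
  shows "0 \<le> transport c x"
  using assms(2-)
proof (induction "nat (ht x)" arbitrary: x rule: less_induct)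
  case less
  show ?case
  proof (cases "x = 0")
    case True
    then show ?thesis using transport_diff[OF assms(1), of x x] by simp
  next
    case False
    then obtain j where "x j \<noteq> 0" by (auto simp: fun_eq_iff)
    then have j: "j \<in> {1..n}" "j \<noteq> p" "x j \<ge> 1"
      using less.prems le_funD[OF less.prems(2), of j] by (auto simp: lattice_def)
    let ?y = "x - unit_vec j"
    have y: "?y \<in> lattice" "0 \<le> ?y" "?y p = 0"
      using less.prems j by (auto simp: le_fun_def unit_vec_apply intro!: lattice_intros)
    have "nat (ht ?y) < nat (ht x)"
      using ht_mono[OF y(2)] j(1) by (auto simp: ht_diff ht_unit ht_zero)
    then have "0 \<le> transport c ?y" using less.hyps y by blast
    moreover have "transport c x = transport c ?y + transport c (unit_vec j)"
      using transport_add[OF assms(1), of ?y "unit_vec j"] by simp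
    ultimately show ?thesis using transport_nonneg_unit[OF assms(1) j(1,2)] by (simp add: le_fun_def)
  qed
qed

section \<open>Inversion sets as order ideals\<close>

definition inversions :: "(nat \<Rightarrow> int) \<Rightarrow> (nat \<Rightarrow> int) set" where
  "inversions c = {g \<in> roots1. transport c g \<le> 0}"

lemma not_inversion: "c \<in> depths \<Longrightarrow> g \<in> roots1 \<Longrightarrow> g \<notin> inversions c \<longleftrightarrow> 0 \<le> transport c g"
  using root_pos_or_neg[OF transport_root, of c g] root_nonzero[OF transport_root, of c g]
  by (auto simp: inversions_def roots1D intro: antisym)

lemma inversions_zero: "inversions 0 = {}"
  using not_inversion[OF depths_zero] roots1_nonneg by (auto simp: transport_zero inversions_def)

text \<open>\<open>g - h\<close> is nonnegative with coefficient 0 at \<open>p\<close>, so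
  \<open>transport_nonneg\<close> keeps the image of \<open>h\<close> below that of
  \<open>g\<close>.\<close>

lemma inversions_downset:
  assumes "c \<in> depths" "g \<in> inversions c" "h \<in> roots1" "h \<le> g"
  shows "h \<in> inversions c"
proof -
  have g: "g \<in> roots1" "transport c g \<le> 0" using assms(2) by (auto simp: inversions_def)
  have "0 \<le> transport c (g - h)"
    using assms g by (intro transport_nonneg) (auto simp: roots1D le_fun_def intro!: lattice_intros)
  then have "transport c h \<le> transport c g"
    using assms(1) by (simp add: transport_diff le_fun_def)
  then show ?thesis using g(2) assms(3) by (auto simp: inversions_def)
qed

text \<open>The new inversion is the preimage of alpha_i, whose coefficient at \<open>p\<close> is
  \<open>pr c (unit_vec i) = 1\<close>.\<close>

lemma inversions_step:
  assumes c: "c \<in> depths" and i: "i \<in> {1..n}" "pr c (unit_vec i) = 1"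
  obtains g where "g \<in> roots1" "transport c g = unit_vec i" "g \<notin> inversions c"
    "inversions (c + unit_vec i) = insert g (inversions c)"
    "transport (c + unit_vec i) g = - unit_vec i"
proof -
  obtain g where g: "g \<in> roots" "transport c g = unit_vec i"
    using transport_surj[OF c root_unit[OF i(1)]] by blast
  then have g1: "g \<in> roots1" using pr_transport[OF c, of g] i(2) by (simp add: roots1_def)
  have e: "0 \<le> unit_vec i" by (simp add: le_fun_def unit_vec_apply)
  have ng: "g \<notin> inversions c" using not_inversion[OF c g1] g(2) e by simp
  have c': "c + unit_vec i \<in> depths" using depths_add_root root_unit c i by blast
  have "h \<in> inversions (c + unit_vec i) \<longleftrightarrow> h = g \<or> h \<in> inversions c" if h: "h \<in> roots1" for h
  proof (cases "h = g")
    case True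
    have "transport (c + unit_vec i) g \<le> 0"
      unfolding transport_step[OF c i] g(2) reflect_unit[OF i(1)] using e by (simp add: le_fun_def)
    then show ?thesis using True g1 by (simp add: inversions_def)
  next
    case False
    then have "transport c h \<noteq> unit_vec i"
      using transport_inject[OF c, of h g] g(2) roots1D(3) h g1 by auto
    \<comment> \<open>An image equal to -alpha_i would lose an inversion, but images of
      \<open>roots1\<close> pair to 1 with the weight and -alpha_i pairs to -1.\<close>
    moreover have "- transport c h \<noteq> unit_vec i"
    proof
      assume "- transport c h = unit_vec i"
      then have "pr c (- transport c h) = 1" using i(2) by simp
      then show False using pr_transport[OF c, of h] roots1D(2)[OF h] by (simp add: pr_minus_right)
    qed
    moreover have rt: "transport c h \<in> roots" using transport_root c h roots1D by blast
    ultimately have "0 \<le> transport c h \<Longrightarrow> 0 \<le> reflect i (transport c h)"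
      "0 \<le> - transport c h \<Longrightarrow> 0 \<le> reflect i (- transport c h)"
      using i(1) root_uminus by (blast intro: reflect_nonneg)+
    then show ?thesis
      using False not_inversion[OF c h] not_inversion[OF c' h] h
      by (auto simp: transport_step[OF c i] inversions_def reflect_minus le_fun_def simp del: plus_fun_apply)
  qed
  then have "inversions (c + unit_vec i) = insert g (inversions c)"
    using g1 by (auto simp: inversions_def)
  then show ?thesis
    using that[OF g1 g(2) ng] by (simp add: transport_step[OF c i] g(2) reflect_unit[OF i(1)] del: plus_fun_apply)
qed

text \<open>The two preimages have coefficients in -1, 0, 1 at \<open>p\<close> with sum 1, so one
  of them lies in \<open>roots1\<close> and the other has coefficient 0.\<close>

lemma transport_split:
  assumes c: "c \<in> depths" and g: "g \<in> roots1" and x: "x \<in> roots" "y \<in> roots" "transport c g = x + y"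
  obtains h k where "h \<in> roots1" "k \<in> roots" "k p = 0" "g = h + k"
    "transport c h = x \<and> transport c k = y \<or> transport c h = y \<and> transport c k = x"
proof -
  obtain u v where uv: "u \<in> roots" "transport c u = x" "v \<in> roots" "transport c v = y"
    using transport_surj[OF c] x by metis
  have "transport c (u + v) = transport c g" using uv x c by (simp only: transport_add)
  then have e: "g = u + v"
    using transport_inject[OF c, of "u + v" g] uv g by (auto simp: roots1D rootsD lattice_intros)
  then have "u p + v p = 1" using roots1D(2)[OF g] by simp
  then consider "u p = 1" "v p = 0" | "u p = 0" "v p = 1"
    using root_p_bounds[OF uv(1)] root_p_bounds[OF uv(3)] by auto
  then show ?thesis
  proof cases
    case 1 then show ?thesis using that[of u v] uv e by (simp add: roots1_def)
  next
    case 2 then show ?thesis using that[of v u] uv e by (simp add: roots1_def add.commute del: plus_fun_apply)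
  qed
qed

lemma transport_sign:
  assumes "c \<in> depths" "k \<in> roots" "k p = 0" "0 \<le> transport c k"
  shows "0 \<le> k"
proof (rule ccontr)
  assume "\<not> ?thesis"
  then have "0 \<le> - k" using root_pos_or_neg[OF assms(2)] by (auto simp: le_fun_def)
  then have "0 \<le> transport c (- k)"
    using assms by (intro transport_nonneg) (auto simp: rootsD lattice_intros)
  then have "transport c k = 0" using assms(1,4) by (auto simp: transport_minus le_fun_def fun_eq_iff intro: antisym)
  then show False using root_nonzero[OF transport_root[OF assms(1,2)]] by simp
qed

text \<open>If the positive image of \<open>g\<close> were not simple, one could split off a simple
  root and pull back: \<open>g = h + k\<close> with \<open>k\<close> positive and \<open>h\<close>
  again no inversion, against minimality.\<close>

lemma transport_minimal_simple:
  assumes c: "c \<in> depths" and g: "g \<in> roots1" "g \<notin> inversions c"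
    and min: "\<And>h. h \<in> roots1 \<Longrightarrow> h \<le> g \<Longrightarrow> h \<noteq> g \<Longrightarrow> h \<in> inversions c"
  obtains i where "i \<in> {1..n}" "transport c g = unit_vec i"
proof -
  have tr: "transport c g \<in> roots" "0 \<le> transport c g"
    using transport_root c g roots1D not_inversion by blast+
  have "\<exists>i\<in>{1..n}. transport c g = unit_vec i"
  proof (rule ccontr)
    assume "\<not> ?thesis"
    then obtain i where i: "i \<in> {1..n}" "transport c g - unit_vec i \<in> roots" "0 \<le> transport c g - unit_vec i"
      using positive_root_decompose[OF tr] by blast
    have "0 \<le> unit_vec i" by (simp add: le_fun_def unit_vec_apply)
    moreover have "transport c g = unit_vec i + (transport c g - unit_vec i)" by simp
    ultimately obtain h k where hk: "h \<in> roots1" "k \<in> roots" "k p = 0" "g = h + k" "0 \<le> transport c h" "0 \<le> transport c k"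
      using transport_split[OF c g(1) root_unit[OF i(1)] i(2)] i(3) by metis
    have "0 \<le> k" using transport_sign[OF c] hk by blast
    then have "h \<le> g" using hk(4) by (simp add: le_fun_def)
    moreover have "h \<noteq> g" using hk(4) root_nonzero[OF hk(2)] by simp
    ultimately have "h \<in> inversions c" using min hk(1) by blast
    then show False using not_inversion[OF c hk(1)] hk(5) by simp
  qed
  then show ?thesis using that by blast
qed

text \<open>The mirror image: a nonsimple image splits into negative roots, \<open>k\<close> is
  negative, and the inversion \<open>h\<close> lies above \<open>g\<close>.\<close>

lemma transport_maximal_simple:
  assumes c: "c \<in> depths" and g: "g \<in> inversions c"
    and max: "\<And>h. h \<in> roots1 \<Longrightarrow> g \<le> h \<Longrightarrow> h \<noteq> g \<Longrightarrow> h \<notin> inversions c"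
  obtains i where "i \<in> {1..n}" "transport c g = - unit_vec i"
proof -
  have g1: "g \<in> roots1" using g by (simp add: inversions_def)
  have tr: "- transport c g \<in> roots" "0 \<le> - transport c g"
    using transport_root[OF c roots1D(1)[OF g1]] root_uminus g by (auto simp: inversions_def le_fun_def)
  have "\<exists>i\<in>{1..n}. - transport c g = unit_vec i"
  proof (rule ccontr)
    assume "\<not> ?thesis"
    then obtain i where i: "i \<in> {1..n}" "- transport c g - unit_vec i \<in> roots" "0 \<le> - transport c g - unit_vec i"
      using positive_root_decompose[OF tr] by blast
    let ?x = "- unit_vec i" and ?y = "- (- transport c g - unit_vec i)"
    have xy: "?x \<in> roots" "?y \<in> roots" using root_uminus root_unit i(1,2) by blast+
    have "?x \<le> 0" by (simp add: le_fun_def unit_vec_apply)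
    moreover have "?y \<le> 0"
    proof (rule le_funI)
      show "?y k \<le> 0 k" for k using le_funD[OF i(3), of k] by simp
    qed
    moreover have "transport c g = ?x + ?y" by simp
    ultimately obtain h k where hk: "h \<in> roots1" "k \<in> roots" "k p = 0" "g = h + k" "transport c h \<le> 0" "transport c k \<le> 0"
      using transport_split[OF c g1 xy] by metis
    have "0 \<le> - k"
      using transport_sign[OF c root_uminus[OF hk(2)]] hk(3,6) c by (simp add: transport_minus le_fun_def)
    then have "g \<le> h" using hk(4) by (simp add: le_fun_def)
    moreover have "h \<noteq> g" using hk(4) root_nonzero[OF hk(2)] by simp
    ultimately have "h \<notin> inversions c" using max hk(1) by blast
    then show False using hk(1,5) by (simp add: inversions_def)
  qed
  then obtain i where "i \<in> {1..n}" "- transport c g = unit_vec i" by blast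
  then show ?thesis using that[of i] by (metis minus_minus)
qed

lemma inversions_mono:
  assumes "c \<in> depths" "d \<in> depths" "c \<le> d"
  shows "inversions c \<subseteq> inversions d"
  using assms
proof (induction "nat (ht d - ht c)" arbitrary: c rule: less_induct)
  case less
  show ?case
  proof (cases "c = d")
    case False
    obtain i where i: "i \<in> {1..n}" "pr c (unit_vec i) = 1" "c + unit_vec i \<in> depths" "c + unit_vec i \<le> d"
      using depths_step_up[OF less.prems False] by metis
    have "nat (ht d - ht (c + unit_vec i)) < nat (ht d - ht c)"
      using ht_mono[OF i(4)] i(1) by (simp add: ht_add ht_unit)
    then have "inversions (c + unit_vec i) \<subseteq> inversions d" using less.hyps i less.prems by blast
    moreover have "inversions c \<subseteq> inversions (c + unit_vec i)"
      using inversions_step[OF less.prems(1) i(1,2)] by (metis subset_insertI)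
    ultimately show ?thesis by blast
  qed simp
qed

text \<open>An element of least height in \<open>D\<close> outside the inversion set has only
  inversions strictly below it, because \<open>D\<close> is an ideal. Its image is then simple, and
  that step adds exactly this root. Starting at 0 gives surjectivity; the bound
  \<open>c \<le> d\<close> gives the order.\<close>

lemma inversions_extend:
  assumes fin: "finite roots1" and D: "D \<in> order_ideals roots1 (\<le>)" and "c \<in> depths" "inversions c \<subseteq> D"
  shows "\<exists>d\<in>depths. c \<le> d \<and> inversions d = D"
  using assms(3,4)
proof (induction "card (D - inversions c)" arbitrary: c rule: less_induct)
  case less
  have Df: "finite D" "D \<subseteq> roots1" using D fin by (auto simp: order_ideals_def intro: finite_subset)
  show ?case
  proof (cases "inversions c = D")
    case True
    then show ?thesis using less.prems by blast
  next
    case False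
    then obtain g where g: "g \<in> D" "g \<notin> inversions c"
      and min: "\<And>h. h \<in> D \<and> h \<notin> inversions c \<Longrightarrow> nat (ht g) \<le> nat (ht h)"
      using less.prems(2) ex_has_least_nat[of "\<lambda>g. g \<in> D \<and> g \<notin> inversions c" _ "\<lambda>g. nat (ht g)"] by blast
    have g1: "g \<in> roots1" using g Df by blast
    have "h \<in> inversions c" if h: "h \<in> roots1" "h \<le> g" "h \<noteq> g" for h
    proof (rule ccontr)
      assume "h \<notin> inversions c"
      moreover have "h \<in> D" using D g(1) h by (auto simp: order_ideals_def)
      ultimately have "nat (ht g) \<le> nat (ht h)" using min by blast
      moreover have "ht h < ht g" using ht_strict_mono h g1 roots1D by blast
      moreover have "0 \<le> ht h" using ht_mono[OF roots1_nonneg[OF h(1)]] by (simp add: ht_zero)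
      ultimately show False by linarith
    qed
    then obtain i where i: "i \<in> {1..n}" "transport c g = unit_vec i"
      using transport_minimal_simple[OF less.prems(1) g1 g(2)] by blast
    have pi: "pr c (unit_vec i) = 1" using pr_transport[OF less.prems(1), of g] i(2) roots1D(2)[OF g1] by simp
    obtain h where h: "h \<in> roots1" "transport c h = unit_vec i" "inversions (c + unit_vec i) = insert h (inversions c)"
      using inversions_step[OF less.prems(1) i(1) pi] by metis
    have "h = g" using transport_inject[OF less.prems(1)] h i(2) g1 roots1D(3) by metis
    then have N: "inversions (c + unit_vec i) = insert g (inversions c)" using h(3) by simp
    have c': "c + unit_vec i \<in> depths" using depths_add_root root_unit less.prems(1) i(1) pi by blast
    have "card (D - inversions (c + unit_vec i)) < card (D - inversions c)"
      unfolding N using g Df by (intro psubset_card_mono) auto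
    then obtain d where "d \<in> depths" "c + unit_vec i \<le> d" "inversions d = D"
      using less.hyps[OF _ c'] N less.prems(2) g(1) by auto
    moreover have "c \<le> c + unit_vec i" by (simp add: le_fun_def unit_vec_apply)
    ultimately show ?thesis using order_trans by blast
  qed
qed

text \<open>The inversion \<open>g\<close> gained in the last step is maximal in the common set, so
  its image at \<open>d\<close> is some -alpha_j. Undoing step \<open>j\<close> removes
  \<open>g\<close> there too; induction identifies the shortened vectors, and alpha_i and alpha_j
  are both the image of \<open>g\<close>.\<close>

lemma inversions_inject:
  assumes "c \<in> depths" "d \<in> depths" "inversions c = inversions d"
  shows "c = d"
  using assms
proof (induction c arbitrary: d rule: depths_induct)
  case zero
  show ?case
  proof (rule ccontr)
    assume "0 \<noteq> d"
    then obtain i where i: "i \<in> {1..n}" "pr d (unit_vec i) = -1" "d - unit_vec i \<in> depths"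
      using depths_step_down[OF depths_zero zero(1) depths_nonneg[OF zero(1)]] by metis
    then have "pr (d - unit_vec i) (unit_vec i) = 1" by (simp add: pr_diff_left ip_unit_self)
    from inversions_step[OF i(3,1) this] have "inversions d \<noteq> {}" by auto
    then show False using zero(2) inversions_zero by metis
  qed
next
  case (step b i)
  note d = step.prems(1)
  obtain g where g: "g \<in> roots1" "transport b g = unit_vec i" "g \<notin> inversions b"
    "inversions (b + unit_vec i) = insert g (inversions b)"
    using inversions_step[OF step.hyps] by metis
  then have Nd: "inversions d = insert g (inversions b)" using step.prems by simp
  have "h \<notin> inversions d" if "h \<in> roots1" "g \<le> h" "h \<noteq> g" for h
    using that g inversions_downset[OF step.hyps(1), of h g] Nd by auto
  then obtain j where j: "j \<in> {1..n}" "transport d g = - unit_vec j"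
    using transport_maximal_simple[OF d, of g] Nd by blast
  have pj: "pr d (unit_vec j) = -1"
    using pr_transport[OF d, of g] roots1D(2)[OF g(1)] j(2) by (simp add: pr_minus_right)
  let ?d = "d - unit_vec j"
  have d': "?d \<in> depths" using depths_diff_root[OF d root_unit[OF j(1)] pj] .
  have "pr ?d (unit_vec j) = 1" using pj j(1) by (simp add: pr_diff_left ip_unit_self)
  then obtain h where h: "h \<in> roots1" "transport ?d h = unit_vec j" "h \<notin> inversions ?d"
    "inversions (?d + unit_vec j) = insert h (inversions ?d)" "transport (?d + unit_vec j) h = - unit_vec j"
    using inversions_step[OF d' j(1)] by metis
  have "transport d h = transport d g" using h(5) j(2) by simp
  then have "h = g" using transport_inject[OF d] h(1) g(1) roots1D(3) by blast
  then have "inversions d = insert g (inversions ?d)" using h(4) by simp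
  then have "inversions b = inversions ?d" using Nd g(3) h(3) \<open>h = g\<close> by (metis insert_ident)
  then have b: "b = ?d" using step.IH[OF d'] by blast
  then have "unit_vec i = unit_vec j" using g(2) h(2) \<open>h = g\<close> by simp
  then show ?case using b by simp
qed

lemma order_iso_inversions:
  assumes "finite roots1"
  shows "bij_betw inversions depths (order_ideals roots1 (\<le>))"
    "c \<in> depths \<Longrightarrow> d \<in> depths \<Longrightarrow> inversions c \<subseteq> inversions d \<longleftrightarrow> c \<le> d"
proof -
  have ideal: "inversions c \<in> order_ideals roots1 (\<le>)" if "c \<in> depths" for c
    using inversions_downset[OF that] by (auto simp: order_ideals_def inversions_def)
  show "bij_betw inversions depths (order_ideals roots1 (\<le>))"
  proof (rule bij_betw_imageI)
    show "inj_on inversions depths" using inversions_inject by (auto intro: inj_onI)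
    show "inversions ` depths = order_ideals roots1 (\<le>)"
      using ideal inversions_extend[OF assms _ depths_zero] by (auto simp: inversions_zero)
  qed
  assume cd: "c \<in> depths" "d \<in> depths"
  show "inversions c \<subseteq> inversions d \<longleftrightarrow> c \<le> d"
    using inversions_mono[OF cd] inversions_extend[OF assms ideal[OF cd(2)] cd(1)] inversions_inject cd(2) by blast
qed

end

subsection \<open>Poset isomorphisms\<close>

definition order_embedding_bij :: "('a \<Rightarrow> 'b) \<Rightarrow> 'a set \<Rightarrow> ('a \<Rightarrow> 'a \<Rightarrow> bool) \<Rightarrow> 'b set \<Rightarrow> ('b \<Rightarrow> 'b \<Rightarrow> bool) \<Rightarrow> bool" where
  "order_embedding_bij f X R Y S \<longleftrightarrow> bij_betw f X Y \<and> (\<forall>x\<in>X. \<forall>y\<in>X. R x y \<longleftrightarrow> S (f x) (f y))"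

lemma order_iso_alt: "order_iso X R Y S \<longleftrightarrow> (\<exists>f. order_embedding_bij f X R Y S)"
  by (simp add: order_iso_def order_embedding_bij_def)

lemma order_embedding_bij_inv:
  assumes "order_embedding_bij f X R Y S"
  shows "order_embedding_bij (inv_into X f) Y S X R"
proof -
  have f: "bij_betw f X Y" and e: "\<And>x y. x \<in> X \<Longrightarrow> y \<in> X \<Longrightarrow> R x y \<longleftrightarrow> S (f x) (f y)"
    using assms by (auto simp: order_embedding_bij_def)
  have g: "inv_into X f y \<in> X" "f (inv_into X f y) = y" if "y \<in> Y" for y
    using f that by (auto simp: bij_betw_def inv_into_into f_inv_into_f)
  show ?thesis
    using bij_betw_inv_into[OF f] g e by (auto simp: order_embedding_bij_def)
qed

lemma order_embedding_bij_trans: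
  "order_embedding_bij f X R Y S \<Longrightarrow> order_embedding_bij g Y S Z T \<Longrightarrow> order_embedding_bij (g \<circ> f) X R Z T"
  unfolding order_embedding_bij_def by (auto intro: bij_betw_trans simp: bij_betw_apply)

text \<open>In \<open>J(P)\<close> the principal ideals are the elements below which there is a largest element.\<close>

definition principal_ideals :: "'a set set \<Rightarrow> 'a set set" where
  "principal_ideals \<D> = {D \<in> \<D>. \<exists>M\<in>\<D>. M \<subset> D \<and> (\<forall>D'\<in>\<D>. D' \<subset> D \<longrightarrow> D' \<subseteq> M)}"

lemma order_embedding_bij_principal:
  assumes po: "partial_order_on' P le"
  shows "order_embedding_bij (\<lambda>x. {y \<in> P. le y x}) P le (principal_ideals (order_ideals P le)) (\<subseteq>)"
proof -
  let ?d = "\<lambda>x. {y \<in> P. le y x}"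
  have refl: "le x x" if "x \<in> P" for x using po that by (simp add: partial_order_on'_def)
  have anti: "x = y" if "x \<in> P" "y \<in> P" "le x y" "le y x" for x y
    using po that unfolding partial_order_on'_def by blast
  have tr: "le x z" if "x \<in> P" "y \<in> P" "z \<in> P" "le x y" "le y z" for x y z
    using po that unfolding partial_order_on'_def by blast
  have ideal: "?d x \<in> order_ideals P le" if "x \<in> P" for x
    using that tr unfolding order_ideals_def by blast
  have prin: "?d x \<in> principal_ideals (order_ideals P le)" if x: "x \<in> P" for x
  proof -
    \<comment> \<open>The largest ideal strictly inside a principal ideal is obtained by removing
      the generator.\<close>
    have "?d x - {x} \<in> order_ideals P le"
      using x tr anti unfolding order_ideals_def by blast
    moreover have "?d x - {x} \<subset> ?d x" using x refl by blast
    moreover have "D \<subseteq> ?d x - {x}" if D: "D \<in> order_ideals P le" "D \<subset> ?d x" for D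
    proof -
      have "x \<notin> D" using D x unfolding order_ideals_def by blast
      then show ?thesis using D by blast
    qed
    ultimately show ?thesis
      using ideal[OF x] unfolding principal_ideals_def mem_Collect_eq by (intro conjI bexI[of _ "?d x - {x}"] ballI impI) simp_all
  qed
  have "D \<in> ?d ` P" if D: "D \<in> principal_ideals (order_ideals P le)" for D
  proof -
    obtain M where M: "M \<in> order_ideals P le" "M \<subset> D"
      "\<forall>D'\<in>order_ideals P le. D' \<subset> D \<longrightarrow> D' \<subseteq> M"
      using D unfolding principal_ideals_def mem_Collect_eq by (elim conjE bexE) (rule that)
    \<comment> \<open>Any element of \<open>D\<close> outside \<open>M\<close> generates
      \<open>D\<close>: its principal ideal is not inside \<open>M\<close>, so it is not a proper
      subset of \<open>D\<close>.\<close>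
    obtain x where x: "x \<in> D" "x \<notin> M" using M(2) by blast
    have Do: "D \<in> order_ideals P le" using D by (simp add: principal_ideals_def)
    then have xP: "x \<in> P" using x by (auto simp: order_ideals_def)
    have "?d x \<subseteq> D" using Do x unfolding order_ideals_def by blast
    moreover have "\<not> ?d x \<subset> D" using bspec[OF M(3) ideal[OF xP]] x refl[OF xP] xP by blast
    ultimately have "?d x = D" by blast
    then show ?thesis using xP by blast
  qed
  then have im: "?d ` P = principal_ideals (order_ideals P le)" using prin by blast
  have le: "le x y \<longleftrightarrow> ?d x \<subseteq> ?d y" if xy: "x \<in> P" "y \<in> P" for x y
  proof
    show "?d x \<subseteq> ?d y" if "le x y" using tr[OF _ xy _ that] by blast
    show "le x y" if "?d x \<subseteq> ?d y" using that refl[OF xy(1)] xy(1) by blast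
  qed
  have "x = y" if "x \<in> P" "y \<in> P" "?d x = ?d y" for x y
    using anti[OF that(1,2)] le[OF that(1,2)] le[OF that(2,1)] that(3) by simp
  then have "inj_on ?d P" by (rule inj_onI)
  then show ?thesis unfolding order_embedding_bij_def bij_betw_def using im le by simp
qed

text \<open>Principality is phrased by inclusion alone, so inclusion isomorphisms respect
  it.\<close>

lemma order_embedding_bij_principal_ideals:
  assumes f: "order_embedding_bij f \<D> (\<subseteq>) \<E> (\<subseteq>)"
  shows "order_embedding_bij f (principal_ideals \<D>) (\<subseteq>) (principal_ideals \<E>) (\<subseteq>)"
proof -
  have b: "bij_betw f \<D> \<E>" and e: "\<And>x y. x \<in> \<D> \<Longrightarrow> y \<in> \<D> \<Longrightarrow> x \<subseteq> y \<longleftrightarrow> f x \<subseteq> f y"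
    using f by (auto simp: order_embedding_bij_def)
  have e': "x \<subset> y \<longleftrightarrow> f x \<subset> f y" if "x \<in> \<D>" "y \<in> \<D>" for x y
    using e that by (simp add: less_le_not_le)
  have E: "\<E> = f ` \<D>" using b by (simp add: bij_betw_def)
  have iff: "f D \<in> principal_ideals \<E> \<longleftrightarrow> D \<in> principal_ideals \<D>" if "D \<in> \<D>" for D
    unfolding principal_ideals_def E mem_Collect_eq bex_simps ball_simps using that e e' by auto
  have sub: "principal_ideals \<D> \<subseteq> \<D>" "principal_ideals \<E> \<subseteq> f ` \<D>"
    unfolding E by (auto simp: principal_ideals_def)
  then have "f ` principal_ideals \<D> = principal_ideals \<E>"
    using iff by (intro equalityI subsetI) (auto dest!: subsetD)
  moreover have "inj_on f (principal_ideals \<D>)"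
    using b sub(1) by (auto simp: bij_betw_def intro: inj_on_subset)
  ultimately show ?thesis
    unfolding order_embedding_bij_def bij_betw_def using e sub(1) by (simp add: subset_iff)
qed

lemma order_ideals_iso_imp_iso:
  assumes "partial_order_on' P le" "partial_order_on' Q le'"
    and "order_embedding_bij f (order_ideals P le) (\<subseteq>) (order_ideals Q le') (\<subseteq>)"
  obtains h where "order_embedding_bij h P le Q le'"
  using order_embedding_bij_trans[OF order_embedding_bij_trans[OF order_embedding_bij_principal[OF assms(1)]
      order_embedding_bij_principal_ideals[OF assms(3)]]
      order_embedding_bij_inv[OF order_embedding_bij_principal[OF assms(2)]]] by blast

section \<open>Antichains under isomorphism and order reversal\<close>

lemma antichain_image:
  assumes "order_embedding_bij h P le Q le'" "antichain P le A"
  shows "antichain Q le' (h ` A)" "card (h ` A) = card A"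
proof -
  have A: "A \<subseteq> P" using assms(2) by (simp add: antichain_def)
  then show "antichain Q le' (h ` A)"
    using assms unfolding antichain_def order_embedding_bij_def bij_betw_def by (auto 0 4)
  show "card (h ` A) = card A"
    using assms(1) A by (auto simp: order_embedding_bij_def bij_betw_def intro!: card_image inj_on_subset[of h P])
qed

lemma antichain_le_image:
  assumes h: "order_embedding_bij h P le Q le'" and "antichain_le P le k A B"
  shows "antichain_le Q le' k (h ` A) (h ` B)"
  using assms(2) unfolding antichain_le_def
proof (induction rule: rtranclp_induct)
  case (step B C)
  obtain x y where xy: "B - C = {x}" "C - B = {y}" "le x y" "x \<noteq> y"
    and BC: "antichain P le B" "antichain P le C" "card B = k" "card C = k"
    using step(2) unfolding antichain_prec_def antichains_size_def by blast
  have sub: "B \<subseteq> P" "C \<subseteq> P" using BC by (auto simp: antichain_def)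
  have inj: "inj_on h P" using h by (simp add: order_embedding_bij_def bij_betw_def)
  have xyP: "x \<in> P" "y \<in> P" using sub xy by blast+
  moreover from this have "h ` B - h ` C = {h x}" "h ` C - h ` B = {h y}"
    using inj_on_image_set_diff[OF inj, of B C, symmetric] inj_on_image_set_diff[OF inj, of C B, symmetric] sub xy(1,2)
    by (simp_all add: Diff_subset[THEN order_trans])
  moreover have "le' (h x) (h y)" "h x \<noteq> h y"
    using h xy(3,4) xyP inj by (auto simp: order_embedding_bij_def inj_on_def)
  moreover have "h ` B \<in> antichains_size Q le' k" "h ` C \<in> antichains_size Q le' k"
    using antichain_image[OF h BC(1)] antichain_image[OF h BC(2)] BC(3,4) by (simp_all add: antichains_size_def)
  ultimately have "antichain_prec Q le' k (h ` B) (h ` C)"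
    unfolding antichain_prec_def by (intro conjI exI[of _ "h x"] exI[of _ "h y"])
  with step.IH show ?case by simp
qed simp

lemma order_embedding_bij_antichains:
  assumes h: "order_embedding_bij h P le Q le'"
  shows "order_embedding_bij (image h) (antichains_size P le k) (antichain_le P le k)
    (antichains_size Q le' k) (antichain_le Q le' k)"
proof -
  note g = order_embedding_bij_inv[OF h]
  have inj: "inj_on h P" and im: "h ` P = Q" using h by (auto simp: order_embedding_bij_def bij_betw_def)
  have gh: "inv_into P h ` h ` A = A" if "A \<subseteq> P" for A
    using inv_into_image_cancel[OF inj that] .
  have hg: "h ` inv_into P h ` B = B" if "B \<subseteq> Q" for B
    using that im by (simp add: image_inv_into_cancel)
  have s: "A \<subseteq> P" if "A \<in> antichains_size P le k" for A
    using that by (simp add: antichains_size_def antichain_def)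
  have "bij_betw (image h) (antichains_size P le k) (antichains_size Q le' k)"
  proof (rule bij_betw_byWitness[where f'="image (inv_into P h)"])
    show "\<forall>A\<in>antichains_size P le k. inv_into P h ` h ` A = A" using gh s by blast
    show "\<forall>B\<in>antichains_size Q le' k. h ` inv_into P h ` B = B"
      using hg by (auto simp: antichains_size_def antichain_def)
    show "image h ` antichains_size P le k \<subseteq> antichains_size Q le' k"
      using antichain_image[OF h] by (auto simp: antichains_size_def)
    show "image (inv_into P h) ` antichains_size Q le' k \<subseteq> antichains_size P le k"
      using antichain_image[OF g] by (auto simp: antichains_size_def)
  qed
  moreover have "antichain_le P le k A B \<longleftrightarrow> antichain_le Q le' k (h ` A) (h ` B)"
    if "A \<in> antichains_size P le k" "B \<in> antichains_size P le k" for A B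
    using antichain_le_image[OF h, of k A B] antichain_le_image[OF g, of k "h ` A" "h ` B"] gh s that by metis
  ultimately show ?thesis by (simp add: order_embedding_bij_def)
qed

lemma antichain_converse:
  assumes "antichain P R A"
  shows "antichain P (\<lambda>x y. R y x) A"
  unfolding antichain_def
proof (intro conjI ballI impI)
  show "A \<subseteq> P" using assms by (simp add: antichain_def)
  fix x y assume "x \<in> A" "y \<in> A" "R y x"
  then have "y = x" using assms unfolding antichain_def by blast
  then show "x = y" ..
qed

lemma antichains_size_converse: "antichains_size P (\<lambda>x y. le y x) k = antichains_size P le k"
  using antichain_converse[of P le] antichain_converse[of P "\<lambda>x y. le y x"] unfolding antichains_size_def by auto

lemma antichain_le_converse: "antichain_le P (\<lambda>x y. le y x) k A B \<longleftrightarrow> antichain_le P le k B A"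
proof -
  have "antichain_prec P (\<lambda>x y. le y x) k = (antichain_prec P le k)\<inverse>\<inverse>"
  proof (intro ext iffI)
    show "(antichain_prec P le k)\<inverse>\<inverse> A B" if "antichain_prec P (\<lambda>x y. le y x) k A B" for A B
      using that unfolding antichain_prec_def antichains_size_converse[of P le] conversep_iff by (elim conjE exE) auto
    show "antichain_prec P (\<lambda>x y. le y x) k A B" if "(antichain_prec P le k)\<inverse>\<inverse> A B" for A B
      using that unfolding antichain_prec_def antichains_size_converse[of P le] conversep_iff by (elim conjE exE) auto
  qed
  then show ?thesis by (simp add: antichain_le_def rtranclp_conversep)
qed

text \<open>Every summand in the expansion of the norm of \<open>c - d\<close> has a zero factor.
  The mixed hypothesis covers two uses: all pairings agree, or the pairings away from
  \<open>p\<close> and the coordinate at \<open>p\<close>.\<close>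

lemma (in pointed_form) pr_inject:
  assumes "c \<in> lattice" "d \<in> lattice"
    and "\<And>i. i \<in> {1..n} \<Longrightarrow> c i = d i \<or> pr c (unit_vec i) = pr d (unit_vec i)"
  shows "c = d"
proof -
  let ?x = "c - d"
  have "?x i * ip ?x (unit_vec i) = 0" if "i \<in> {1..n}" for i
    using assms(3)[OF that] by (auto simp: pr_def ip_diff_left)
  then have "(\<Sum>i=1..n. ?x i * ip ?x (unit_vec i)) = 0" by (rule sum.neutral[OF ballI])
  then have "ip ?x ?x = 0" by (subst ip_expand)
  then have "?x = 0" using assms by (intro ip_eq_0D lattice_intros)
  then show ?thesis by simp
qed

section \<open>Connectedness of a level, and the passage to the reversed order\<close>

context minuscule
begin

text \<open>Go down from \<open>c\<close> to the meet and then up to \<open>d\<close>. Each step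
  changes a coordinate in which its end points differ, so it avoids \<open>p\<close> and stays in
  the level.\<close>

lemma level_connected:
  assumes T: "c \<in> T" "c \<in> level k" and d: "d \<in> level k"
    and up: "\<And>b i. b \<in> T \<Longrightarrow> b \<in> level k \<Longrightarrow> i \<in> {1..n} - {p} \<Longrightarrow> pr b (unit_vec i) = 1 \<Longrightarrow> b + unit_vec i \<in> T"
    and down: "\<And>b i. b \<in> T \<Longrightarrow> b \<in> level k \<Longrightarrow> i \<in> {1..n} - {p} \<Longrightarrow> pr b (unit_vec i) = -1 \<Longrightarrow> b - unit_vec i \<in> T"
  shows "d \<in> T"
proof -
  have go_up: "d \<in> T" if "b \<in> T" "b \<in> level k" "d \<in> level k" "b \<le> d" for b d
    using that
  proof (induction "nat (ht d - ht b)" arbitrary: b rule: less_induct)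
    case less
    show ?case
    proof (cases "b = d")
      case False
      obtain i where i: "i \<in> {1..n}" "b i < d i" "pr b (unit_vec i) = 1" "b + unit_vec i \<in> depths" "b + unit_vec i \<le> d"
        using depths_step_up[OF _ _ less.prems(4) False] less.prems by (auto simp: level_def)
      have ip: "i \<noteq> p" using i(2) less.prems by (auto simp: level_def)
      have "b + unit_vec i \<in> level k" using i(4) ip less.prems by (simp add: level_def unit_vec_apply)
      moreover have "nat (ht d - ht (b + unit_vec i)) < nat (ht d - ht b)"
        using ht_mono[OF i(5)] i(1) by (simp add: ht_add ht_unit)
      ultimately show ?thesis using less.hyps[of "b + unit_vec i"] up[OF less.prems(1,2), of i] i ip less.prems by blast
    qed (use less.prems in simp)
  qed
  have go_down: "d \<in> T" if "b \<in> T" "b \<in> level k" "d \<in> level k" "d \<le> b" for b d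
    using that
  proof (induction "nat (ht b - ht d)" arbitrary: b rule: less_induct)
    case less
    show ?case
    proof (cases "b = d")
      case False
      obtain i where i: "i \<in> {1..n}" "d i < b i" "pr b (unit_vec i) = -1" "b - unit_vec i \<in> depths" "d \<le> b - unit_vec i"
        using depths_step_down[OF _ _ less.prems(4) False[symmetric]] less.prems by (auto simp: level_def)
      have ip: "i \<noteq> p" using i(2) less.prems by (auto simp: level_def)
      have "b - unit_vec i \<in> level k" using i(4) ip less.prems by (simp add: level_def unit_vec_apply)
      moreover have "nat (ht (b - unit_vec i) - ht d) < nat (ht b - ht d)"
        using ht_mono[OF i(5)] i(1) by (simp add: ht_diff ht_unit)
      ultimately show ?thesis using less.hyps[of "b - unit_vec i"] down[OF less.prems(1,2), of i] i ip less.prems by blast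
    qed (use less.prems in simp)
  qed
  let ?m = "\<lambda>i. min (c i) (d i)"
  have m: "?m \<in> level k" using depths_min T(2) d by (simp add: level_def)
  have "?m \<in> T" by (rule go_down[OF T m]) (simp add: le_fun_def)
  then show ?thesis by (rule go_up[OF _ m d]) (simp add: le_fun_def)
qed

lemma roots1_subset_depths: "roots1 \<subseteq> depths"
  by (auto simp: depths_def excess_def roots1D)

lemma antichains_iso_level:
  assumes "finite roots1"
  shows "order_embedding_bij (\<lambda>A. \<Sum>A) (antichains_size roots1 (\<lambda>x y. y \<le> x) k) (antichain_le roots1 (\<lambda>x y. y \<le> x) k)
    (level k) (\<lambda>x y. y \<le> x)"
  unfolding order_embedding_bij_def antichains_size_converse[of roots1 "(\<le>)"] antichain_le_converse[of roots1 "(\<le>)"]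
  using bij_betw_antichains_level[OF assms] sum_le_imp_antichain_le[OF assms] antichain_le_imp_sum_le[OF assms] by blast

lemma depths_iso_order_ideals:
  assumes "finite roots1"
  shows "order_embedding_bij (\<lambda>c. roots1 - inversions c) depths (\<lambda>x y. y \<le> x) (order_ideals roots1 (\<lambda>x y. y \<le> x)) (\<subseteq>)"
proof -
  note iso = order_iso_inversions[OF assms]
  have sub: "inversions c \<subseteq> roots1" for c by (auto simp: inversions_def)
  have "bij_betw (\<lambda>D. roots1 - D) (order_ideals roots1 (\<le>)) (order_ideals roots1 (\<lambda>x y. y \<le> x))"
    by (rule bij_betw_byWitness[where f'="\<lambda>D. roots1 - D"]) (auto simp: order_ideals_def)
  from bij_betw_trans[OF iso(1) this] have "bij_betw (\<lambda>c. roots1 - inversions c) depths (order_ideals roots1 (\<lambda>x y. y \<le> x))"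
    by (simp add: comp_def)
  moreover have "d \<le> c \<longleftrightarrow> roots1 - inversions c \<subseteq> roots1 - inversions d" if "c \<in> depths" "d \<in> depths" for c d
    using iso(2)[OF that(2,1)] sub by blast
  ultimately show ?thesis by (simp add: order_embedding_bij_def)
qed

end

subsection \<open>The representation\<close>

lemma csubspace_iff: "csubspace W \<longleftrightarrow> vec.subspace W"
  by (simp add: csubspace_def vec.subspace_def)

lemma scaleR_matrix_vector: "(r *\<^sub>R (A :: complex^'d^'d)) *v v = of_real r *s (A *v v)"
  unfolding matrix_vector_mult_def vec_eq_iff by (simp add: sum_distrib_left) (simp add: scaleR_conv_of_real mult_ac)

lemma comm_vector: "comm A B *v v = A *v (B *v v) - B *v (A *v v)"
  by (simp add: comm_def matrix_vector_mult_diff_rdistrib matrix_vector_mul_assoc)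

locale minuscule_rep = pointed_form n a p
  for n :: nat and a :: "nat \<Rightarrow> nat \<Rightarrow> int" and p :: nat +
  fixes E F H :: "nat \<Rightarrow> complex^'d^'d"
  assumes rep: "serre_rep n a E F H"
    and irred: "simple_submodule {1..n} E F H UNIV"
    and hw: "\<exists>v. v \<noteq> 0 \<and> (\<forall>i\<in>{1..n}. E i *v v = 0 \<and> H i *v v = fund_weight p i *s v)"
    and orbit: "weights_of {1..n} H UNIV \<subseteq> weyl_orbit n a (fund_weight p)"
begin

lemma H_E: "i \<in> {1..n} \<Longrightarrow> j \<in> {1..n} \<Longrightarrow>
    H i *v (E j *v v) = E j *v (H i *v v) + of_int (a i j) *s (E j *v v)"
  and H_F: "i \<in> {1..n} \<Longrightarrow> j \<in> {1..n} \<Longrightarrow>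
    H i *v (F j *v v) = F j *v (H i *v v) - of_int (a i j) *s (F j *v v)"
  and E_F: "i \<in> {1..n} \<Longrightarrow> j \<in> {1..n} \<Longrightarrow>
    E i *v (F j *v v) = F j *v (E i *v v) + (if i = j then H i *v v else 0)"
  and F_commute: "i \<in> {1..n} \<Longrightarrow> j \<in> {1..n} \<Longrightarrow> i \<noteq> j \<Longrightarrow> a i j = 0 \<Longrightarrow>
    F i *v (F j *v v) = F j *v (F i *v v)"
proof -
  assume i: "i \<in> {1..n}" and j: "j \<in> {1..n}"
  have r: "comm (H i) (E j) = (of_int (a i j) :: real) *\<^sub>R E j"
    "comm (H i) (F j) = (- of_int (a i j) :: real) *\<^sub>R F j"
    "comm (E i) (F j) = (if i = j then H i else 0)"
    "i \<noteq> j \<longrightarrow> ((comm (F i)) ^^ nat (1 - a i j)) (F j) = 0"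
    using rep i j unfolding serre_rep_def by blast+
  have "comm (H i) (E j) *v v = of_int (a i j) *s (E j *v v)"
    unfolding r by (simp add: scaleR_matrix_vector)
  then show "H i *v (E j *v v) = E j *v (H i *v v) + of_int (a i j) *s (E j *v v)"
    unfolding comm_vector by (simp add: algebra_simps)
  have "comm (H i) (F j) *v v = - of_int (a i j) *s (F j *v v)"
    unfolding r scaleR_matrix_vector by (simp only: of_real_minus of_real_of_int_eq)
  then show "H i *v (F j *v v) = F j *v (H i *v v) - of_int (a i j) *s (F j *v v)"
    unfolding comm_vector by (simp add: algebra_simps)
  have "comm (E i) (F j) *v v = (if i = j then H i *v v else 0)"
    unfolding r by simp
  then show "E i *v (F j *v v) = F j *v (E i *v v) + (if i = j then H i *v v else 0)"
    unfolding comm_vector by (simp add: algebra_simps)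
  assume "i \<noteq> j" "a i j = 0"
  then have "comm (F i) (F j) *v v = 0" using r(4) by simp
  then show "F i *v (F j *v v) = F j *v (F i *v v)"
    unfolding comm_vector by simp
qed

section \<open>Weight vectors of the module and the minuscule inequality\<close>

definition weight_vec :: "(nat \<Rightarrow> int) \<Rightarrow> complex^'d \<Rightarrow> bool" where
  "weight_vec c v \<longleftrightarrow> (\<forall>i\<in>{1..n}. H i *v v = of_int (pr c (unit_vec i)) *s v)"

lemma weight_vec_E:
  assumes "weight_vec c v" "j \<in> {1..n}"
  shows "weight_vec (c - unit_vec j) (E j *v v)"
  unfolding weight_vec_def
proof
  fix i assume i: "i \<in> {1..n}"
  have e: "pr (c - unit_vec j) (unit_vec i) = pr c (unit_vec i) + a i j"
    using i assms(2) a_sym by (simp add: pr_diff_left ip_unit_unit)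
  have "H i *v v = of_int (pr c (unit_vec i)) *s v" using assms(1) i by (simp add: weight_vec_def)
  then show "H i *v (E j *v v) = of_int (pr (c - unit_vec j) (unit_vec i)) *s (E j *v v)"
    unfolding e H_E[OF i assms(2)] by (simp only: vector_scalar_commute of_int_add vec.scale_left_distrib)
qed

lemma weight_vec_F:
  assumes "weight_vec c v" "j \<in> {1..n}"
  shows "weight_vec (c + unit_vec j) (F j *v v)"
  unfolding weight_vec_def
proof
  fix i assume i: "i \<in> {1..n}"
  have e: "pr (c + unit_vec j) (unit_vec i) = pr c (unit_vec i) - a i j"
    using i assms(2) a_sym by (simp add: pr_add_left ip_unit_unit)
  have "H i *v v = of_int (pr c (unit_vec i)) *s v" using assms(1) i by (simp add: weight_vec_def)
  then show "H i *v (F j *v v) = of_int (pr (c + unit_vec j) (unit_vec i)) *s (F j *v v)"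
    unfolding e H_F[OF i assms(2)] by (simp only: vector_scalar_commute of_int_diff vec.scale_left_diff_distrib)
qed

text \<open>With m the pairing with alpha_i, a reflection adds m alpha_i to \<open>c\<close>, and
  the excess changes by 2 m^2 - 2 m^2 = 0.\<close>

lemma weyl_orbit_excess:
  assumes "\<mu> \<in> weyl_orbit n a (fund_weight p)"
  shows "\<exists>c\<in>lattice. excess c = 0 \<and> (\<forall>i\<in>{1..n}. \<mu> i = of_int (pr c (unit_vec i)))"
  using assms
proof induction
  case base
  show ?case
  proof (rule bexI[OF _ lattice_zero], intro conjI ballI)
    show "excess 0 = 0" by (rule depthsD(2)[OF depths_zero])
    show "fund_weight p i = of_int (pr 0 (unit_vec i))" for i
      unfolding pr_zero_left by (simp add: fund_weight_def unit_vec_apply)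
  qed
next
  case (refl_step \<mu> i)
  then obtain c where c: "c \<in> lattice" "excess c = 0" "\<forall>i\<in>{1..n}. \<mu> i = of_int (pr c (unit_vec i))" by blast
  define m where "m = pr c (unit_vec i)"
  let ?x = "\<lambda>k. m * unit_vec i k"
  have s: "ip ?x y = m * ip (unit_vec i) y" for y by (rule ip_scale_left)
  have x: "?x \<in> lattice" using refl_step(2) by (auto simp: lattice_def unit_vec_apply)
  have xx: "ip ?x ?x = 2 * m * m"
    using s[of ?x] s[of "unit_vec i"] ip_sym[of "unit_vec i" ?x] ip_unit_self[OF refl_step(2)] by simp
  have "pr c ?x = m * m"
    using s[of c] ip_sym[of c] by (simp add: pr_def m_def right_diff_distrib)
  then have "excess (c + ?x) = 0" unfolding excess_add xx using c(2) by simp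
  moreover have "(if j \<in> {1..n} then \<mu> j - \<mu> i * of_int (a j i) else \<mu> j) = of_int (pr (c + ?x) (unit_vec j))"
    if j: "j \<in> {1..n}" for j
  proof -
    have "pr (c + ?x) (unit_vec j) = pr c (unit_vec j) - m * a j i"
      using ip_unit_unit[OF refl_step(2) j] a_sym[OF refl_step(2) j] by (simp only: pr_add_left s)
    moreover have "\<mu> j = of_int (pr c (unit_vec j))" "\<mu> i = of_int m" using c(3) j refl_step(2) by (auto simp: m_def)
    ultimately show ?thesis using j by (simp only: if_True) simp
  qed
  ultimately show ?case using lattice_add[OF c(1) x] by blast
qed

lemma excess_weight:
  assumes "c \<in> lattice" "weight_vec c v" "v \<noteq> 0"
  shows "excess c = 0"
proof -
  let ?\<mu> = "\<lambda>i. if i \<in> {1..n} then of_int (pr c (unit_vec i)) else 0 :: complex"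
  have "?\<mu> \<in> weights_of {1..n} H UNIV"
    using assms unfolding weights_of_def weight_vec_def by auto
  then obtain d where d: "d \<in> lattice" "excess d = 0" "\<forall>i\<in>{1..n}. ?\<mu> i = of_int (pr d (unit_vec i))"
    using orbit weyl_orbit_excess by blast
  have "c = d" using d(3) by (intro pr_inject assms(1) d(1)) simp
  then show ?thesis using d(2) by simp
qed

lemma F_nonzero:
  assumes "c \<in> lattice" "weight_vec c v" "v \<noteq> 0" "j \<in> {1..n}" "F j *v v \<noteq> 0"
  shows "pr c (unit_vec j) = 1"
  using excess_weight[OF assms(1-3)] excess_weight[OF _ weight_vec_F[OF assms(2,4)] assms(5)] assms(1,4)
  by (simp add: lattice_intros excess_add ip_unit_self)

lemma E_nonzero:
  assumes "c \<in> lattice" "weight_vec c v" "v \<noteq> 0" "j \<in> {1..n}" "E j *v v \<noteq> 0"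
  shows "pr c (unit_vec j) = -1"
  using excess_weight[OF assms(1-3)] excess_weight[OF _ weight_vec_E[OF assms(2,4)] assms(5)] assms(1,4)
  by (simp add: lattice_intros excess_diff ip_unit_self)

text \<open>If F_j killed \<open>v\<close>, the relation between E_j and F_j would make
  \<open>E j *v v\<close> nonzero, and \<open>E_nonzero\<close> would give pairing -1.\<close>

lemma F_nonzero_if:
  assumes "c \<in> lattice" "weight_vec c v" "v \<noteq> 0" "j \<in> {1..n}" "pr c (unit_vec j) = 1"
  shows "F j *v v \<noteq> 0"
proof
  assume "F j *v v = 0"
  then have "F j *v (E j *v v) + H j *v v = 0" using E_F[OF assms(4,4), of v] by simp
  moreover have "H j *v v = v" using assms(2,4,5) by (simp add: weight_vec_def)
  ultimately have "E j *v v \<noteq> 0" using assms(3) by auto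
  then show False using E_nonzero[OF assms(1-4)] assms(5) by simp
qed

lemma pr_weight_le_1:
  assumes "c \<in> lattice" "weight_vec c v" "v \<noteq> 0" "j \<in> {1..n}"
  shows "pr c (unit_vec j) \<le> 1"
proof (cases "F j *v v = 0 \<and> E j *v v = 0")
  case True
  then have "H j *v v = 0" using E_F[OF assms(4,4), of v] by simp
  then have "of_int (pr c (unit_vec j)) *s v = 0" using assms(2,4) by (simp add: weight_vec_def)
  then show ?thesis using assms(3) by simp
qed (use F_nonzero[OF assms] E_nonzero[OF assms] in auto)

definition hwv :: "complex^'d" where
  "hwv = (SOME v. v \<noteq> 0 \<and> weight_vec 0 v)"

lemma hwv: "hwv \<noteq> 0" "weight_vec 0 hwv"
proof -
  obtain v where "v \<noteq> 0" "\<forall>i\<in>{1..n}. H i *v v = fund_weight p i *s v" using hw by blast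
  then have "v \<noteq> 0 \<and> weight_vec 0 v"
    unfolding weight_vec_def pr_zero_left by (simp add: fund_weight_def unit_vec_apply)
  then have "hwv \<noteq> 0 \<and> weight_vec 0 hwv" unfolding hwv_def by (rule someI)
  then show "hwv \<noteq> 0" "weight_vec 0 hwv" by auto
qed

text \<open>The walk is applied to the set of weights that occur in the module; nonvanishing of F_i
  provides its steps.\<close>

lemma minuscule_axiom:
  assumes "c \<in> lattice"
  shows "excess c \<ge> 0"
proof (rule excess_nonneg_if_reachable(1)[of "{c \<in> lattice. \<exists>v. v \<noteq> 0 \<and> weight_vec c v}"])
  show "0 \<in> {c \<in> lattice. \<exists>v. v \<noteq> 0 \<and> weight_vec c v}" using hwv lattice_zero by blast
  fix c i assume "c \<in> {c \<in> lattice. \<exists>v. v \<noteq> 0 \<and> weight_vec c v}"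
  then obtain v where c: "c \<in> lattice" and v: "v \<noteq> 0" "weight_vec c v" by blast
  show "excess c = 0" by (rule excess_weight[OF c v(2,1)])
  assume i: "i \<in> {1..n}"
  show "pr c (unit_vec i) \<le> 1" by (rule pr_weight_le_1[OF c v(2,1) i])
  assume "pr c (unit_vec i) = 1"
  then have "F i *v v \<noteq> 0" by (rule F_nonzero_if[OF c v(2,1) i])
  then show "c + unit_vec i \<in> {c \<in> lattice. \<exists>v. v \<noteq> 0 \<and> weight_vec c v}"
    using weight_vec_F[OF v(2) i] lattice_add[OF c lattice_unit[OF i]] by blast
qed (use assms in auto)

sublocale minuscule
  by unfold_locales (rule minuscule_axiom)

text \<open>One vector per weight, normalised so that every E_i and F_i takes it to another such
  vector or to 0.\<close>

definition wvec :: "(nat \<Rightarrow> int) \<Rightarrow> complex^'d" where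
  "wvec = path_state (\<lambda>i v. F i *v v) hwv"

lemma wvec_step:
  "c \<in> depths \<Longrightarrow> i \<in> {1..n} \<Longrightarrow> pr c (unit_vec i) = 1 \<Longrightarrow> wvec (c + unit_vec i) = F i *v wvec c"
  unfolding wvec_def by (rule path_state_step) (rule F_commute)

lemma wvec: "c \<in> depths \<Longrightarrow> weight_vec c (wvec c) \<and> wvec c \<noteq> 0"
proof (induction c rule: depths_induct)
  case zero
  show ?case unfolding wvec_def path_state_zero using hwv by blast
next
  case (step c i)
  then show ?case
    unfolding wvec_step[OF step.hyps]
    using weight_vec_F[of c "wvec c" i] F_nonzero_if[OF depthsD(1), of c "wvec c" i] by blast
qed

lemma H_wvec: "c \<in> depths \<Longrightarrow> i \<in> {1..n} \<Longrightarrow> H i *v wvec c = of_int (pr c (unit_vec i)) *s wvec c"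
  using wvec by (simp add: weight_vec_def)

lemma F_wvec:
  "c \<in> depths \<Longrightarrow> i \<in> {1..n} \<Longrightarrow> F i *v wvec c = (if pr c (unit_vec i) = 1 then wvec (c + unit_vec i) else 0)"
  using wvec_step[of c i] F_nonzero[of c "wvec c" i] wvec[of c] depthsD(1)[of c] by auto

text \<open>Write \<open>wvec c\<close> as F_i of \<open>wvec ?b\<close>. E_i kills
  \<open>wvec ?b\<close>, whose pairing is 1, so E_i F_i acts on it as H_i, that is, as the
  identity.\<close>

lemma E_wvec:
  assumes "c \<in> depths" "i \<in> {1..n}"
  shows "E i *v wvec c = (if pr c (unit_vec i) = -1 then wvec (c - unit_vec i) else 0)"
proof (cases "pr c (unit_vec i) = -1")
  case True
  let ?b = "c - unit_vec i"
  have b: "?b \<in> depths" by (rule depths_diff_root[OF assms(1) root_unit[OF assms(2)] True])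
  have pb: "pr ?b (unit_vec i) = 1" using True assms(2) by (simp add: pr_diff_left ip_unit_self)
  have "E i *v wvec ?b = 0"
    using E_nonzero[OF depthsD(1)[OF b] _ _ assms(2)] wvec[OF b] pb by force
  moreover have "wvec c = F i *v wvec ?b" using wvec_step[OF b assms(2) pb] by (simp only: diff_add_cancel)
  ultimately have "E i *v wvec c = H i *v wvec ?b" using E_F[OF assms(2,2), of "wvec ?b"] by simp
  then show ?thesis using H_wvec[OF b assms(2)] pb True by simp
next
  case False
  then show ?thesis using E_nonzero[OF depthsD(1)[OF assms(1)] _ _ assms(2)] wvec[OF assms(1)] by auto
qed

section \<open>Spans of weight vectors and their submodules\<close>

definition wspan :: "(nat \<Rightarrow> int) set \<Rightarrow> (complex^'d) set" where
  "wspan S = {\<Sum>c\<in>S. k c *s wvec c | k. True}"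

lemma csubspace_wspan: "csubspace (wspan S)"
proof -
  have "0 \<in> wspan S" unfolding wspan_def by (auto intro!: exI[of _ "\<lambda>_. 0"])
  moreover have "x + y \<in> wspan S" if xy: "x \<in> wspan S" "y \<in> wspan S" for x y
  proof -
    obtain k where "x = (\<Sum>c\<in>S. k c *s wvec c)" using xy(1) unfolding wspan_def by blast
    moreover obtain l where "y = (\<Sum>c\<in>S. l c *s wvec c)" using xy(2) unfolding wspan_def by blast
    ultimately have "x + y = (\<Sum>c\<in>S. (k c + l c) *s wvec c)"
      by (simp add: sum.distrib vector_sadd_rdistrib)
    then show ?thesis unfolding wspan_def mem_Collect_eq by (intro exI[of _ "\<lambda>c. k c + l c"]) simp
  qed
  moreover have "r *s x \<in> wspan S" if x: "x \<in> wspan S" for r x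
  proof -
    obtain k where "x = (\<Sum>c\<in>S. k c *s wvec c)" using x unfolding wspan_def by blast
    then have "r *s x = (\<Sum>c\<in>S. (r * k c) *s wvec c)" by (simp add: vec.scale_sum_right)
    then show ?thesis unfolding wspan_def mem_Collect_eq by (intro exI[of _ "\<lambda>c. r * k c"]) simp
  qed
  ultimately show ?thesis unfolding csubspace_def by blast
qed

lemma wvec_in_wspan: "finite S \<Longrightarrow> c \<in> S \<Longrightarrow> wvec c \<in> wspan S"
  unfolding wspan_def mem_Collect_eq
  by (intro exI[of _ "\<lambda>d. if d = c then 1 else 0"]) (simp add: if_distrib[of "\<lambda>t. t *s _"] cong: if_cong)

lemma wspan_subset:
  assumes "csubspace U" "\<And>c. c \<in> S \<Longrightarrow> wvec c \<in> U"
  shows "wspan S \<subseteq> U"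
  using assms unfolding wspan_def csubspace_iff
  by (auto intro!: vec.subspace_sum vec.subspace_scale)

lemma matrix_sum: "A *v (\<Sum>c\<in>S. k c *s wvec c) = (\<Sum>c\<in>S. k c *s (A *v wvec c))"
  by (simp add: vec.linear_sum[OF matrix_vector_mul_linear_gen] vector_scalar_commute)

definition step_closed :: "nat set \<Rightarrow> (nat \<Rightarrow> int) set \<Rightarrow> bool" where
  "step_closed J S \<longleftrightarrow> (\<forall>c\<in>S. \<forall>i\<in>J. (pr c (unit_vec i) = 1 \<longrightarrow> c + unit_vec i \<in> S) \<and>
     (pr c (unit_vec i) = -1 \<longrightarrow> c - unit_vec i \<in> S))"

lemma invariant_wspan:
  assumes "finite S" "S \<subseteq> depths" "J \<subseteq> {1..n}" "step_closed J S"
  shows "invariant J E F H (wspan S)"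
  unfolding invariant_def
proof (intro ballI)
  fix i x assume i: "i \<in> J" and "x \<in> wspan S"
  then obtain k where x: "x = (\<Sum>c\<in>S. k c *s wvec c)" unfolding wspan_def by blast
  have sub: "vec.subspace (wspan S)" using csubspace_wspan csubspace_iff by blast
  have i': "i \<in> {1..n}" using i assms(3) by blast
  have "E i *v wvec c \<in> wspan S \<and> F i *v wvec c \<in> wspan S \<and> H i *v wvec c \<in> wspan S" if c: "c \<in> S" for c
  proof -
    have d: "c \<in> depths" using c assms(2) by blast
    then show ?thesis
      using c i assms(4) wvec_in_wspan[OF assms(1)] vec.subspace_0[OF sub] vec.subspace_scale[OF sub]
      by (simp add: E_wvec[OF d i'] F_wvec[OF d i'] H_wvec[OF d i'] step_closed_def del: minus_fun_apply plus_fun_apply)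
  qed
  then show "E i *v x \<in> wspan S \<and> F i *v x \<in> wspan S \<and> H i *v x \<in> wspan S"
    unfolding x matrix_sum by (auto intro!: vec.subspace_sum[OF sub] vec.subspace_scale[OF sub])
qed

definition separated :: "nat set \<Rightarrow> (nat \<Rightarrow> int) set \<Rightarrow> bool" where
  "separated J S \<longleftrightarrow> (\<forall>c\<in>S. \<forall>d\<in>S. c \<noteq> d \<longrightarrow> (\<exists>j\<in>J. pr c (unit_vec j) \<noteq> pr d (unit_vec j)))"

text \<open>For an index \<open>j\<close> separating \<open>c\<close> from \<open>d\<close>,
  applying H_j minus the eigenvalue \<open>w c\<close> cancels the term of \<open>c\<close> and
  multiplies that of \<open>d\<close> by a nonzero number.\<close>

lemma weight_component:
  assumes U: "csubspace U" "\<And>j x. j \<in> J \<Longrightarrow> x \<in> U \<Longrightarrow> H j *v x \<in> U" and J: "J \<subseteq> {1..n}"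
    and "finite S" "S \<subseteq> depths" "d \<in> depths"
    and "\<And>c. c \<in> S \<Longrightarrow> \<exists>j\<in>J. pr c (unit_vec j) \<noteq> pr d (unit_vec j)"
    and "k d *s wvec d + (\<Sum>c\<in>S. k c *s wvec c) \<in> U"
  shows "k d *s wvec d \<in> U"
  using assms(4-)
proof (induction S arbitrary: k rule: finite_induct)
  case (insert c S)
  have sub: "vec.subspace U" using U(1) by (simp add: csubspace_iff)
  obtain j where j: "j \<in> J" "pr c (unit_vec j) \<noteq> pr d (unit_vec j)" using insert.prems(3) by blast
  define w where "w = (\<lambda>c. of_int (pr c (unit_vec j)) :: complex)"
  have j': "j \<in> {1..n}" using j J by blast
  let ?x = "k d *s wvec d + (\<Sum>c\<in>insert c S. k c *s wvec c)"
  have HS: "H j *v wvec b = w b *s wvec b" if "b \<in> insert d (insert c S)" for b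
    using that insert.prems(1,2) H_wvec[OF _ j', of b] by (auto simp: w_def)
  have "H j *v ?x = (w d * k d) *s wvec d + (\<Sum>b\<in>insert c S. (w b * k b) *s wvec b)"
    unfolding matrix_vector_right_distrib matrix_sum
    by (intro arg_cong2[of _ _ _ _ "(+)"] sum.cong refl) (auto simp: vector_scalar_commute HS mult_ac)
  moreover have "w c *s ?x = (w c * k d) *s wvec d + (\<Sum>b\<in>insert c S. (w c * k b) *s wvec b)"
    by (simp only: vec.scale_right_distrib vec.scale_sum_right vec.scale_scale)
  ultimately have "H j *v ?x - w c *s ?x = ((w d - w c) * k d) *s wvec d
      + (\<Sum>b\<in>insert c S. ((w b - w c) * k b) *s wvec b)"
    by (simp only: left_diff_distrib vec.scale_left_diff_distrib sum_subtractf) (simp only: algebra_simps)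
  also have "\<dots> = ((w d - w c) * k d) *s wvec d + (\<Sum>b\<in>S. ((w b - w c) * k b) *s wvec b)"
    using insert.hyps by simp
  finally have "((w d - w c) * k d) *s wvec d + (\<Sum>b\<in>S. ((w b - w c) * k b) *s wvec b) \<in> U"
    using vec.subspace_diff[OF sub U(2)[OF j(1) insert.prems(4)] vec.subspace_scale[OF sub insert.prems(4), of "w c"]]
    by simp
  then have "((w d - w c) * k d) *s wvec d \<in> U"
    using insert.IH[of "\<lambda>b. (w b - w c) * k b"] insert.prems by auto
  then have "(1 / (w d - w c)) *s (((w d - w c) * k d) *s wvec d) \<in> U"
    by (rule vec.subspace_scale[OF sub])
  moreover have "w d - w c \<noteq> 0" using j(2) by (simp add: w_def)
  ultimately show ?case by (simp add: vec.scale_scale)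
qed simp

lemma weight_components:
  assumes U: "csubspace U" "\<And>j x. j \<in> J \<Longrightarrow> x \<in> U \<Longrightarrow> H j *v x \<in> U" and J: "J \<subseteq> {1..n}"
    and S: "finite S" "S \<subseteq> depths" "separated J S"
    and x: "(\<Sum>c\<in>S. k c *s wvec c) \<in> U" and d: "d \<in> S"
  shows "k d *s wvec d \<in> U"
proof (rule weight_component[OF U J, where S="S - {d}"])
  show "k d *s wvec d + (\<Sum>c\<in>S - {d}. k c *s wvec c) \<in> U" using x S(1) d by (simp add: sum.remove[of S d])
  show "\<exists>j\<in>J. pr c (unit_vec j) \<noteq> pr d (unit_vec j)" if "c \<in> S - {d}" for c
    using that S(3) d by (auto simp: separated_def)
qed (use S d in auto)

lemma separated_depths: "S \<subseteq> depths \<Longrightarrow> separated {1..n} S"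
  unfolding separated_def using pr_inject depthsD(1) by (metis subsetD)

text \<open>On a level the coordinates at \<open>p\<close> agree, which replaces the missing pairing
  with alpha_p.\<close>

lemma separated_level: "separated ({1..n} - {p}) (level k)"
  unfolding separated_def
proof (intro ballI impI, rule ccontr)
  fix c d assume cd: "c \<in> level k" "d \<in> level k" "c \<noteq> d"
    "\<not> (\<exists>j\<in>{1..n} - {p}. pr c (unit_vec j) \<noteq> pr d (unit_vec j))"
  have "c i = d i \<or> pr c (unit_vec i) = pr d (unit_vec i)" if "i \<in> {1..n}" for i
    using that cd by (cases "i = p") (auto simp: level_def)
  then have "c = d" using cd(1,2) by (intro pr_inject) (auto simp: level_def depthsD)
  then show False using cd(3) by simp
qed

lemma wvec_independent:
  assumes "finite S" "S \<subseteq> depths" "(\<Sum>c\<in>S. k c *s wvec c) = 0" "d \<in> S"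
  shows "k d = 0"
proof -
  have "k d *s wvec d \<in> {0}"
    by (rule weight_components[OF _ _ order_refl assms(1,2) separated_depths[OF assms(2)] _ assms(4)])
      (use assms(3) in \<open>auto simp: csubspace_def\<close>)
  then show ?thesis using wvec assms(2,4) by auto
qed

text \<open>A nonzero submodule contains some \<open>wvec c\<close> by
  \<open>weight_components\<close>. The indices of all such vectors in it form a step-closed set,
  and \<open>conn\<close> makes this set everything.\<close>

lemma simple_wspan:
  assumes S: "finite S" "S \<subseteq> depths" "separated J S" "step_closed J S" "S \<noteq> {}" and J: "J \<subseteq> {1..n}"
    and conn: "\<And>T c. T \<subseteq> S \<Longrightarrow> step_closed J T \<Longrightarrow> c \<in> T \<Longrightarrow> T = S"
  shows "simple_submodule J E F H (wspan S)"
  unfolding simple_submodule_def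
proof (intro conjI allI impI)
  show "csubspace (wspan S)" by (rule csubspace_wspan)
  show "invariant J E F H (wspan S)" using S J by (intro invariant_wspan)
  obtain c where "c \<in> S" using S(5) by blast
  then show "wspan S \<noteq> {0}" using wvec_in_wspan[OF S(1)] wvec S(2) by blast
  fix U assume U: "csubspace U \<and> U \<subseteq> wspan S \<and> invariant J E F H U"
  have sub: "vec.subspace U" using U by (simp add: csubspace_iff)
  show "U = {0} \<or> U = wspan S"
  proof (cases "U = {0}")
    case False
    then obtain x where x: "x \<in> U" "x \<noteq> 0" using vec.subspace_0[OF sub] by blast
    then obtain k where k: "x = (\<Sum>c\<in>S. k c *s wvec c)" using U unfolding wspan_def by blast
    have "x = 0" if "\<forall>c\<in>S. k c *s wvec c = 0" unfolding k by (rule sum.neutral[OF that])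
    then obtain c where c: "c \<in> S" "k c *s wvec c \<noteq> 0" using x(2) by blast
    have U': "csubspace U" "\<And>j y. j \<in> J \<Longrightarrow> y \<in> U \<Longrightarrow> H j *v y \<in> U"
      using U by (simp_all add: invariant_def)
    have "k c *s wvec c \<in> U"
      by (rule weight_components[OF U' J S(1-3) _ c(1)]) (use x(1) k in simp_all)
    then have "(1 / k c) *s (k c *s wvec c) \<in> U" by (rule vec.subspace_scale[OF sub])
    moreover have "k c \<noteq> 0" using c(2) by auto
    ultimately have cU: "wvec c \<in> U" by (simp add: vec.scale_scale)
    define T where "T = {c \<in> S. wvec c \<in> U}"
    have "step_closed J T"
      unfolding step_closed_def
    proof (intro ballI conjI impI)
      fix b i assume b: "b \<in> T" and i: "i \<in> J"
      have b': "b \<in> depths" "b \<in> S" "wvec b \<in> U" and i': "i \<in> {1..n}" using b i S(2) J by (auto simp: T_def)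
      have EF: "E i *v wvec b \<in> U" "F i *v wvec b \<in> U" using U b'(3) i by (auto simp: invariant_def)
      show "b + unit_vec i \<in> T" if "pr b (unit_vec i) = 1"
        using EF(2) that S(4) b' i by (auto simp: T_def F_wvec[OF b'(1) i'] step_closed_def simp del: plus_fun_apply)
      show "b - unit_vec i \<in> T" if "pr b (unit_vec i) = -1"
        using EF(1) that S(4) b' i by (auto simp: T_def E_wvec[OF b'(1) i'] step_closed_def simp del: minus_fun_apply)
    qed
    then have "T = S" using c(1) cU by (intro conn[of T c]) (auto simp: T_def)
    then have "wspan S \<subseteq> U" using U by (intro wspan_subset) (auto simp: T_def)
    then show ?thesis using U by blast
  qed simp
qed

lemma step_closed_depths: "step_closed {1..n} depths"
  unfolding step_closed_def using depths_add_root depths_diff_root root_unit by blast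

lemma step_closed_level: "step_closed ({1..n} - {p}) (level k)"
  unfolding step_closed_def
  using depths_add_root depths_diff_root root_unit by (auto simp: level_def unit_vec_apply)

lemma simple_level:
  assumes "finite depths" "level k \<noteq> {}"
  shows "simple_submodule ({1..n} - {p}) E F H (wspan (level k))"
proof (rule simple_wspan)
  show "finite (level k)" using assms(1) by (auto simp: level_def intro: finite_subset)
  show "level k \<subseteq> depths" by (auto simp: level_def)
  fix T c assume T: "T \<subseteq> level k" "step_closed ({1..n} - {p}) T" "c \<in> T"
  have "d \<in> T" if d: "d \<in> level k" for d
    using T by (intro level_connected[of c T k, OF _ _ d]) (auto simp: step_closed_def)
  then show "T = level k" using T(1) by blast
qed (use assms(2) separated_level step_closed_level in auto)

text \<open>Irreducibility enters here: the span is a nonzero invariant subspace.\<close>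

lemma wspan_depths:
  assumes "finite depths"
  shows "wspan depths = UNIV"
proof -
  have "invariant {1..n} E F H (wspan depths)"
    by (rule invariant_wspan[OF assms order_refl order_refl step_closed_depths])
  moreover have "wspan depths \<noteq> {0}"
    using wvec_in_wspan[OF assms depths_zero] wvec[OF depths_zero] by blast
  ultimately show ?thesis
    using irred csubspace_wspan unfolding simple_submodule_def by blast
qed

section \<open>Weights of the spans and their order\<close>

definition restricted_weight :: "nat set \<Rightarrow> (nat \<Rightarrow> int) \<Rightarrow> nat \<Rightarrow> complex" where
  "restricted_weight J c = (\<lambda>i. if i \<in> J then of_int (pr c (unit_vec i)) else 0)"

lemma weights_of_wspan:
  assumes S: "finite S" "S \<subseteq> depths" and J: "J \<subseteq> {1..n}"
  shows "weights_of J H (wspan S) = restricted_weight J ` S"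
proof (intro equalityI subsetI)
  fix \<mu> assume "\<mu> \<in> restricted_weight J ` S"
  then obtain c where c: "c \<in> S" "\<mu> = restricted_weight J c" by blast
  have "c \<in> depths" using c(1) S(2) by blast
  then have "H i *v wvec c = \<mu> i *s wvec c" if "i \<in> J" for i
    using H_wvec[of c i] that J c(2) by (auto simp: restricted_weight_def)
  moreover have "\<mu> i = 0" if "i \<notin> J" for i using c(2) that by (simp add: restricted_weight_def)
  moreover have "wvec c \<in> wspan S" "wvec c \<noteq> 0"
    using wvec_in_wspan[OF S(1) c(1)] wvec \<open>c \<in> depths\<close> by blast+
  ultimately show "\<mu> \<in> weights_of J H (wspan S)"
    unfolding weights_of_def by blast
next
  fix \<mu> assume "\<mu> \<in> weights_of J H (wspan S)"
  then obtain v where v: "v \<in> wspan S" "v \<noteq> 0" "\<forall>i\<in>J. H i *v v = \<mu> i *s v" and \<mu>: "\<forall>i. i \<notin> J \<longrightarrow> \<mu> i = 0"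
    unfolding weights_of_def by blast
  obtain k where k: "v = (\<Sum>c\<in>S. k c *s wvec c)" using v(1) unfolding wspan_def by blast
  have "v = 0" if "\<forall>c\<in>S. k c = 0" unfolding k using that by (intro sum.neutral) simp
  then obtain c where c: "c \<in> S" "k c \<noteq> 0" using v(2) by blast
  have "\<mu> i = restricted_weight J c i" for i
  proof (cases "i \<in> J")
    case True
    have i: "i \<in> {1..n}" using True J by blast
    have "(\<Sum>b\<in>S. (k b * (of_int (pr b (unit_vec i)) - \<mu> i)) *s wvec b) = H i *v v - \<mu> i *s v"
      unfolding k matrix_sum vec.scale_sum_right sum_subtractf[symmetric]
      using S(2) by (intro sum.cong refl) (auto simp: H_wvec[OF _ i] right_diff_distrib vector_sub_rdistrib mult_ac)
    also have "\<dots> = 0" using v(3) True by simp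
    finally have "k c * (of_int (pr c (unit_vec i)) - \<mu> i) = 0" by (rule wvec_independent[OF S _ c(1)])
    then show ?thesis using c(2) True by (simp add: restricted_weight_def)
  qed (use \<mu> in \<open>simp add: restricted_weight_def\<close>)
  then show "\<mu> \<in> restricted_weight J ` S" using c(1) by blast
qed

text \<open>The restricted weights differ by the combination of simple roots with coefficients
  \<open>c j - d j\<close>. No other coefficients are possible: the error \<open>?y\<close> is
  supported in \<open>J\<close> and orthogonal to alpha_i for \<open>i\<close> in \<open>J\<close>,
  so its norm is 0.\<close>

lemma weight_le_restricted:
  assumes "c \<in> lattice" "d \<in> lattice" "J \<subseteq> {1..n}" "\<And>i. i \<in> {1..n} - J \<Longrightarrow> c i = d i"
  shows "weight_le J a (restricted_weight J c) (restricted_weight J d) \<longleftrightarrow> d \<le> c"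
proof -
  have fin: "finite J" using assms(3) by (rule finite_subset) simp
  have diff: "restricted_weight J d i - restricted_weight J c i = of_int (\<Sum>j\<in>J. (c j - d j) * a i j)" if i: "i \<in> J" for i
  proof -
    have "pr d (unit_vec i) - pr c (unit_vec i) = ip (c - d) (unit_vec i)"
      by (simp add: pr_def ip_diff_left)
    also have "\<dots> = (\<Sum>j=1..n. a i j * (c - d) j)" using assms(3) i by (intro ip_unit_right) blast
    also have "\<dots> = (\<Sum>j\<in>J. a i j * (c - d) j)"
      using assms(3,4) by (intro sum.mono_neutral_right) auto
    finally show ?thesis using i by (simp add: restricted_weight_def mult.commute del: of_int_sum flip: of_int_diff)
  qed
  show ?thesis
  proof
    assume "weight_le J a (restricted_weight J c) (restricted_weight J d)"
    then obtain m :: "nat \<Rightarrow> nat" where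
      m: "\<forall>i\<in>J. restricted_weight J d i - restricted_weight J c i = (\<Sum>j\<in>J. of_nat (m j) * of_int (a i j))"
      unfolding weight_le_def by blast
    define x where "x = (\<lambda>j. if j \<in> J then int (m j) else 0)"
    have "of_int (\<Sum>j\<in>J. (c j - d j) * a i j) = (of_int (\<Sum>j\<in>J. int (m j) * a i j) :: complex)" if "i \<in> J" for i
      using m diff that by simp
    then have eq: "(\<Sum>j\<in>J. (c j - d j) * a i j) = (\<Sum>j\<in>J. int (m j) * a i j)" if "i \<in> J" for i
      using that of_int_eq_iff by blast
    let ?y = "c - d - x"
    have y: "?y \<in> lattice" using assms by (auto simp: lattice_def x_def)
    have y0: "?y i = 0" if "i \<in> {1..n} - J" for i using assms(4)[OF that] that by (simp add: x_def)
    have "?y i * ip ?y (unit_vec i) = 0" if i: "i \<in> {1..n}" for i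
    proof (cases "i \<in> J")
      case True
      have "ip ?y (unit_vec i) = (\<Sum>j=1..n. a i j * ?y j)" by (rule ip_unit_right[OF i])
      also have "\<dots> = (\<Sum>j\<in>J. a i j * ?y j)"
        using assms(3) y0 by (intro sum.mono_neutral_right) auto
      also have "\<dots> = (\<Sum>j\<in>J. (c j - d j) * a i j) - (\<Sum>j\<in>J. int (m j) * a i j)"
        unfolding sum_subtractf[symmetric] by (intro sum.cong refl) (simp add: x_def algebra_simps)
      finally show ?thesis using eq[OF True] by simp
    qed (use y0 i in auto)
    then have "(\<Sum>i=1..n. ?y i * ip ?y (unit_vec i)) = 0" by (rule sum.neutral[OF ballI])
    then have "ip ?y ?y = 0" by (subst ip_expand)
    then have "?y = 0" by (rule ip_eq_0D[OF y])
    then have "c = d + x" by (simp add: algebra_simps)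
    then show "d \<le> c" by (simp add: le_fun_def x_def)
  next
    assume "d \<le> c"
    then have "(\<Sum>j\<in>J. of_nat (nat (c j - d j)) * of_int (a i j)) = (of_int (\<Sum>j\<in>J. (c j - d j) * a i j) :: complex)" for i
      unfolding of_int_sum by (intro sum.cong refl) (simp add: le_fun_def)
    then show "weight_le J a (restricted_weight J c) (restricted_weight J d)"
      unfolding weight_le_def using diff by (intro exI[of _ "\<lambda>j. nat (c j - d j)"]) simp
  qed
qed

lemma inj_on_restricted_weight:
  assumes "separated J S"
  shows "inj_on (restricted_weight J) S"
proof (rule inj_onI, rule ccontr)
  fix c d assume cd: "c \<in> S" "d \<in> S" "restricted_weight J c = restricted_weight J d" "c \<noteq> d"
  then obtain j where "j \<in> J" "pr c (unit_vec j) \<noteq> pr d (unit_vec j)"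
    using assms by (auto simp: separated_def)
  then show False using fun_cong[OF cd(3), of j] by (simp add: restricted_weight_def)
qed

lemma order_embedding_bij_weights:
  assumes "finite S" "S \<subseteq> depths" "J \<subseteq> {1..n}" "separated J S"
    and "\<And>c d i. c \<in> S \<Longrightarrow> d \<in> S \<Longrightarrow> i \<in> {1..n} - J \<Longrightarrow> c i = d i"
  shows "order_embedding_bij (restricted_weight J) S (\<lambda>x y. y \<le> x) (weights_of J H (wspan S)) (weight_le J a)"
  unfolding order_embedding_bij_def
proof (intro conjI ballI)
  show "bij_betw (restricted_weight J) S (weights_of J H (wspan S))"
    using weights_of_wspan[OF assms(1-3)] inj_on_restricted_weight[OF assms(4)] by (simp add: bij_betw_def)
  show "d \<le> c \<longleftrightarrow> weight_le J a (restricted_weight J c) (restricted_weight J d)" if "c \<in> S" "d \<in> S" for c d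
    using that assms depthsD(1) by (intro weight_le_restricted[symmetric]) blast+
qed

end

section \<open>The width as index range, and the direct sum of the levels\<close>

lemma antichain_sizes_eq: "{card A |A. antichain P le A} = card ` {A. antichain P le A}"
  by blast

text \<open>Subsets of antichains are antichains, so every size up to the maximum occurs.\<close>

lemma antichains_size_nonempty_iff:
  assumes "finite P"
  shows "antichains_size P le k \<noteq> {} \<longleftrightarrow> k \<le> width P le"
proof -
  let ?C = "{card A |A. antichain P le A}"
  have "{A. antichain P le A} \<subseteq> Pow P" by (auto simp: antichain_def)
  then have fin: "finite ?C"
    unfolding antichain_sizes_eq using assms by (intro finite_imageI finite_subset[OF _ iffD2[OF finite_Pow_iff]])
  have ne: "?C \<noteq> {}" by (auto simp: antichain_def intro!: exI[of _ "{}"])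
  show ?thesis
  proof
    assume "antichains_size P le k \<noteq> {}"
    then have "k \<in> ?C" by (auto simp: antichains_size_def)
    then show "k \<le> width P le" unfolding width_def by (rule Max_ge[OF fin])
  next
    assume k: "k \<le> width P le"
    obtain A where A: "antichain P le A" "card A = width P le"
      using Max_in[OF fin ne] unfolding width_def by auto
    obtain B where "B \<subseteq> A" "card B = k" using k A(2) by (metis obtain_subset_with_card_n)
    then have "B \<in> antichains_size P le k" using A(1) by (auto simp: antichains_size_def antichain_def)
    then show "antichains_size P le k \<noteq> {}" by blast
  qed
qed

context minuscule_rep
begin

lemma finite_depths:
  assumes "finite (weights_of {1..n} H UNIV)"
  shows "finite depths"
proof (rule finite_imageD)
  show "inj_on (restricted_weight {1..n}) depths"
    by (rule inj_on_restricted_weight[OF separated_depths]) simp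
  have "restricted_weight {1..n} c \<in> weights_of {1..n} H UNIV" if "c \<in> depths" for c
  proof -
    have "restricted_weight {1..n} c \<in> weights_of {1..n} H (wspan {c})"
      using weights_of_wspan[of "{c}" "{1..n}"] that by simp
    then show ?thesis unfolding weights_of_def by blast
  qed
  then show "finite (restricted_weight {1..n} ` depths)"
    using assms by (meson finite_subset image_subsetI)
qed

lemma roots1_iso:
  fixes P :: "'p set"
  assumes fin: "finite depths" and po: "partial_order_on' P le"
    and JP: "order_iso (weights_of {1..n} H UNIV) (weight_le {1..n} a) (order_ideals P le) (\<subseteq>)"
  obtains h where "order_embedding_bij h roots1 (\<lambda>x y. y \<le> x) P le"
proof -
  have fin1: "finite roots1" using roots1_subset_depths fin by (rule finite_subset)
  have "order_embedding_bij (restricted_weight {1..n}) depths (\<lambda>x y. y \<le> x)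
      (weights_of {1..n} H (wspan depths)) (weight_le {1..n} a)"
    using separated_depths by (intro order_embedding_bij_weights[OF fin]) auto
  then have w: "order_embedding_bij (restricted_weight {1..n}) depths (\<lambda>x y. y \<le> x)
      (weights_of {1..n} H UNIV) (weight_le {1..n} a)"
    by (simp only: wspan_depths[OF fin])
  obtain f where f: "order_embedding_bij f (weights_of {1..n} H UNIV) (weight_le {1..n} a) (order_ideals P le) (\<subseteq>)"
    using JP unfolding order_iso_alt by blast
  have po1: "partial_order_on' roots1 (\<lambda>x y. y \<le> x)"
    unfolding partial_order_on'_def by auto
  show thesis
    by (rule order_ideals_iso_imp_iso[OF po1 po order_embedding_bij_trans[OF
          order_embedding_bij_inv[OF depths_iso_order_ideals[OF fin1]]
          order_embedding_bij_trans[OF w f]]]) (rule that)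
qed

lemma level_iso:
  assumes fin: "finite depths" and h: "order_embedding_bij h roots1 (\<lambda>x y. y \<le> x) P le"
  shows "order_iso (weights_of ({1..n} - {p}) H (wspan (level k))) (weight_le ({1..n} - {p}) a)
    (antichains_size P le k) (antichain_le P le k)"
    and "level k \<noteq> {} \<longleftrightarrow> antichains_size P le k \<noteq> {}"
proof -
  have fin1: "finite roots1" using roots1_subset_depths fin by (rule finite_subset)
  have "level k \<subseteq> depths" by (auto simp: level_def)
  then have w: "order_embedding_bij (restricted_weight ({1..n} - {p})) (level k) (\<lambda>x y. y \<le> x)
      (weights_of ({1..n} - {p}) H (wspan (level k))) (weight_le ({1..n} - {p}) a)"
    using separated_level finite_subset[OF _ fin]
    by (intro order_embedding_bij_weights) (auto simp: level_def)
  note l = order_embedding_bij_trans[OF order_embedding_bij_inv[OF antichains_iso_level[OF fin1, of k]]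
      order_embedding_bij_antichains[OF h]]
  show "order_iso (weights_of ({1..n} - {p}) H (wspan (level k))) (weight_le ({1..n} - {p}) a)
      (antichains_size P le k) (antichain_le P le k)"
    unfolding order_iso_alt using order_embedding_bij_trans[OF order_embedding_bij_inv[OF w] l] by blast
  show "level k \<noteq> {} \<longleftrightarrow> antichains_size P le k \<noteq> {}"
    using l unfolding order_embedding_bij_def bij_betw_def by (metis image_is_empty)
qed

lemma sum_depths_levels:
  fixes g :: "(nat \<Rightarrow> int) \<Rightarrow> complex^'d"
  assumes fin: "finite depths" and w: "\<And>k. level k \<noteq> {} \<Longrightarrow> k \<le> w"
  shows "(\<Sum>c\<in>depths. g c) = (\<Sum>i\<le>w. \<Sum>c\<in>level i. g c)"
proof -
  have "depths = (\<Union>i\<in>{..w}. level i)"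
  proof (intro equalityI subsetI)
    fix c assume c: "c \<in> depths"
    have "0 \<le> c p" using le_funD[OF depths_nonneg[OF c], of p] by simp
    then have "c \<in> level (nat (c p))" using c by (simp add: level_def)
    then show "c \<in> (\<Union>i\<in>{..w}. level i)" using w by blast
  qed (auto simp: level_def)
  moreover have "finite (level i)" for i using fin by (auto simp: level_def)
  ultimately show ?thesis
    by (simp only:) (rule sum.UNION_disjoint, auto simp: level_def)
qed

lemma level_decomposition:
  assumes fin: "finite depths" and w: "\<And>k. level k \<noteq> {} \<Longrightarrow> k \<le> w"
  shows "\<exists>u. (\<forall>i\<le>w. u i \<in> wspan (level i)) \<and> v = (\<Sum>i\<le>w. u i)"
proof -
  have "v \<in> wspan depths" using wspan_depths[OF fin] by blast
  then obtain k where k: "v = (\<Sum>c\<in>depths. k c *s wvec c)" unfolding wspan_def by blast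
  show ?thesis
    by (rule exI[of _ "\<lambda>i. \<Sum>c\<in>level i. k c *s wvec c"])
      (use k sum_depths_levels[OF fin w] in \<open>auto simp: wspan_def\<close>)
qed

lemma level_independent:
  assumes fin: "finite depths" and w: "\<And>k. level k \<noteq> {} \<Longrightarrow> k \<le> w"
    and u: "\<forall>i\<le>w. u i \<in> wspan (level i)" "(\<Sum>i\<le>w. u i) = 0" and "j \<le> w"
  shows "u j = 0"
proof -
  have "\<forall>i. \<exists>k. i \<le> w \<longrightarrow> u i = (\<Sum>c\<in>level i. k c *s wvec c)"
    using u(1) unfolding wspan_def by blast
  then obtain k where k: "\<And>i. i \<le> w \<Longrightarrow> u i = (\<Sum>c\<in>level i. k i c *s wvec c)" by metis
  \<comment> \<open>Each \<open>c\<close> lies in one level only, read off from \<open>c p\<close>,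
    so the coefficient functions of all levels merge into one.\<close>
  define l where "l = (\<lambda>c. k (nat (c p)) c)"
  have ul: "u i = (\<Sum>c\<in>level i. l c *s wvec c)" if "i \<le> w" for i
    unfolding k[OF that] by (intro sum.cong refl) (simp add: l_def level_def)
  have "(\<Sum>c\<in>depths. l c *s wvec c) = (\<Sum>i\<le>w. \<Sum>c\<in>level i. l c *s wvec c)"
    by (rule sum_depths_levels[OF fin w])
  also have "\<dots> = 0" using u(2) ul by simp
  finally have "(\<Sum>c\<in>depths. l c *s wvec c) = 0" .
  then have "l c = 0" if "c \<in> depths" for c using wvec_independent[OF fin order_refl _ that] by blast
  then show ?thesis unfolding ul[OF \<open>j \<le> w\<close>] by (intro sum.neutral) (auto simp: level_def)
qed

end

theorem theorem5p1:
  fixes n p :: nat and a :: "nat \<Rightarrow> nat \<Rightarrow> int"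
    and E F H :: "nat \<Rightarrow> complex^'d^'d"
    and P :: "'p set" and le :: "'p \<Rightarrow> 'p \<Rightarrow> bool"
  assumes cartan: "simply_laced_finite_cartan n a"
    and p: "p \<in> {1..n}"
    and rep: "serre_rep n a E F H"
    and irred: "simple_submodule {1..n} E F H UNIV"
    and hw: "\<exists>v. v \<noteq> 0 \<and> (\<forall>i\<in>{1..n}. E i *v v = 0 \<and> H i *v v = fund_weight p i *s v)"
    and minuscule: "weights_of {1..n} H UNIV \<subseteq> weyl_orbit n a (fund_weight p)"
    and Pfin: "finite P" and Pord: "partial_order_on' P le"
    and JP: "order_iso (weights_of {1..n} H UNIV) (weight_le {1..n} a)
                       (order_ideals P le) (\<subseteq>)"
  shows "\<exists>V :: nat \<Rightarrow> (complex^'d) set.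
           (\<forall>i\<le>width P le. simple_submodule ({1..n} - {p}) E F H (V i)) \<and>
           (\<forall>v. \<exists>u. (\<forall>i\<le>width P le. u i \<in> V i) \<and> v = (\<Sum>i\<le>width P le. u i)) \<and>
           (\<forall>u. (\<forall>i\<le>width P le. u i \<in> V i) \<and> (\<Sum>i\<le>width P le. u i) = 0
                 \<longrightarrow> (\<forall>i\<le>width P le. u i = 0)) \<and>
           (\<forall>i\<le>width P le.
              order_iso (weights_of ({1..n} - {p}) H (V i)) (weight_le ({1..n} - {p}) a)
                        (antichains_size P le i) (antichain_le P le i))"
proof -
  interpret minuscule_rep n a p E F H
    by unfold_locales (fact cartan p rep irred hw minuscule)+
  \<comment> \<open>Finiteness of \<open>P\<close> bounds the number of weights through
    \<open>JP\<close>.\<close>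
  have "finite (order_ideals P le)"
    by (rule finite_subset[of _ "Pow P"]) (use Pfin in \<open>auto simp: order_ideals_def\<close>)
  then have "finite (weights_of {1..n} H UNIV)"
    using JP unfolding order_iso_def by (auto dest: bij_betw_finite)
  then have fin: "finite depths" by (rule finite_depths)
  obtain h where h: "order_embedding_bij h roots1 (\<lambda>x y. y \<le> x) P le"
    using roots1_iso[OF fin Pord JP] by blast
  have ne: "level k \<noteq> {} \<longleftrightarrow> k \<le> width P le" for k
    using level_iso(2)[OF fin h] antichains_size_nonempty_iff[OF Pfin] by metis
  then have w: "\<And>k. level k \<noteq> {} \<Longrightarrow> k \<le> width P le" by blast
  show ?thesis
  proof (intro exI[of _ "\<lambda>i. wspan (level i)"] conjI allI impI)
    show "simple_submodule ({1..n} - {p}) E F H (wspan (level i))" if "i \<le> width P le" for i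
      using simple_level[OF fin] ne that by blast
    show "\<exists>u. (\<forall>i\<le>width P le. u i \<in> wspan (level i)) \<and> v = (\<Sum>i\<le>width P le. u i)" for v
      by (rule level_decomposition[OF fin w])
    show "u i = 0" if "(\<forall>i\<le>width P le. u i \<in> wspan (level i)) \<and> (\<Sum>i\<le>width P le. u i) = 0" "i \<le> width P le" for u i
      using level_independent[OF fin w] that by blast
    show "order_iso (weights_of ({1..n} - {p}) H (wspan (level i))) (weight_le ({1..n} - {p}) a)
        (antichains_size P le i) (antichain_le P le i)" for i
      by (rule level_iso(1)[OF fin h])
  qed
qed

end
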